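(* Let $1<p<\infty$, $m,N\in\mathbb{N}$, let $(u_n)$ be a bounded sequence in $W^{m,p}(\mathbb{R}^N)$, and let $N(n)$, $\Lambda$, $w^{(l)}$, $y^{(l)}_{N(n)}$ be a profile decomposition of $(u_n)$ in $W^{m,p}(\mathbb{R}^N)$ (as defined in the context). Let $\alpha\in\mathbb{N}_0^N$ with $|\alpha|<m$, and let $f_\alpha\in C(\mathbb{R};\mathbb{R})$ satisfy: for every $\varepsilon>0$ there exist $q=q_{\alpha,\varepsilon}\in\,]p,p^*_{m-|\alpha|}[$ and $C=C_{\alpha,\varepsilon}>0$ such that for all $s\in\mathbb{R}$, $|f_\alpha(s)|\le\varepsilon(|s|^{p-1}+|s|^{p^*_{m-|\alpha|}-1})+C|s|^{q-1}$ if $p^*_{m-|\alpha|}<\infty$, and $|f_\alpha(s)|\le\varepsilon|s|^{p-1}+C|s|^{q-1}$ if $p^*_{m-|\alpha|}=\infty$. Let $F_\alpha(s)=\int_0^sf_\alpha(t)\,dt$. Then $$\lim_{n\to\infty}\int_{\mathbb{R}^N}F_\alpha(\partial^\alpha u_{N(n)})\,dx=\sum_{l=0}^\Lambda\int_{\mathbb{R}^N}F_\alpha(\partial^\alpha w^{(l)})\,dx,$$ where in particular the limit on the left exists and the series on the right converges.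
   Context: $W^{m,p}(\mathbb{R}^N)$ has norm $(\sum_{|\beta|\le m}\|\partial^\beta u\|_{L^p}^p)^{1/p}$; $p^*_k=pN/(N-kp)$ if $N>kp$, $=\infty$ if $N\le kp$. Profile decomposition of a bounded sequence $(u_n)$ in $W^{m,p}(\mathbb{R}^N)$: data consisting of $\Lambda\in\mathbb{N}\cup\{0,+\infty\}$, a subsequence $(u_{N(n)})_{n\in\mathbb{N}_0}$, $w^{(l)}\in W^{m,p}(\mathbb{R}^N)$ for $l\in\mathbb{N}_0^{<\Lambda+1}$ and $y^{(l)}_{N(n)}\in\mathbb{Z}^N$ for $l\in\mathbb{N}_0^{<\Lambda+1}$, $n\ge l$, such that: (i) $y^{(0)}_{N(n)}=0$ and $w^{(l)}\ne0$ for $l\ge1$; (ii) $|y^{(l)}_{N(n)}-y^{(k)}_{N(n)}|\to\infty$ as $n\to\infty$ for $l\ne k$; (iii) $u_{N(n)}(\cdot+y^{(l)}_{N(n)})\to w^{(l)}$ weakly in $W^{m,p}$ and a.e.; (iv) with $r^L_{N(n)}:=u_{N(n)}-\sum_{l=0}^Lw^{(l)}(\cdot-y^{(l)}_{N(n)})$, $r^L_{N(n)}(\cdot+y^{(l)}_{N(n)})\to0$ weakly in $W^{m,p}$ and a.e. for $0\le l\le L$; (v) $\lim_{L\to\Lambda}\limsup_{n\to\infty}\|\partial^\beta r^L_{N(n)}\|_{L^q(\mathbb{R}^N)}=0$ for every multi-index $|\beta|<m$ and every $q\in\,]p,p^*_{m-|\beta|}[$. (Such data exist for every bounded sequence, by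 the profile decomposition theorem in $W^{m,p}(\mathbb{R}^N)$.) Here $\mathbb{N}_0^{<\Lambda+1}=\{0,\dots,\Lambda\}$ if $\Lambda<\infty$, $=\mathbb{N}_0$ otherwise, and for $\Lambda<\infty$, $\lim_{L\to\Lambda}a_L$ means $a_\Lambda$. *)

theory Defs
  imports "HOL-Analysis.Analysis" "HOL-Library.Extended_Nat"
begin

type_synonym 'n mindex = "'n \<Rightarrow> nat"

definition mlen :: "'n::finite mindex \<Rightarrow> nat" where
  "mlen \<beta> = (\<Sum>i\<in>UNIV. \<beta> i)"

definition pd :: "'n::finite \<Rightarrow> (real^'n \<Rightarrow> real) \<Rightarrow> real^'n \<Rightarrow> real" where
  "pd i f x = deriv (\<lambda>t. f (x + t *\<^sub>R axis i 1)) 0"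

definition pdlist :: "'n::finite list \<Rightarrow> (real^'n \<Rightarrow> real) \<Rightarrow> real^'n \<Rightarrow> real" where
  "pdlist ds f = foldr pd ds f"

definition smooth_fun :: "(real^'n::finite \<Rightarrow> real) \<Rightarrow> bool" where
  "smooth_fun \<phi> \<longleftrightarrow>
     (\<forall>ds i x. (\<lambda>t. pdlist ds \<phi> (x + t *\<^sub>R axis i 1)) differentiable (at 0)) \<and>
     (\<forall>ds. continuous_on UNIV (pdlist ds \<phi>))"

definition test_fun :: "(real^'n::finite \<Rightarrow> real) \<Rightarrow> bool" where
  "test_fun \<phi> \<longleftrightarrow> smooth_fun \<phi> \<and> compact (closure {x. \<phi> x \<noteq> 0})"

text \<open>Classical derivative partial^beta (order of differentiation is irrelevant for smooth functions).\<close>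
definition cderiv :: "'n::finite mindex \<Rightarrow> (real^'n \<Rightarrow> real) \<Rightarrow> real^'n \<Rightarrow> real" where
  "cderiv \<beta> \<phi> = pdlist (SOME ds. \<forall>i. count_list ds i = \<beta> i) \<phi>"

definition locint :: "(real^'n::finite \<Rightarrow> real) \<Rightarrow> bool" where
  "locint f \<longleftrightarrow> f \<in> borel_measurable lborel \<and> (\<forall>K. compact K \<longrightarrow> set_integrable lborel K f)"

definition is_weak_deriv :: "'n::finite mindex \<Rightarrow> (real^'n \<Rightarrow> real) \<Rightarrow> (real^'n \<Rightarrow> real) \<Rightarrow> bool" where
  "is_weak_deriv \<beta> u v \<longleftrightarrow> locint u \<and> locint v \<and>
     (\<forall>\<phi>. test_fun \<phi> \<longrightarrow>
        (\<integral>x. u x * cderiv \<beta> \<phi> x \<partial>lborel) = (-1) ^ mlen \<beta> * (\<integral>x. v x * \<phi> x \<partial>lborel))"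

text \<open>A chosen representative of the weak derivative (unique up to null sets).\<close>
definition wd :: "'n::finite mindex \<Rightarrow> (real^'n \<Rightarrow> real) \<Rightarrow> real^'n \<Rightarrow> real" where
  "wd \<beta> u = (SOME v. is_weak_deriv \<beta> u v)"

definition Lp :: "real \<Rightarrow> (real^'n::finite \<Rightarrow> real) \<Rightarrow> bool" where
  "Lp p f \<longleftrightarrow> f \<in> borel_measurable lborel \<and> integrable lborel (\<lambda>x. \<bar>f x\<bar> powr p)"

definition Lp_norm :: "real \<Rightarrow> (real^'n::finite \<Rightarrow> real) \<Rightarrow> real" where
  "Lp_norm p f = (\<integral>x. \<bar>f x\<bar> powr p \<partial>lborel) powr (1 / p)"

definition sobolev :: "nat \<Rightarrow> real \<Rightarrow> (real^'n::finite \<Rightarrow> real) \<Rightarrow> bool" where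
  "sobolev m p u \<longleftrightarrow> (\<forall>\<beta>::'n mindex. mlen \<beta> \<le> m \<longrightarrow> (\<exists>v. is_weak_deriv \<beta> u v \<and> Lp p v))"

definition sob_norm :: "nat \<Rightarrow> real \<Rightarrow> (real^'n::finite \<Rightarrow> real) \<Rightarrow> real" where
  "sob_norm m p u = (\<Sum>\<beta>\<in>{\<beta>::'n mindex. mlen \<beta> \<le> m}. Lp_norm p (wd \<beta> u) powr p) powr (1 / p)"

definition sob_weak_conv :: "nat \<Rightarrow> real \<Rightarrow> (nat \<Rightarrow> real^'n::finite \<Rightarrow> real) \<Rightarrow> (real^'n \<Rightarrow> real) \<Rightarrow> bool" where
  "sob_weak_conv m p us u \<longleftrightarrow> sobolev m p u \<and> (\<forall>n. sobolev m p (us n)) \<and>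
     (\<forall>\<beta>::'n mindex. mlen \<beta> \<le> m \<longrightarrow> (\<forall>g. Lp (p / (p - 1)) g \<longrightarrow>
        (\<lambda>n. \<integral>x. wd \<beta> (us n) x * g x \<partial>lborel) \<longlonglongrightarrow> (\<integral>x. wd \<beta> u x * g x \<partial>lborel)))"

definition ae_conv :: "(nat \<Rightarrow> real^'n::finite \<Rightarrow> real) \<Rightarrow> (real^'n \<Rightarrow> real) \<Rightarrow> bool" where
  "ae_conv us u \<longleftrightarrow> (AE x in lborel. (\<lambda>n. us n x) \<longlonglongrightarrow> u x)"

definition pstar :: "nat \<Rightarrow> real \<Rightarrow> nat \<Rightarrow> ereal" where
  "pstar N p k = (if real N > real k * p then ereal (p * real N / (real N - real k * p)) else \<infinity>)"

text \<open>Remainder r^L_{N(n)} (with nu n = N(n) and y l n = y^(l)_{N(n)}).\<close>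
definition remainder :: "(nat \<Rightarrow> real^'n::finite \<Rightarrow> real) \<Rightarrow> (nat \<Rightarrow> nat) \<Rightarrow> (nat \<Rightarrow> real^'n \<Rightarrow> real)
    \<Rightarrow> (nat \<Rightarrow> nat \<Rightarrow> real^'n) \<Rightarrow> nat \<Rightarrow> nat \<Rightarrow> real^'n \<Rightarrow> real" where
  "remainder u \<nu> w y L n = (\<lambda>x. u (\<nu> n) x - (\<Sum>l\<le>L. w l (x - y l n)))"

definition profile_decomp :: "nat \<Rightarrow> real \<Rightarrow> (nat \<Rightarrow> real^'n::finite \<Rightarrow> real) \<Rightarrow> enat \<Rightarrow> (nat \<Rightarrow> nat)
    \<Rightarrow> (nat \<Rightarrow> real^'n \<Rightarrow> real) \<Rightarrow> (nat \<Rightarrow> nat \<Rightarrow> real^'n) \<Rightarrow> bool" where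
  "profile_decomp m p u \<Lambda> \<nu> w y \<longleftrightarrow>
     strict_mono \<nu> \<and>
     (\<forall>l. enat l \<le> \<Lambda> \<longrightarrow> sobolev m p (w l)) \<and>
     (\<forall>l n. enat l \<le> \<Lambda> \<longrightarrow> l \<le> n \<longrightarrow> (\<forall>i. y l n $ i \<in> \<int>)) \<and>
     (\<forall>n. y 0 n = 0) \<and>
     (\<forall>l. enat l \<le> \<Lambda> \<longrightarrow> l \<ge> 1 \<longrightarrow> \<not> (AE x in lborel. w l x = 0)) \<and>
     (\<forall>l k. enat l \<le> \<Lambda> \<longrightarrow> enat k \<le> \<Lambda> \<longrightarrow> l \<noteq> k \<longrightarrow>
        filterlim (\<lambda>n. norm (y l n - y k n)) at_top sequentially) \<and>
     (\<forall>l. enat l \<le> \<Lambda> \<longrightarrow>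
        sob_weak_conv m p (\<lambda>n x. u (\<nu> n) (x + y l n)) (w l) \<and>
        ae_conv (\<lambda>n x. u (\<nu> n) (x + y l n)) (w l)) \<and>
     (\<forall>L l. enat L \<le> \<Lambda> \<longrightarrow> l \<le> L \<longrightarrow>
        sob_weak_conv m p (\<lambda>n x. remainder u \<nu> w y L n (x + y l n)) (\<lambda>x. 0) \<and>
        ae_conv (\<lambda>n x. remainder u \<nu> w y L n (x + y l n)) (\<lambda>x. 0)) \<and>
     (\<forall>\<beta>::'n mindex. \<forall>q. mlen \<beta> < m \<longrightarrow> p < q \<longrightarrow> ereal q < pstar CARD('n) p (m - mlen \<beta>) \<longrightarrow>
        (let a = (\<lambda>L. limsup (\<lambda>n. ereal (Lp_norm q (wd \<beta> (remainder u \<nu> w y L n))))) in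
          (if \<Lambda> = \<infinity> then a \<longlonglongrightarrow> 0 else a (the_enat \<Lambda>) = 0)))"

end

theory Submission
  imports Defs "HOL-Computational_Algebra.Polynomial"
begin

text \<open>
  Write \<open>v\<^sub>n = \<partial>\<^sup>\<alpha> u\<^sub>N\<^sub>(\<^sub>n\<^sub>)\<close>, \<open>W\<^sub>l = \<partial>\<^sup>\<alpha> w\<^sup>(\<^sup>l\<^sup>)\<close> and \<open>S\<^sub>L\<close> for the sum of the first
  translated profiles \<open>W\<^sub>l(\<cdot> - y\<^sub>l)\<close>.  By the Sobolev embedding \<open>(v\<^sub>n)\<close> is bounded in \<open>L\<^sup>r\<close> for
  all \<open>p \<le> r \<le> p\<^sup>*\<close>, \<open>r < \<infinity>\<close>.  Weak lower semicontinuity on disjoint translates of bounded sets gives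
  \<open>\<Sum>\<^sub>l \<parallel>W\<^sub>l\<parallel>\<^sub>r\<^sup>r \<le> sup\<^sub>n \<parallel>v\<^sub>n\<parallel>\<^sub>r\<^sup>r\<close>, so \<open>S\<^sub>L\<close> is bounded in \<open>L\<^sup>r\<close> uniformly in \<open>L\<close> for large \<open>n\<close>; no
  local compactness is needed.  By the growth of \<open>f\<close>, \<open>\<integral>F(v\<^sub>n) - \<integral>F(S\<^sub>L)\<close> is small because
  \<open>v\<^sub>n - S\<^sub>L\<close> is small in \<open>L\<^sup>q\<close>, and \<open>\<integral>F(S\<^sub>L)\<close> tends to \<open>\<Sum>\<^sub>l\<^sub>\<le>\<^sub>L \<integral>F(W\<^sub>l)\<close> because products of profiles
  with diverging centres vanish in the limit.

  The Sobolev embedding, including the critical exponent, is derived without smooth approximation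
  from \<open>\<parallel>u(\<cdot> + z) - u\<parallel>\<^sub>p \<le> C \<bar>z\<bar>\<close> alone: the dyadic truncations
  \<open>u\<^sub>j = min (max (\<bar>u\<bar> - 2\<^sup>j) 0) 2\<^sup>j\<close> satisfy
  \<open>\<Sum>\<^sub>j \<bar>u\<^sub>j(x + z) - u\<^sub>j(x)\<bar>\<^sup>p \<le> \<bar>u(x + z) - u(x)\<bar>\<^sup>p\<close>, and comparing \<open>u\<^sub>j\<close> with its averages over cubes
  of volume about \<open>2 \<bar>{\<bar>u\<bar> > 2\<^sup>j}\<bar>\<close> bounds \<open>\<bar>{\<bar>u\<bar> > 2\<^sup>j\<^sup>+\<^sup>1}\<bar>\<close> in terms of \<open>\<bar>{\<bar>u\<bar> > 2\<^sup>j}\<bar>\<close>.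
\<close>

text \<open>The remainder is known to vanish only for exponents strictly between \<open>p\<close>
  and the critical one, whereas \<open>f\<close> also grows with the endpoint powers. At the
  endpoints nothing is small except the prefactor \<epsilon>, so the masses there must be bounded by
  a constant fixed before \<epsilon>. Hence the weight put on the critical embedding and on a bound
  for \<open>S\<^sub>L\<close> that does not depend on \<open>L\<close>. The constants are chosen in
  this order: endpoint masses, \<epsilon>, then \<open>q\<close> and \<open>C\<close>, a Young
  parameter, the admissible size of the remainder, \<open>L\<close>, and finally \<open>n\<close>.

  The outcome is a single estimate: the integral at \<open>n\<close> and the partial sum up to
  \<open>L\<close> differ by less than \<delta> for large \<open>L\<close> and then for
  \<open>n\<close> large depending on \<open>L\<close>. Comparing two partial sums through one
  common \<open>n\<close> gives convergence of the series, and the limit in \<open>n\<close>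
  follows. Since \<open>wd\<close> is a Hilbert choice, identities between derivatives hold only
  almost everywhere and are all drawn from uniqueness of weak derivatives.\<close>

abbreviation nn_Lp_mass :: "real \<Rightarrow> (real^'n::finite \<Rightarrow> real) \<Rightarrow> ennreal" where
  "nn_Lp_mass r f \<equiv> \<integral>\<^sup>+x. ennreal (\<bar>f x\<bar> powr r) \<partial>lborel"

abbreviation Lp_mass :: "real \<Rightarrow> (real^'n::finite \<Rightarrow> real) \<Rightarrow> real" where
  "Lp_mass r f \<equiv> \<integral>x. \<bar>f x\<bar> powr r \<partial>lborel"

abbreviation cube :: "real \<Rightarrow> (real^'n::finite) set" where
  "cube r \<equiv> cbox (\<chi> i. - r) (\<chi> i. r)"

section \<open>Product test functions\<close>

text \<open>Counting derivatives turns closure under products and affine substitution into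
  inductions on the order with the functions generalised: the derivative of a product is again a sum
  of products, of one order less.\<close>

primrec times_diff :: "nat \<Rightarrow> (real \<Rightarrow> real) \<Rightarrow> bool" where
  "times_diff 0 g \<longleftrightarrow> True"
| "times_diff (Suc n) g \<longleftrightarrow> (\<forall>x. g differentiable at x) \<and> times_diff n (deriv g)"

definition smooth1 :: "(real \<Rightarrow> real) \<Rightarrow> bool" where
  "smooth1 g \<longleftrightarrow> (\<forall>n. times_diff n g)"

lemma smooth1_differentiable: "smooth1 g \<Longrightarrow> g differentiable at x"
  by (metis smooth1_def times_diff.simps(2))

lemma smooth1_has_derivative: "smooth1 g \<Longrightarrow> (g has_real_derivative deriv g x) (at x)"
  by (simp add: DERIV_deriv_iff_real_differentiable smooth1_differentiable)

lemma smooth1_deriv: "smooth1 g \<Longrightarrow> smooth1 (deriv g)"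
  by (metis smooth1_def times_diff.simps(2))

lemma smooth1_funpow_deriv: "smooth1 g \<Longrightarrow> smooth1 ((deriv ^^ n) g)"
  by (induction n) (auto intro: smooth1_deriv)

lemma smooth1_continuous: "smooth1 g \<Longrightarrow> continuous_on S g"
  by (meson smooth1_differentiable differentiable_imp_continuous_within continuous_at_imp_continuous_on)

lemma times_diff_SucD: "times_diff (Suc n) g \<Longrightarrow> times_diff n g"
  by (induction n arbitrary: g) auto

lemma times_diff_add:
  "times_diff n g \<Longrightarrow> times_diff n h \<Longrightarrow> times_diff n (\<lambda>x. g x + h x)"
proof (induction n arbitrary: g h)
  case (Suc n)
  have "deriv (\<lambda>x. g x + h x) = (\<lambda>x. deriv g x + deriv h x)"
    using Suc.prems by (auto simp: field_differentiable_def real_differentiable_def intro!: deriv_add)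
  then show ?case using Suc by (auto intro!: differentiable_add)
qed simp

lemma times_diff_mult:
  "times_diff n g \<Longrightarrow> times_diff n h \<Longrightarrow> times_diff n (\<lambda>x. g x * h x)"
proof (induction n arbitrary: g h)
  case (Suc n)
  have "deriv (\<lambda>x. g x * h x) = (\<lambda>x. g x * deriv h x + deriv g x * h x)"
    using Suc.prems by (auto simp: field_differentiable_def real_differentiable_def intro!: deriv_mult)
  moreover have "times_diff n (\<lambda>x. g x * deriv h x + deriv g x * h x)"
    using Suc.prems times_diff_SucD[OF Suc.prems(1)] times_diff_SucD[OF Suc.prems(2)]
    by (intro times_diff_add Suc.IH) simp_all
  ultimately show ?case using Suc.prems by (simp add: differentiable_mult)
qed simp

lemma times_diff_const: "times_diff n (\<lambda>x. c)"
  by (induction n arbitrary: c) auto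

lemma has_derivative_affine:
  assumes "\<And>x. (g::real\<Rightarrow>real) differentiable at x"
  shows "((\<lambda>t. g (c * t + d)) has_real_derivative c * deriv g (c * t + d)) (at t)"
proof -
  have "(g has_real_derivative deriv g (c * t + d)) (at (c * t + d))"
    by (simp add: DERIV_deriv_iff_real_differentiable assms)
  moreover have "((\<lambda>t. c * t + d) has_real_derivative c) (at t)"
    by (auto intro!: derivative_eq_intros)
  ultimately show ?thesis
    using DERIV_chain2[of g "deriv g (c * t + d)" "\<lambda>t. c * t + d" t c UNIV] by (simp add: mult.commute)
qed

lemma deriv_affine:
  "(\<And>x. (g::real\<Rightarrow>real) differentiable at x) \<Longrightarrow>
    deriv (\<lambda>t. g (c * t + d)) = (\<lambda>t. c * deriv g (c * t + d))"
  by (intro ext DERIV_imp_deriv has_derivative_affine)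

lemma times_diff_affine: "times_diff n g \<Longrightarrow> times_diff n (\<lambda>t. g (c * t + d))"
proof (induction n arbitrary: g)
  case (Suc n)
  have d: "g differentiable at x" for x using Suc.prems by simp
  have "(\<lambda>t. g (c * t + d)) differentiable at x" for x
    using has_derivative_affine[OF d] real_differentiable_def by blast
  moreover have "times_diff n (\<lambda>t. c * deriv g (c * t + d))"
    using Suc by (intro times_diff_mult times_diff_const) simp
  ultimately show ?case by (simp add: deriv_affine[OF d])
qed simp

lemma smooth1_mult: "smooth1 g \<Longrightarrow> smooth1 h \<Longrightarrow> smooth1 (\<lambda>x. g x * h x)"
  by (simp add: smooth1_def times_diff_mult)

lemma smooth1_affine: "smooth1 g \<Longrightarrow> smooth1 (\<lambda>t. g (c * t + d))"
  by (simp add: smooth1_def times_diff_affine)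

lemma smooth1_translate: "smooth1 g \<Longrightarrow> smooth1 (\<lambda>t. g (t - d))"
  using smooth1_affine[of g 1 "- d"] by simp

lemma deriv_translate: "smooth1 g \<Longrightarrow> deriv (\<lambda>t. g (t - d)) = (\<lambda>t. deriv g (t - d))"
  using deriv_affine[of g 1 "- d"] by (simp add: smooth1_differentiable)

lemma smooth1_diff: "smooth1 g \<Longrightarrow> smooth1 h \<Longrightarrow> smooth1 (\<lambda>x. g x - h x)"
  unfolding smooth1_def
  using times_diff_add[of _ g "\<lambda>x. (-1) * h x"] times_diff_mult[of _ "\<lambda>x. -1" h] times_diff_const[of _ "-1"]
  by simp

text \<open>All further derivatives of \<open>G\<close> are those of \<open>g\<close>, so one order
  is gained and \<open>times_diff_SucD\<close> discards the surplus. This makes the primitive in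
  \<open>weak_deriv_line\<close> an admissible test factor.\<close>

lemma smooth1_antiderivative:
  assumes "smooth1 g" "\<And>x. (G has_real_derivative g x) (at x)"
  shows "smooth1 G"
proof -
  have "deriv G = g" using assms(2) by (auto intro: DERIV_imp_deriv)
  then have "times_diff (Suc n) G" for n
    using assms by (auto simp: smooth1_def real_differentiable_def)
  then show ?thesis unfolding smooth1_def using times_diff_SucD by blast
qed

text \<open>The functions P(1/t) exp(-1/t), extended by 0, are closed under differentiation because
  the polynomial absorbs every power of 1/t. Smoothness is then an induction on the order with
  \<open>P\<close> arbitrary.\<close>

definition poly_exp_inv :: "real poly \<Rightarrow> real \<Rightarrow> real" where
  "poly_exp_inv P t = (if t > 0 then poly P (1 / t) * exp (- 1 / t) else 0)"

lemma poly_times_exp_minus_tendsto_0: "((\<lambda>u::real. poly P u * exp (- u)) \<longlongrightarrow> 0) at_top"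
proof -
  have "((\<lambda>u::real. (\<Sum>i\<le>degree P. coeff P i * (u ^ i / exp u))) \<longlongrightarrow> (\<Sum>i\<le>degree P. coeff P i * 0)) at_top"
    by (intro tendsto_intros tendsto_power_div_exp_0)
  then show ?thesis
    by (simp add: poly_altdef sum_distrib_right exp_minus divide_inverse mult.assoc)
qed

text \<open>With u = 1/t one has du/dt = -u^2, so P(u) exp(-u) has derivative u^2 (P - P')(u)
  exp(-u); \<open>[:0,0,1:]\<close> is the polynomial u^2. Only t = 0 calls for a limit.\<close>

lemma poly_exp_inv_has_derivative:
  "(poly_exp_inv P has_real_derivative poly_exp_inv ([:0,0,1:] * (P - pderiv P)) t) (at t)"
proof -
  consider "t > 0" | "t < 0" | "t = 0" by linarith
  then show ?thesis
  proof cases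
    case 1
    have "((\<lambda>t. poly P (1 / t) * exp (- 1 / t)) has_real_derivative
       poly_exp_inv ([:0,0,1:] * (P - pderiv P)) t) (at t)"
      using 1 by (auto intro!: derivative_eq_intros poly_DERIV[THEN DERIV_chain2]
          simp: poly_exp_inv_def field_simps power2_eq_square)
    then show ?thesis
      by (rule DERIV_cong_ev[THEN iffD1, rotated -1, OF _ refl _ refl])
        (use 1 in \<open>auto simp: poly_exp_inv_def intro!: eventually_mono[OF eventually_nhds_in_open[of "{0<..}"]]\<close>)
  next
    case 2
    have "((\<lambda>t. 0) has_real_derivative poly_exp_inv ([:0,0,1:] * (P - pderiv P)) t) (at t)"
      using 2 by (auto simp: poly_exp_inv_def)
    then show ?thesis
      by (rule DERIV_cong_ev[THEN iffD1, rotated -1, OF _ refl _ refl])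
        (use 2 in \<open>auto simp: poly_exp_inv_def intro!: eventually_mono[OF eventually_nhds_in_open[of "{..<0}"]]\<close>)
  next
    case 3
    have "((\<lambda>h. poly_exp_inv P h / h) \<longlongrightarrow> 0) (at_right 0)"
    proof -
      \<comment> \<open>\<open>pCons 0 P\<close> is u P(u), the extra u being the 1/h of the
        difference quotient.\<close>
      have "((\<lambda>h. poly (pCons 0 P) (inverse h) * exp (- inverse h)) \<longlongrightarrow> 0) (at_right (0::real))"
        by (rule filterlim_compose[OF poly_times_exp_minus_tendsto_0 filterlim_inverse_at_top_right])
      then show ?thesis
        by (rule Lim_transform_eventually)
          (auto simp: eventually_at_right_field poly_exp_inv_def field_simps intro!: exI[of _ 1])
    qed
    moreover have "((\<lambda>h. poly_exp_inv P h / h) \<longlongrightarrow> 0) (at_left 0)"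
      by (rule Lim_transform_eventually[OF tendsto_const])
        (auto simp: eventually_at_left_field poly_exp_inv_def intro!: exI[of _ "-1"])
    ultimately have "((\<lambda>h. poly_exp_inv P h / h) \<longlongrightarrow> 0) (at 0)"
      by (simp add: filterlim_split_at)
    then show ?thesis using 3 by (simp add: DERIV_def poly_exp_inv_def)
  qed
qed

lemma smooth1_poly_exp_inv: "smooth1 (poly_exp_inv P)"
  unfolding smooth1_def
proof
  fix n show "times_diff n (poly_exp_inv P)"
  proof (induction n arbitrary: P)
    case (Suc n)
    have "deriv (poly_exp_inv P) = poly_exp_inv ([:0,0,1:] * (P - pderiv P))"
      using poly_exp_inv_has_derivative by (auto intro: DERIV_imp_deriv)
    then show ?case using Suc poly_exp_inv_has_derivative
      by (auto simp: real_differentiable_def)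
  qed simp
qed

section \<open>Products of one-variable functions and their partial derivatives\<close>

definition prodf :: "('n \<Rightarrow> real \<Rightarrow> real) \<Rightarrow> real^'n::finite \<Rightarrow> real" where
  "prodf g x = (\<Prod>i\<in>UNIV. g i (x $ i))"

definition ptest :: "('n::finite \<Rightarrow> real \<Rightarrow> real) \<Rightarrow> bool" where
  "ptest g \<longleftrightarrow> (\<forall>i. smooth1 (g i)) \<and> (\<exists>r. \<forall>i t. r < \<bar>t\<bar> \<longrightarrow> g i t = 0)"

lemma prodf_insert: "prodf g x = g i (x $ i) * (\<Prod>j\<in>UNIV - {i}. g j (x $ j))"
  unfolding prodf_def by (simp add: prod.remove)

lemma prodf_axis_derivative:
  assumes "\<And>i. smooth1 (g i)"
  shows "((\<lambda>t. prodf g (x + t *\<^sub>R axis i 1)) has_real_derivative prodf (g(i := deriv (g i))) x) (at 0)"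
proof -
  have eq: "(\<lambda>t. prodf g (x + t *\<^sub>R axis i 1)) =
     (\<lambda>t. g i (x $ i + t) * (\<Prod>j\<in>UNIV - {i}. g j (x $ j)))"
    by (auto simp: prodf_insert[of g _ i] axis_def intro!: prod.cong)
  have "(g i has_real_derivative deriv (g i) (x $ i + 0)) (at (x $ i + 0))"
    by (rule smooth1_has_derivative[OF assms])
  then have "((\<lambda>t. g i (x $ i + t)) has_real_derivative deriv (g i) (x $ i + 0) * 1) (at 0)"
    by (rule DERIV_chain2) (auto intro!: derivative_eq_intros)
  from DERIV_cmult_right[OF this, of "\<Prod>j\<in>UNIV - {i}. g j (x $ j)"]
  show ?thesis unfolding eq by (simp add: prodf_insert[of _ x i])
qed

lemma pd_prodf: "(\<And>i. smooth1 (g i)) \<Longrightarrow> pd i (prodf g) = prodf (g(i := deriv (g i)))"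
  unfolding pd_def by (auto intro!: DERIV_imp_deriv prodf_axis_derivative)

text \<open>Each partial derivative acts on one factor, so an iterated derivative sees the list only
  through its multiplicities.\<close>

lemma pdlist_prodf:
  assumes "\<And>i. smooth1 (g i)"
  shows "pdlist ds (prodf g) = prodf (\<lambda>i. (deriv ^^ count_list ds i) (g i))"
proof (induction ds)
  case (Cons d ds)
  have "pdlist (d # ds) (prodf g) = pd d (prodf (\<lambda>i. (deriv ^^ count_list ds i) (g i)))"
    using Cons by (simp add: pdlist_def)
  also have "\<dots> = prodf ((\<lambda>i. (deriv ^^ count_list ds i) (g i))(d := deriv ((deriv ^^ count_list ds d) (g d))))"
    by (rule pd_prodf) (auto intro: smooth1_funpow_deriv assms)
  also have "((\<lambda>i. (deriv ^^ count_list ds i) (g i))(d := deriv ((deriv ^^ count_list ds d) (g d)))) =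
    (\<lambda>i. (deriv ^^ count_list (d # ds) i) (g i))" by auto
  finally show ?case .
qed (simp add: pdlist_def)

lemma continuous_on_prodf:
  assumes "\<And>i. smooth1 (g i)" shows "continuous_on S (prodf g)"
proof -
  have "continuous_on S (\<lambda>x. g i (x $ i))" for i
    by (rule continuous_on_compose2[of UNIV "g i" S "\<lambda>x. x $ i"])
      (simp_all add: smooth1_continuous assms continuous_on_component)
  then show ?thesis unfolding prodf_def by (intro continuous_on_prod)
qed

lemma ptest_bounded_support:
  assumes "ptest g"
  obtains r where "r > 0" "\<And>x. x \<notin> cube r \<Longrightarrow> prodf g x = 0"
proof -
  obtain r where r: "\<And>i t. r < \<bar>t\<bar> \<Longrightarrow> g i t = 0" using assms by (auto simp: ptest_def)
  show ?thesis
  proof (rule that[of "max r 1"])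
    fix x :: "real^'a" assume "x \<notin> cbox (\<chi> i. - (max r 1)) (\<chi> i. (max r 1))"
    then obtain i where "\<not> (- max r 1 \<le> x $ i \<and> x $ i \<le> max r 1)"
      unfolding mem_box_cart vec_lambda_beta by blast
    then have "r < \<bar>x $ i\<bar>" by linarith
    then have "g i (x $ i) = 0" by (rule r)
    then show "prodf g x = 0" unfolding prodf_def by (auto intro!: prod_zero)
  qed auto
qed

lemma test_fun_prodf:
  assumes "ptest g"
  shows "test_fun (prodf g)"
proof -
  have sm: "\<And>i. smooth1 (g i)" using assms by (auto simp: ptest_def)
  have "(\<lambda>t. pdlist ds (prodf g) (x + t *\<^sub>R axis i 1)) differentiable at 0" for ds x i
    unfolding pdlist_prodf[OF sm] real_differentiable_def
    using prodf_axis_derivative[of "\<lambda>i. (deriv ^^ count_list ds i) (g i)" x i]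
      smooth1_funpow_deriv sm by blast
  moreover have "continuous_on UNIV (pdlist ds (prodf g))" for ds
    unfolding pdlist_prodf[OF sm] by (intro continuous_on_prodf smooth1_funpow_deriv sm)
  moreover have "compact (closure {x. prodf g x \<noteq> 0})"
  proof -
    obtain r where "\<And>x. x \<notin> cube r \<Longrightarrow> prodf g x = 0"
      using ptest_bounded_support[OF assms] by metis
    then have "{x. prodf g x \<noteq> 0} \<subseteq> cube r" by auto
    then show ?thesis by (meson bounded_cbox bounded_subset compact_closure)
  qed
  ultimately show ?thesis by (auto simp: test_fun_def smooth_fun_def)
qed

lemma ex_list_count: "\<exists>ds. \<forall>i::'n::finite. count_list ds i = \<beta> i"
proof -
  obtain ds where ds: "mset ds = (\<Sum>i\<in>UNIV. replicate_mset (\<beta> i) i)" using ex_mset by blast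
  have "count_list ds i = \<beta> i" for i
  proof -
    have "count_list ds i = count (mset ds) i" by (simp add: count_mset count_list_eq_length_filter)
    also have "\<dots> = (\<Sum>j\<in>UNIV. if j = i then \<beta> j else 0)"
      unfolding ds count_sum by (intro sum.cong) auto
    finally show ?thesis by simp
  qed
  then show ?thesis by blast
qed

text \<open>\<open>cderiv\<close> fixes an order of differentiation by choice;
  \<open>ex_list_count\<close> guarantees that a list exists to be chosen, and by
  \<open>pdlist_prodf\<close> any list with these multiplicities gives the same function.\<close>

lemma cderiv_prodf:
  assumes "ptest g"
  shows "cderiv \<beta> (prodf g) = prodf (\<lambda>i. (deriv ^^ \<beta> i) (g i))"
proof -
  have "\<forall>i. count_list (SOME ds. \<forall>i. count_list ds i = \<beta> i) i = \<beta> i"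
    using someI_ex[OF ex_list_count[of \<beta>]] .
  then show ?thesis using assms by (simp add: cderiv_def pdlist_prodf ptest_def)
qed

lemma deriv_zero_outside:
  assumes "\<And>t. r < \<bar>t\<bar> \<Longrightarrow> g t = 0" and "r < \<bar>t\<bar>"
  shows "deriv g t = (0::real)"
proof -
  have "open {t::real. r < \<bar>t\<bar>}"
    by (intro open_Collect_less continuous_intros)
  then have "\<forall>\<^sub>F s in nhds t. s \<in> {t. r < \<bar>t\<bar>}" using assms by (intro eventually_nhds_in_open) auto
  then have "\<forall>\<^sub>F s in nhds t. g s = 0" by eventually_elim (use assms in auto)
  then have "deriv g t = deriv (\<lambda>_. 0) t" by (intro deriv_cong_ev) auto
  then show ?thesis by simp
qed

lemma ptest_funpow_deriv:
  assumes "ptest g" shows "ptest (\<lambda>i. (deriv ^^ \<beta> i) (g i))"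
proof -
  obtain r where r: "\<And>i t. r < \<bar>t\<bar> \<Longrightarrow> g i t = 0" using assms by (auto simp: ptest_def)
  have "(deriv ^^ n) (g i) t = 0" if "r < \<bar>t\<bar>" for n i t
    using that by (induction n arbitrary: t) (auto intro: r deriv_zero_outside)
  then show ?thesis using assms unfolding ptest_def by (auto intro: smooth1_funpow_deriv)
qed

lemma ptest_deriv: "ptest g \<Longrightarrow> ptest (g(i := deriv (g i)))"
proof -
  assume "ptest g"
  moreover have "g(i := deriv (g i)) = (\<lambda>j. (deriv ^^ (if j = i then 1 else 0)) (g j))" by auto
  ultimately show ?thesis using ptest_funpow_deriv[of g "\<lambda>j. if j = i then 1 else 0"] by simp
qed

lemma ptest_translate:
  assumes "ptest g" shows "ptest (\<lambda>i t. g i (t - z $ i))"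
proof -
  obtain r where r: "\<And>i t. r < \<bar>t\<bar> \<Longrightarrow> g i t = 0" using assms by (auto simp: ptest_def)
  have "g i (t - z $ i) = 0" if "r + norm z < \<bar>t\<bar>" for i t
    using that component_le_norm_cart[of z i] by (intro r) linarith
  then show ?thesis using assms unfolding ptest_def by (auto intro: smooth1_translate)
qed

lemma prodf_translate: "prodf (\<lambda>i t. g i (t - z $ i)) x = prodf g (x - z)"
  by (simp add: prodf_def)

section \<open>Weak derivatives\<close>

lemma borel_measurable_translate:
  "(f :: 'a::euclidean_space \<Rightarrow> 'b::topological_space) \<in> borel_measurable lborel \<Longrightarrow>
    (\<lambda>x. f (x + c)) \<in> borel_measurable lborel"
  by (rule measurable_compose[of "\<lambda>x. x + c" lborel borel]) auto

lemma lborel_distr_plus': "distr lborel borel (\<lambda>x. x + c) = (lborel :: 'a::euclidean_space measure)"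
proof -
  have "(\<lambda>x. x + c) = (+) c" by (auto simp: add.commute)
  then show ?thesis by (simp only: lborel_distr_plus)
qed

lemma integral_translate:
  fixes f :: "'a::euclidean_space \<Rightarrow> real"
  assumes "f \<in> borel_measurable lborel"
  shows "(LBINT x. f (x + c)) = (LBINT x. f x)"
  using integral_distr[of "\<lambda>x. x + c" lborel borel f] assms lborel_distr_plus'[of c] by simp

lemma nn_integral_translate:
  fixes f :: "'a::euclidean_space \<Rightarrow> ennreal"
  assumes "f \<in> borel_measurable lborel"
  shows "(\<integral>\<^sup>+x. f (x + c) \<partial>lborel) = (\<integral>\<^sup>+x. f x \<partial>lborel)"
  using nn_integral_distr[of "\<lambda>x. x + c" lborel borel f] assms lborel_distr_plus'[of c] by simp

lemma integrable_translate:
  fixes f :: "'a::euclidean_space \<Rightarrow> real"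
  assumes "integrable lborel f"
  shows "integrable lborel (\<lambda>x. f (x + c))"
  using integrable_distr[of "\<lambda>x. x + c" lborel borel f] assms lborel_distr_plus'[of c] by simp

lemma ptest_bounded:
  assumes "ptest g" obtains C where "\<And>x. \<bar>prodf g x\<bar> \<le> C"
proof -
  obtain r where r: "r > 0" "\<And>x. x \<notin> cube r \<Longrightarrow> prodf g x = 0"
    using ptest_bounded_support[OF assms] by metis
  have "continuous_on (cube r) (prodf g)"
    using assms by (intro continuous_on_prodf) (auto simp: ptest_def)
  then have "bounded (prodf g ` cube r)"
    using compact_continuous_image compact_imp_bounded compact_cbox by blast
  then obtain C where C: "\<And>x. x \<in> cube r \<Longrightarrow> \<bar>prodf g x\<bar> \<le> C"
    unfolding bounded_iff by auto
  have "\<bar>prodf g x\<bar> \<le> max C 0" for x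
    using C[of x] r(2)[of x] by (cases "x \<in> cube r") auto
  then show ?thesis by (rule that)
qed

lemma prodf_borel [measurable]:
  assumes "ptest g" shows "prodf g \<in> borel_measurable borel"
  using assms by (intro borel_measurable_continuous_onI continuous_on_prodf) (auto simp: ptest_def)

lemma locint_borel: "locint f \<Longrightarrow> f \<in> borel_measurable borel"
  by (simp add: locint_def)

lemma locint_integrable_cbox:
  "locint f \<Longrightarrow> integrable lborel (\<lambda>x. indicator (cbox a b) x * f x)"
  by (simp add: locint_def set_integrable_def)

lemma locint_integrable_ptest:
  assumes f: "locint f" and g: "ptest g"
  shows "integrable lborel (\<lambda>x. f x * prodf g x)"
proof -
  obtain r where r: "\<And>x. x \<notin> cube r \<Longrightarrow> prodf g x = 0"
    using ptest_bounded_support[OF g] by metis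
  obtain C where C: "\<And>x. \<bar>prodf g x\<bar> \<le> C" using ptest_bounded[OF g] by metis
  have [measurable]: "f \<in> borel_measurable borel" "prodf g \<in> borel_measurable borel"
    using f g by (auto simp: locint_borel prodf_borel)
  have "integrable lborel (\<lambda>x. C * (indicator (cube r) x * f x))"
    by (intro integrable_mult_right locint_integrable_cbox f)
  then show ?thesis
  proof (rule Bochner_Integration.integrable_bound)
    show "AE x in lborel. norm (f x * prodf g x) \<le> norm (C * (indicator (cube r) x * f x))"
    proof (rule AE_I2)
      fix x
      show "norm (f x * prodf g x) \<le> norm (C * (indicator (cube r) x * f x))"
        using mult_left_mono[OF order_trans[OF C[of x] abs_ge_self] abs_ge_zero[of "f x"]] r[of x]
        by (auto simp: abs_mult mult.commute indicator_def)
    qed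
  qed measurable
qed

lemma locint_add: "locint f \<Longrightarrow> locint g \<Longrightarrow> locint (\<lambda>x. f x + g x)"
  unfolding locint_def by (auto intro: set_integral_add)

lemma locint_diff: "locint f \<Longrightarrow> locint g \<Longrightarrow> locint (\<lambda>x. f x - g x)"
  unfolding locint_def by (auto intro: set_integral_diff)

lemma locint_zero: "locint (\<lambda>x. 0)"
  unfolding locint_def set_integrable_def by auto

lemma locint_translate:
  assumes "locint f" shows "locint (\<lambda>x. f (x + z))"
  unfolding locint_def
proof (intro conjI allI impI)
  show "(\<lambda>x. f (x + z)) \<in> borel_measurable lborel"
    using assms by (intro borel_measurable_translate) (simp add: locint_def)
  fix K :: "(real^'a) set" assume "compact K"
  then have "compact ((+) z ` K)" by (rule compact_translation)
  then have "integrable lborel (\<lambda>x. indicator ((+) z ` K) x *\<^sub>R f x)"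
    using assms by (simp add: locint_def set_integrable_def)
  from integrable_translate[OF this, of z]
  have "integrable lborel (\<lambda>x. indicator ((+) z ` K) (x + z) *\<^sub>R f (x + z))" .
  moreover have "indicator ((+) z ` K) (x + z) = (indicator K x :: real)" for x
    by (auto simp: indicator_def image_iff add.commute)
  ultimately show "set_integrable lborel K (\<lambda>x. f (x + z))" by (simp add: set_integrable_def)
qed

text \<open>The products over the coordinates of \<open>exp (- 1 / (k t))\<close>, cut off to 0 for \<open>t \<le> 0\<close>, increase to the indicator of a box, so no bump
  function attaining the value 1 is needed.\<close>

lemma integral_box_eq_0:
  fixes h :: "real^'n::finite \<Rightarrow> real"
  assumes h: "locint h" and 0: "\<And>g. ptest g \<Longrightarrow> (LBINT x. h x * prodf g x) = 0"
  shows "(LBINT x. h x * indicator (box a b) x) = 0"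
proof -
  define e where "e = poly_exp_inv 1"
  have e: "0 \<le> e t" "e t \<le> 1" "t \<le> 0 \<Longrightarrow> e t = 0" for t by (auto simp: e_def poly_exp_inv_def)
  have sm: "smooth1 e" unfolding e_def by (rule smooth1_poly_exp_inv)
  \<comment> \<open>This is e((k+1)(t - a_i)) e((k+1)(b_i - t)): outside the open interval one
    argument is non-positive, inside both tend to infinity, where \<open>e\<close> tends to 1. The
    arguments are spelled out in the shape of \<open>smooth1_affine\<close>.\<close>
  define g where "g k i t = e (real (Suc k) * t + - real (Suc k) * a $ i) * e (- real (Suc k) * t + real (Suc k) * b $ i)" for k i t
  have g0: "g k i t = 0" if "\<not> (a $ i < t \<and> t < b $ i)" for k i t
  proof -
    have "real (Suc k) * (t - a $ i) \<le> 0 \<or> real (Suc k) * (b $ i - t) \<le> 0"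
      using that by (auto simp: mult_le_0_iff)
    then show ?thesis unfolding g_def using e(3) by (auto simp: algebra_simps)
  qed
  have pt: "ptest (g k)" for k
    unfolding ptest_def
  proof (intro conjI exI allI impI)
    show "smooth1 (g k i)" for i
      unfolding g_def by (intro smooth1_mult smooth1_affine sm)
    fix i t assume t: "norm a + norm b < \<bar>t\<bar>"
    then have "\<not> (a $ i < t \<and> t < b $ i)"
      using component_le_norm_cart[of a i] component_le_norm_cart[of b i] norm_ge_zero[of a] norm_ge_zero[of b] by linarith
    then show "g k i t = 0" by (rule g0)
  qed
  have g01: "0 \<le> g k i t" "g k i t \<le> 1" for k i t
    unfolding g_def using e(1,2) by (auto intro: mult_le_one)
  have e_lim: "(\<lambda>k. e (real (Suc k) * s)) \<longlonglongrightarrow> 1" if "s > 0" for s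
  proof -
    have "(\<lambda>k. exp (- 1 / (real (Suc k) * s))) \<longlonglongrightarrow> exp (- 0)"
    proof (intro tendsto_exp)
      have "(\<lambda>k. - (inverse s * inverse (real (Suc k)))) \<longlonglongrightarrow> - (inverse s * 0)"
        by (intro tendsto_intros LIMSEQ_inverse_real_of_nat)
      then show "(\<lambda>k. - 1 / (real (Suc k) * s)) \<longlonglongrightarrow> - 0" by (simp add: divide_inverse mult.commute)
    qed
    then show ?thesis using that by (simp add: e_def poly_exp_inv_def)
  qed
  have lim: "(\<lambda>k. prodf (g k) x) \<longlonglongrightarrow> indicator (box a b) x" for x
  proof (cases "x \<in> box a b")
    case True
    then have ab: "a $ i < x $ i" "x $ i < b $ i" for i by (auto simp: mem_box_cart)
    have "(\<lambda>k. g k i (x $ i)) \<longlonglongrightarrow> 1 * 1" for i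
      unfolding g_def
    proof (intro tendsto_mult)
      show "(\<lambda>k. e (real (Suc k) * x $ i + - real (Suc k) * a $ i)) \<longlonglongrightarrow> 1"
        using e_lim[of "x $ i - a $ i"] ab[of i] by (simp add: algebra_simps)
      show "(\<lambda>k. e (- real (Suc k) * x $ i + real (Suc k) * b $ i)) \<longlonglongrightarrow> 1"
        using e_lim[of "b $ i - x $ i"] ab[of i] by (simp add: algebra_simps)
    qed
    then have "(\<lambda>k. prodf (g k) x) \<longlonglongrightarrow> (\<Prod>i\<in>(UNIV::'n set). 1 * 1)"
      unfolding prodf_def by (intro tendsto_prod) auto
    then show ?thesis using True by simp
  next
    case False
    then obtain i where "\<not> (a $ i < x $ i \<and> x $ i < b $ i)" by (auto simp: mem_box_cart)
    then have "prodf (g k) x = 0" for k unfolding prodf_def using g0 by (intro prod_zero) auto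
    then show ?thesis using False by simp
  qed
  have [measurable]: "h \<in> borel_measurable borel" "\<And>k. prodf (g k) \<in> borel_measurable borel"
    using h pt by (auto simp: locint_borel prodf_borel)
  have "(\<lambda>k. LBINT x. h x * prodf (g k) x) \<longlonglongrightarrow> (LBINT x. h x * indicator (box a b) x)"
  proof (rule integral_dominated_convergence)
    show "integrable lborel (\<lambda>x. \<bar>indicator (cbox a b) x * h x\<bar>)"
      by (intro integrable_abs locint_integrable_cbox h)
    show "AE x in lborel. (\<lambda>k. h x * prodf (g k) x) \<longlonglongrightarrow> h x * indicator (box a b) x"
      by (intro AE_I2 tendsto_mult tendsto_const lim)
    fix k
    have "norm (h x * prodf (g k) x) \<le> \<bar>indicator (cbox a b) x * h x\<bar>" for x
    proof (cases "x \<in> cbox a b")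
      case True
      have "\<bar>prodf (g k) x\<bar> \<le> 1"
        unfolding prodf_def abs_prod using g01 by (intro prod_le_1) auto
      then show ?thesis using True by (auto simp: abs_mult mult_left_le)
    next
      case False
      then obtain i where "\<not> (a $ i \<le> x $ i \<and> x $ i \<le> b $ i)" unfolding mem_box_cart by blast
      then have "\<not> (a $ i < x $ i \<and> x $ i < b $ i)" by linarith
      then have "prodf (g k) x = 0" unfolding prodf_def using g0 by (intro prod_zero) auto
      then show ?thesis by simp
    qed
    then show "AE x in lborel. norm (h x * prodf (g k) x) \<le> \<bar>indicator (cbox a b) x * h x\<bar>" by simp
  qed measurable
  then have "(\<lambda>k. 0) \<longlonglongrightarrow> (LBINT x. h x * indicator (box a b) x)" using 0[OF pt] by simp
  then show ?thesis by (simp add: LIMSEQ_const_iff)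
qed

text \<open>The positive and negative parts of \<open>h\<close> are densities of two measures that
  agree on open boxes and are finite there. Boxes form an intersection-stable generator, so the
  measures coincide, and uniqueness of densities gives
  \<open>ennreal (h x) = ennreal (- h x)\<close> almost everywhere. One side is always 0, which
  forces \<open>h x = 0\<close>.\<close>

lemma fundamental_lemma:
  fixes h :: "real^'n::finite \<Rightarrow> real"
  assumes h: "locint h" and 0: "\<And>g. ptest g \<Longrightarrow> (LBINT x. h x * prodf g x) = 0"
  shows "AE x in lborel. h x = 0"
proof -
  have [measurable]: "h \<in> borel_measurable borel" using h by (rule locint_borel)
  let ?M = "density lborel (\<lambda>x. ennreal (h x))" and ?N = "density lborel (\<lambda>x. ennreal (- h x))"
  have I: "integrable lborel (\<lambda>x. h x * indicator (box a b) x)" for a b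
    by (rule Bochner_Integration.integrable_bound[OF integrable_abs[OF locint_integrable_cbox[OF h, of a b]]])
      (use box_subset_cbox[of a b] in \<open>auto simp: indicator_def\<close>)
  have M: "emeasure ?M (box a b) = (\<integral>\<^sup>+x. ennreal (h x * indicator (box a b) x) \<partial>lborel)" for a b
    by (subst emeasure_density) (auto intro!: nn_integral_cong simp: indicator_def)
  have N: "emeasure ?N (box a b) = (\<integral>\<^sup>+x. ennreal (- (h x * indicator (box a b) x)) \<partial>lborel)" for a b
    by (subst emeasure_density) (auto intro!: nn_integral_cong simp: indicator_def)
  have fin: "(\<integral>\<^sup>+x. ennreal (h x * indicator (box a b) x) \<partial>lborel) \<noteq> \<infinity>"
     "(\<integral>\<^sup>+x. ennreal (- (h x * indicator (box a b) x)) \<partial>lborel) \<noteq> \<infinity>" for a b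
    using I[of a b] by (auto simp: real_integrable_def)
  have eq: "emeasure ?M (box a b) = emeasure ?N (box a b)" for a b
  proof -
    let ?A = "\<integral>\<^sup>+x. ennreal (h x * indicator (box a b) x) \<partial>lborel"
    let ?B = "\<integral>\<^sup>+x. ennreal (- (h x * indicator (box a b) x)) \<partial>lborel"
    have "enn2real ?A = enn2real ?B"
    proof -
      have "(LBINT x. h x * indicator (box a b) x) = 0" by (rule integral_box_eq_0[OF h]) (rule 0)
      then show ?thesis using real_lebesgue_integral_def[OF I[of a b]] by linarith
    qed
    moreover have "ennreal (enn2real ?A) = ?A" "ennreal (enn2real ?B) = ?B"
      by (rule ennreal_enn2real, use fin[of a b] in \<open>simp add: less_top\<close>)+
    ultimately show ?thesis unfolding M N by metis
  qed
  have "?M = ?N"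
  proof (rule measure_eqI_generator_eq)
    let ?E = "range (\<lambda>(a, b). box a b::(real^'n) set)"
    show "Int_stable ?E" by (auto simp: Int_stable_def box_Int_box)
    show "?E \<subseteq> Pow UNIV" "sets ?M = sigma_sets UNIV ?E" "sets ?N = sigma_sets UNIV ?E"
      by (simp_all add: borel_eq_box)
    let ?A = "\<lambda>n::nat. box (- (real n *\<^sub>R One)) (real n *\<^sub>R One) :: (real^'n) set"
    show "range ?A \<subseteq> ?E" "(\<Union>i. ?A i) = UNIV" unfolding UN_box_eq_UNIV by auto
    show "emeasure ?M (?A i) \<noteq> \<infinity>" for i unfolding M by (rule fin)
    show "emeasure ?M X = emeasure ?N X" if "X \<in> ?E" for X using that eq by auto
  qed
  then have "AE x in lborel. ennreal (h x) = ennreal (- h x)"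
    by (subst (asm) sigma_finite_measure.density_unique_iff[OF sigma_finite_lborel]) auto
  then show ?thesis
  proof eventually_elim
    case (elim x)
    then show ?case
      by (cases "h x \<ge> 0"; cases "- h x \<ge> 0") (auto simp: ennreal_neg ennreal_eq_0_iff)
  qed
qed

text \<open>Testing only against products of one-variable functions loses nothing by the fundamental
  lemma, and on such products partial derivatives trivially commute.\<close>

definition weak_deriv :: "'n::finite mindex \<Rightarrow> (real^'n \<Rightarrow> real) \<Rightarrow> (real^'n \<Rightarrow> real) \<Rightarrow> bool" where
  "weak_deriv \<beta> u v \<longleftrightarrow> locint u \<and> locint v \<and>
     (\<forall>g. ptest g \<longrightarrow> (LBINT x. u x * prodf (\<lambda>i. (deriv ^^ \<beta> i) (g i)) x) =
        (-1) ^ mlen \<beta> * (LBINT x. v x * prodf g x))"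

lemma is_weak_deriv_imp_weak_deriv: "is_weak_deriv \<beta> u v \<Longrightarrow> weak_deriv \<beta> u v"
  unfolding is_weak_deriv_def weak_deriv_def
  by (auto simp: test_fun_prodf cderiv_prodf[symmetric])

lemma weak_deriv_unique:
  assumes "weak_deriv \<beta> u v" "weak_deriv \<beta> u v'"
  shows "AE x in lborel. v x = v' x"
proof -
  have "AE x in lborel. v x - v' x = 0"
  proof (rule fundamental_lemma)
    show "locint (\<lambda>x. v x - v' x)" using assms by (auto simp: weak_deriv_def intro: locint_diff)
    fix g :: "'a \<Rightarrow> real \<Rightarrow> real" assume g: "ptest g"
    have "(LBINT x. v x * prodf g x) = (LBINT x. v' x * prodf g x)"
      using assms g by (simp add: weak_deriv_def)
    moreover have "(LBINT x. (v x - v' x) * prodf g x) = (LBINT x. v x * prodf g x - v' x * prodf g x)"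
      by (simp add: algebra_simps)
    ultimately show "(LBINT x. (v x - v' x) * prodf g x) = 0"
      using assms g by (subst (asm) Bochner_Integration.integral_diff) (auto simp: weak_deriv_def locint_integrable_ptest)
  qed
  then show ?thesis by simp
qed

lemma weak_deriv_diff:
  assumes "weak_deriv \<beta> u v" "weak_deriv \<beta> u' v'"
  shows "weak_deriv \<beta> (\<lambda>x. u x - u' x) (\<lambda>x. v x - v' x)"
  using assms unfolding weak_deriv_def
  by (auto intro!: locint_diff simp: left_diff_distrib right_diff_distrib locint_integrable_ptest ptest_funpow_deriv)

lemma weak_deriv_add:
  assumes "weak_deriv \<beta> u v" "weak_deriv \<beta> u' v'"
  shows "weak_deriv \<beta> (\<lambda>x. u x + u' x) (\<lambda>x. v x + v' x)"
  using assms unfolding weak_deriv_def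
  by (auto intro!: locint_add simp: distrib_left distrib_right locint_integrable_ptest ptest_funpow_deriv)

lemma weak_deriv_sum:
  assumes "\<And>l. l \<in> A \<Longrightarrow> weak_deriv \<beta> (u l) (v l)"
  shows "weak_deriv \<beta> (\<lambda>x. \<Sum>l\<in>A. u l x) (\<lambda>x. \<Sum>l\<in>A. v l x)"
  using assms
proof (induction A rule: infinite_finite_induct)
  case (insert l A)
  then show ?case using weak_deriv_add[of \<beta> "u l" "v l"] by simp
qed (simp_all add: weak_deriv_def locint_zero)

text \<open>A translation of the variable moves onto the test product, where it shifts each factor
  separately, and one-variable derivatives commute with shifts.\<close>

lemma weak_deriv_translate:
  assumes "weak_deriv \<beta> u v"
  shows "weak_deriv \<beta> (\<lambda>x. u (x + z)) (\<lambda>x. v (x + z))"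
  unfolding weak_deriv_def
proof (intro conjI allI impI)
  have [measurable]: "u \<in> borel_measurable borel" "v \<in> borel_measurable borel"
    using assms by (auto simp: weak_deriv_def locint_borel)
  show "locint (\<lambda>x. u (x + z))" "locint (\<lambda>x. v (x + z))"
    using assms by (auto simp: weak_deriv_def intro: locint_translate)
  fix g :: "'a \<Rightarrow> real \<Rightarrow> real" assume g: "ptest g"
  let ?g = "\<lambda>i t. g i (t - z $ i)"
  have pg: "ptest ?g" by (rule ptest_translate[OF g])
  have d: "(deriv ^^ n) (?g i) = (\<lambda>t. (deriv ^^ n) (g i) (t - z $ i))" for n i
  proof (induction n)
    case (Suc n)
    then show ?case using g by (simp add: deriv_translate smooth1_funpow_deriv ptest_def)
  qed simp
  have m: "prodf (\<lambda>i. (deriv ^^ \<beta> i) (g i)) \<in> borel_measurable borel" for \<beta>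
    by (intro prodf_borel ptest_funpow_deriv g)
  have eq: "(LBINT x. u' (x + z) * prodf (\<lambda>i. (deriv ^^ \<beta> i) (g i)) x) =
    (LBINT x. u' x * prodf (\<lambda>i. (deriv ^^ \<beta> i) (?g i)) x)" if [measurable]: "u' \<in> borel_measurable borel" for u' \<beta>
  proof -
    have "(LBINT x. u' x * prodf (\<lambda>i. (deriv ^^ \<beta> i) (?g i)) x) =
       (LBINT x. u' x * prodf (\<lambda>i. (deriv ^^ \<beta> i) (g i)) (x - z))"
      unfolding d prodf_translate[of "\<lambda>i. (deriv ^^ \<beta> i) (g i)" z] ..
    also have "\<dots> = (LBINT x. u' (x + z) * prodf (\<lambda>i. (deriv ^^ \<beta> i) (g i)) (x + z - z))"
      using measurable_compose[OF _ m[of \<beta>], of "\<lambda>x. x - z" lborel]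
      by (intro integral_translate[symmetric]) simp
    finally show ?thesis by simp
  qed
  show "(LBINT x. u (x + z) * prodf (\<lambda>i. (deriv ^^ \<beta> i) (g i)) x) =
        (-1) ^ mlen \<beta> * (LBINT x. v (x + z) * prodf g x)"
    using assms pg eq[of u \<beta>] eq[of v "\<lambda>_. 0"] by (simp add: weak_deriv_def)
qed

definition axis_index :: "'n::finite \<Rightarrow> 'n mindex" where "axis_index i = (\<lambda>j. if j = i then 1 else 0)"

lemma weak_deriv_axis_index:
  fixes i :: "'n::finite"
  shows "weak_deriv (axis_index i) u v \<longleftrightarrow> locint u \<and> locint v \<and>
     (\<forall>g. ptest g \<longrightarrow> (LBINT x. u x * prodf (g(i := deriv (g i))) x) = - (LBINT x. v x * prodf g x))"
proof -
  have "(\<lambda>j. (deriv ^^ axis_index i j) (g j)) = g(i := deriv (g i))" for g :: "'n \<Rightarrow> real \<Rightarrow> real"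
    by (auto simp: axis_index_def)
  moreover have "mlen (axis_index i) = 1" by (simp add: mlen_def axis_index_def)
  ultimately show ?thesis by (simp add: weak_deriv_def)
qed

text \<open>Testing the derivative of order \<open>\<beta>\<close> with a product whose
  \<open>i\<close>-th factor is differentiated raises the order on the test side by one; the common
  sign cancels. Independently chosen derivatives of consecutive orders are thereby linked as a
  function and its first-order derivative, which is what allows first-order embeddings to be
  iterated.\<close>

lemma weak_deriv_step:
  assumes "weak_deriv \<beta> u v" "weak_deriv (\<lambda>j. \<beta> j + axis_index i j) u v'"
  shows "weak_deriv (axis_index i) v v'"
  unfolding weak_deriv_axis_index
proof (intro conjI allI impI)
  show "locint v" "locint v'" using assms by (auto simp: weak_deriv_def)
  fix g :: "'a \<Rightarrow> real \<Rightarrow> real" assume g: "ptest g"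
  have "(\<lambda>j. (deriv ^^ \<beta> j) ((g(i := deriv (g i))) j)) = (\<lambda>j. (deriv ^^ (\<beta> j + axis_index i j)) (g j))"
    by (auto simp: axis_index_def funpow_swap1)
  moreover have "mlen (\<lambda>j. \<beta> j + axis_index i j) = Suc (mlen \<beta>)"
    by (simp add: mlen_def axis_index_def sum.distrib)
  moreover have "(LBINT x. u x * prodf (\<lambda>j. (deriv ^^ \<beta> j) ((g(i := deriv (g i))) j)) x) =
      (-1) ^ mlen \<beta> * (LBINT x. v x * prodf (g(i := deriv (g i))) x)"
    using assms(1) ptest_deriv[OF g] unfolding weak_deriv_def by blast
  moreover have "(LBINT x. u x * prodf (\<lambda>j. (deriv ^^ (\<beta> j + axis_index i j)) (g j)) x) =
      (-1) ^ mlen (\<lambda>j. \<beta> j + axis_index i j) * (LBINT x. v' x * prodf g x)"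
    using assms(2) g unfolding weak_deriv_def by blast
  ultimately have "(-1) ^ mlen \<beta> * (LBINT x. v x * prodf (g(i := deriv (g i))) x) =
     (-1) ^ mlen \<beta> * - (LBINT x. v' x * prodf g x)"
    by simp
  then show "(LBINT x. v x * prodf (g(i := deriv (g i))) x) = - (LBINT x. v' x * prodf g x)"
    by (subst (asm) mult_left_cancel) simp_all
qed

section \<open>Difference quotients along lines\<close>

text \<open>Convexity: the power lies above its tangent at \<open>m\<close>. The cases
  \<open>m = 0\<close> and \<open>a = 0\<close> are separate because convexity and the derivative
  are taken on the open half-line. Jensen's inequality, the midpoint inequality and weak lower
  semicontinuity below are all drawn from this.\<close>

lemma powr_tangent:
  fixes a m p :: real
  assumes "0 \<le> a" "0 \<le> m" "1 < p"
  shows "m powr p + p * m powr (p - 1) * (a - m) \<le> a powr p"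
proof (cases "m = 0")
  case True
  then show ?thesis using assms by simp
next
  case False
  show ?thesis
  proof (cases "a = 0")
    case True
    have "m powr p = m powr (p - 1) * m" using powr_mult_base[of m "p - 1"] assms by (simp add: mult.commute)
    then have "m powr p + p * m powr (p - 1) * (a - m) = (1 - p) * m powr p" using True by (simp add: algebra_simps)
    also have "\<dots> \<le> 0" using assms by (intro mult_nonpos_nonneg) auto
    finally show ?thesis using True by simp
  next
    case a: False
    have "a powr p - m powr p \<ge> (p * m powr (p - 1)) * (a - m)"
    proof (rule convex_on_imp_above_tangent[of "{0<..}"])
      show "((\<lambda>x. x powr p) has_real_derivative p * m powr (p - 1)) (at m within {0<..})"
        using False assms by (auto intro!: derivative_eq_intros)
    qed (use assms False a in \<open>auto intro: powr_convex simp: interior_open\<close>)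
    then show ?thesis by linarith
  qed
qed

text \<open>Jensen's inequality on \<open>{0..t}\<close>: the tangent inequality at the mean
  \<open>m\<close> is integrated, and the linear part cancels because \<open>m\<close> is the mean.
  An infinite right-hand side is settled first so that the remaining integrals are real.\<close>

lemma integral_powr_Icc_le:
  fixes f :: "real \<Rightarrow> real"
  assumes f: "integrable lborel (\<lambda>s. indicator {0..t} s * f s)" "\<And>s. 0 \<le> f s" and [measurable]: "f \<in> borel_measurable borel"
    and t: "t > 0" and p: "1 < p"
  shows "ennreal ((LBINT s. indicator {0..t} s * f s) powr p) \<le>
     ennreal (t powr (p - 1)) * (\<integral>\<^sup>+s. indicator {0..t} s * ennreal (f s powr p) \<partial>lborel)"
proof (cases "(\<integral>\<^sup>+s. ennreal (indicator {0..t} s * f s powr p) \<partial>lborel) = \<infinity>")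
  case True
  then have "(\<integral>\<^sup>+s. indicator {0..t} s * ennreal (f s powr p) \<partial>lborel) = \<infinity>"
    by (simp add: ennreal_mult' ennreal_indicator)
  then show ?thesis using t by (simp add: ennreal_mult_top)
next
  case False
  then have fp: "integrable lborel (\<lambda>s. indicator {0..t} s * f s powr p)"
    by (intro integrableI_nonneg) (auto simp: less_top)
  define I where "I = (LBINT s. indicator {0..t} s * f s)"
  define m where "m = I / t"
  have I0: "I \<ge> 0" unfolding I_def using f(2) by (intro Bochner_Integration.integral_nonneg) auto
  have m0: "m \<ge> 0" using I0 t by (simp add: m_def)
  have i1: "integrable lborel (\<lambda>s. indicator {0..t} s :: real)" by (rule integrable_real_indicator) (auto simp: emeasure_lborel_Icc_eq)
  have "(LBINT s. (m powr p - p * m powr (p - 1) * m) * indicator {0..t} s + p * m powr (p - 1) * (indicator {0..t} s * f s))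
     \<le> (LBINT s. indicator {0..t} s * f s powr p)"
  proof (rule integral_mono)
    show "integrable lborel (\<lambda>s. (m powr p - p * m powr (p - 1) * m) * indicator {0..t} s + p * m powr (p - 1) * (indicator {0..t} s * f s))"
      by (intro Bochner_Integration.integrable_add integrable_mult_right i1 f)
    fix s
    show "(m powr p - p * m powr (p - 1) * m) * indicator {0..t} s + p * m powr (p - 1) * (indicator {0..t} s * f s)
      \<le> indicator {0..t} s * f s powr p"
      using powr_tangent[OF f(2)[of s] m0 p] by (auto simp: indicator_def algebra_simps)
  qed (rule fp)
  also have "(LBINT s. (m powr p - p * m powr (p - 1) * m) * indicator {0..t} s + p * m powr (p - 1) * (indicator {0..t} s * f s))
    = (m powr p - p * m powr (p - 1) * m) * t + p * m powr (p - 1) * I"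
    using f(1) i1 t by (subst Bochner_Integration.integral_add) (auto simp: I_def)
  also have "\<dots> = t * m powr p" using t by (simp add: m_def field_simps)
  finally have *: "t * m powr p \<le> (LBINT s. indicator {0..t} s * f s powr p)" .
  have "I powr p = t powr p * m powr p" using I0 t by (simp add: m_def powr_divide)
  also have "t powr p = t powr (p - 1) * t" using powr_mult_base[of t "p - 1"] t by (simp add: mult.commute)
  finally have "I powr p = t powr (p - 1) * (t * m powr p)" by simp
  also have "\<dots> \<le> t powr (p - 1) * (LBINT s. indicator {0..t} s * f s powr p)"
    by (intro mult_left_mono *) auto
  finally have "ennreal (I powr p) \<le> ennreal (t powr (p - 1)) * ennreal (LBINT s. indicator {0..t} s * f s powr p)"
    by (simp add: ennreal_leI flip: ennreal_mult)
  also have "ennreal (LBINT s. indicator {0..t} s * f s powr p) = (\<integral>\<^sup>+s. indicator {0..t} s * ennreal (f s powr p) \<partial>lborel)"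
    using fp by (subst nn_integral_eq_integral[symmetric]) (auto simp: ennreal_mult' ennreal_indicator)
  finally show ?thesis unfolding I_def .
qed

text \<open>For \<open>s\<close> in \<open>{0..t}\<close> the shifted cube stays in the cube of
  half-side r + |t|, so every inner integral is dominated by one fixed integral of |v|. This
  justifies Fubini along lines for a function that is merely locally integrable.\<close>

lemma shear_nn_integral_finite:
  fixes v :: "real^'n::finite \<Rightarrow> real"
  assumes v: "locint v"
  shows "(\<integral>\<^sup>+z. ennreal \<bar>case z of (s, x) \<Rightarrow> indicator {0..t} s * (indicator (cube r) x * v (x + s *\<^sub>R axis i 1))\<bar>
     \<partial>(lborel \<Otimes>\<^sub>M lborel)) < \<infinity>"
proof -
  have [measurable]: "v \<in> borel_measurable borel" using v by (rule locint_borel)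
  have [measurable]: "(\<lambda>z. v (case z of (s, x) \<Rightarrow> x + s *\<^sub>R axis i 1)) \<in> borel_measurable (lborel \<Otimes>\<^sub>M lborel)"
    by measurable
  define B :: "(real^'n) set" where "B = cube r"
  define B' :: "(real^'n) set" where "B' = cbox (\<chi> i. - (r + \<bar>t\<bar>)) (\<chi> i. r + \<bar>t\<bar>)"
  have "integrable lborel (\<lambda>x. indicator B' x * v x)"
    unfolding B'_def by (rule locint_integrable_cbox[OF v])
  then have fin: "(\<integral>\<^sup>+x. ennreal \<bar>indicator B' x * v x\<bar> \<partial>lborel) < \<infinity>"
    by (simp add: integrable_iff_bounded)
  have inner: "(\<integral>\<^sup>+x. ennreal \<bar>indicator {0..t} s * (indicator B x * v (x + s *\<^sub>R axis i 1))\<bar> \<partial>lborel)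
     \<le> indicator {0..t} s * (\<integral>\<^sup>+x. ennreal \<bar>indicator B' x * v x\<bar> \<partial>lborel)" for s
  proof (cases "s \<in> {0..t}")
    case True
    have "x + s *\<^sub>R axis i 1 \<in> B'" if "x \<in> B" for x
    proof -
      have "- r \<le> x $ j \<and> x $ j \<le> r" for j using that by (simp add: B_def mem_box_cart)
      then show ?thesis using True unfolding B'_def mem_box_cart by (auto simp: axis_def intro!: add_mono)
         (smt (verit, best))+
    qed
    then have "(\<integral>\<^sup>+x. ennreal \<bar>indicator {0..t} s * (indicator B x * v (x + s *\<^sub>R axis i 1))\<bar> \<partial>lborel)
       \<le> (\<integral>\<^sup>+x. ennreal \<bar>indicator B' (x + s *\<^sub>R axis i 1) * v (x + s *\<^sub>R axis i 1)\<bar> \<partial>lborel)"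
      using True by (intro nn_integral_mono) (auto simp: indicator_def)
    also have "\<dots> = (\<integral>\<^sup>+x. ennreal \<bar>indicator B' x * v x\<bar> \<partial>lborel)"
      by (rule nn_integral_translate) (simp add: B'_def)
    finally show ?thesis using True by simp
  qed simp
  have "(\<integral>\<^sup>+z. ennreal \<bar>case z of (s, x) \<Rightarrow> indicator {0..t} s * (indicator B x * v (x + s *\<^sub>R axis i 1))\<bar>
     \<partial>(lborel \<Otimes>\<^sub>M lborel)) =
     (\<integral>\<^sup>+s. \<integral>\<^sup>+x. ennreal \<bar>indicator {0..t} s * (indicator B x * v (x + s *\<^sub>R axis i 1))\<bar> \<partial>lborel \<partial>lborel)"
    by (subst lborel.nn_integral_fst[symmetric]) (auto simp: B_def split_beta')
  also have "\<dots> \<le> (\<integral>\<^sup>+s. indicator {0..t} s * (\<integral>\<^sup>+x. ennreal \<bar>indicator B' x * v x\<bar> \<partial>lborel) \<partial>lborel)"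
    by (intro nn_integral_mono inner)
  also have "\<dots> = emeasure lborel {0..t} * (\<integral>\<^sup>+x. ennreal \<bar>indicator B' x * v x\<bar> \<partial>lborel)"
    by (subst nn_integral_multc) auto
  also have "\<dots> < \<infinity>" using fin by (simp add: ennreal_mult_less_top emeasure_lborel_Icc_eq)
  finally show ?thesis unfolding B_def .
qed


lemma shear_integrable:
  fixes v :: "real^'n::finite \<Rightarrow> real"
  assumes v: "locint v"
  shows "integrable (lborel \<Otimes>\<^sub>M lborel)
    (\<lambda>(s, x). indicator {0..t} s * (indicator (cube r) x * v (x + s *\<^sub>R axis i 1)))"
proof (rule integrableI_bounded)
  have [measurable]: "v \<in> borel_measurable borel" using v by (rule locint_borel)
  show "(\<lambda>(s, x). indicator {0..t} s * (indicator (cube r) x * v (x + s *\<^sub>R axis i 1)))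
     \<in> borel_measurable (lborel \<Otimes>\<^sub>M lborel)" by measurable
qed (use shear_nn_integral_finite[OF v, of t r i] in simp)

lemma mem_cbox_norm: "norm (x :: real^'n::finite) \<le> r \<Longrightarrow> x \<in> cube r"
  unfolding mem_box_cart using component_le_norm_cart[of x] by (auto simp: abs_le_iff) (smt (verit, best))+

text \<open>Fubini gives the claim with a cut-off to a cube in \<open>x\<close>; countably many
  cubes of integer half-side exhaust the space and remove it.\<close>

lemma AE_integrable_line:
  fixes v :: "real^'n::finite \<Rightarrow> real"
  assumes v: "locint v"
  shows "AE x in lborel. integrable lborel (\<lambda>s. indicator {0..t} s * v (x + s *\<^sub>R axis i 1))"
proof -
  have "AE x in lborel. integrable lborel
      (\<lambda>s. indicator {0..t} s * (indicator (cube (real n)) x * v (x + s *\<^sub>R axis i 1)))" for n :: nat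
    by (rule lborel_pair.AE_integrable_snd[OF shear_integrable[OF v]])
  then have "AE x in lborel. \<forall>n::nat. integrable lborel
      (\<lambda>s. indicator {0..t} s * (indicator (cube (real n)) x * v (x + s *\<^sub>R axis i 1)))"
    by (simp add: AE_all_countable)
  then show ?thesis
  proof eventually_elim
    case (elim x)
    obtain n :: nat where "norm x \<le> real n" using real_arch_simple by blast
    then have "x \<in> cube (real n)" by (rule mem_cbox_norm)
    then show ?case using elim[rule_format, of n] by simp
  qed
qed

lemma locint_line_integral:
  fixes v :: "real^'n::finite \<Rightarrow> real"
  assumes v: "locint v"
  shows "locint (\<lambda>x. LBINT s. indicator {0..t} s * v (x + s *\<^sub>R axis i 1))"
  unfolding locint_def
proof (intro conjI allI impI)
  let ?W = "\<lambda>x. LBINT s. indicator {0..t} s * v (x + s *\<^sub>R axis i 1)"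
  have [measurable]: "v \<in> borel_measurable borel" using v by (rule locint_borel)
  show "?W \<in> borel_measurable lborel" by measurable
  fix K :: "(real^'n) set" assume K: "compact K"
  obtain r where r: "\<And>x. x \<in> K \<Longrightarrow> norm x \<le> r"
    using compact_imp_bounded[OF K] by (auto simp: bounded_iff)
  have "integrable lborel (\<lambda>x. LBINT s. indicator {0..t} s * (indicator (cube r) x * v (x + s *\<^sub>R axis i 1)))"
    by (rule lborel_pair.integrable_snd[OF shear_integrable[OF v]])
  moreover have "(LBINT s. indicator {0..t} s * (indicator (cube r) x * v (x + s *\<^sub>R axis i 1))) =
     indicator (cube r) x * ?W x" for x
    by (auto simp: indicator_def)
  ultimately have "set_integrable lborel (cube r) ?W"
    by (simp add: set_integrable_def)
  then show "set_integrable lborel K ?W"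
    by (rule set_integrable_subset) (use r mem_cbox_norm K in \<open>auto intro: borel_compact\<close>)
qed

text \<open>The first integrand is dominated by the sheared cube integrand, since a test product is
  bounded with bounded support. For fixed \<open>s\<close> a translation carries the second into the
  first, so finiteness transfers slice by slice. In \<open>weak_deriv_line\<close> the order of
  integration is exchanged both before and after that translation.\<close>

lemma shear_integrable_ptest:
  fixes v :: "real^'n::finite \<Rightarrow> real"
  assumes v: "locint v" and g: "ptest g"
  shows "integrable (lborel \<Otimes>\<^sub>M lborel) (\<lambda>(s, x). indicator {0..t} s * (v (x + s *\<^sub>R axis i 1) * prodf g x))"
    and "integrable (lborel \<Otimes>\<^sub>M lborel) (\<lambda>(s, x). indicator {0..t} s * (v x * prodf g (x - s *\<^sub>R axis i 1)))"
proof -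
  have [measurable]: "v \<in> borel_measurable borel" "prodf g \<in> borel_measurable borel"
    using v g by (auto simp: locint_borel prodf_borel)
  obtain r where r: "\<And>x. x \<notin> cube r \<Longrightarrow> prodf g x = 0"
    using ptest_bounded_support[OF g] by metis
  obtain C where C: "\<And>x. \<bar>prodf g x\<bar> \<le> C" using ptest_bounded[OF g] by metis
  have "integrable (lborel \<Otimes>\<^sub>M lborel) (\<lambda>z. C * (case z of (s, x) \<Rightarrow>
      indicator {0..t} s * (indicator (cube r) x * v (x + s *\<^sub>R axis i 1))))"
    by (intro integrable_mult_right shear_integrable v)
  then show 1: "integrable (lborel \<Otimes>\<^sub>M lborel) (\<lambda>(s, x). indicator {0..t} s * (v (x + s *\<^sub>R axis i 1) * prodf g x))"
  proof (rule Bochner_Integration.integrable_bound)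
    show "AE z in lborel \<Otimes>\<^sub>M lborel. norm (case z of (s, x) \<Rightarrow> indicator {0..t} s * (v (x + s *\<^sub>R axis i 1) * prodf g x))
      \<le> norm (C * (case z of (s, x) \<Rightarrow> indicator {0..t} s * (indicator (cube r) x * v (x + s *\<^sub>R axis i 1))))"
    proof (intro AE_I2, clarify)
      fix s :: real and x :: "real^'n"
      show "norm (indicator {0..t} s * (v (x + s *\<^sub>R axis i 1) * prodf g x))
        \<le> norm (C * (indicator {0..t} s * (indicator (cube r) x * v (x + s *\<^sub>R axis i 1))))"
        using mult_left_mono[OF order_trans[OF C[of x] abs_ge_self] abs_ge_zero[of "v (x + s *\<^sub>R axis i 1)"]] r[of x]
        by (auto simp: abs_mult mult.commute indicator_def)
    qed
  qed measurable
  show "integrable (lborel \<Otimes>\<^sub>M lborel) (\<lambda>(s, x). indicator {0..t} s * (v x * prodf g (x - s *\<^sub>R axis i 1)))"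
  proof (rule integrableI_bounded)
    show "(\<lambda>(s, x). indicator {0..t} s * (v x * prodf g (x - s *\<^sub>R axis i 1))) \<in> borel_measurable (lborel \<Otimes>\<^sub>M lborel)"
      by measurable
    have "(\<integral>\<^sup>+z. ennreal (norm (case z of (s, x) \<Rightarrow> indicator {0..t} s * (v x * prodf g (x - s *\<^sub>R axis i 1)))) \<partial>(lborel \<Otimes>\<^sub>M lborel)) =
      (\<integral>\<^sup>+s. \<integral>\<^sup>+x. ennreal \<bar>indicator {0..t} s * (v x * prodf g (x - s *\<^sub>R axis i 1))\<bar> \<partial>lborel \<partial>lborel)"
      by (subst lborel.nn_integral_fst[symmetric]) auto
    also have "\<dots> = (\<integral>\<^sup>+s. \<integral>\<^sup>+x. ennreal \<bar>indicator {0..t} s * (v (x + s *\<^sub>R axis i 1) * prodf g x)\<bar> \<partial>lborel \<partial>lborel)"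
    proof (rule nn_integral_cong)
      fix s :: real
      show "(\<integral>\<^sup>+x. ennreal \<bar>indicator {0..t} s * (v x * prodf g (x - s *\<^sub>R axis i 1))\<bar> \<partial>lborel) =
        (\<integral>\<^sup>+x. ennreal \<bar>indicator {0..t} s * (v (x + s *\<^sub>R axis i 1) * prodf g x)\<bar> \<partial>lborel)"
        using nn_integral_translate[of "\<lambda>x. ennreal \<bar>indicator {0..t} s * (v x * prodf g (x - s *\<^sub>R axis i 1))\<bar>" "s *\<^sub>R axis i 1"]
        by simp
    qed
    also have "\<dots> = (\<integral>\<^sup>+z. ennreal (norm (case z of (s, x) \<Rightarrow> indicator {0..t} s * (v (x + s *\<^sub>R axis i 1) * prodf g x))) \<partial>(lborel \<Otimes>\<^sub>M lborel))"
      by (subst lborel.nn_integral_fst[symmetric]) auto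
    also have "\<dots> < \<infinity>" using 1 unfolding integrable_iff_bounded by blast
    finally show "(\<integral>\<^sup>+z. ennreal (norm (case z of (s, x) \<Rightarrow> indicator {0..t} s * (v x * prodf g (x - s *\<^sub>R axis i 1)))) \<partial>(lborel \<Otimes>\<^sub>M lborel)) < \<infinity>" .
  qed
qed


text \<open>Testing against the primitive of \<open>g i - g i (\<cdot> - t)\<close> in the \<open>i\<close>-th variable,
  which is again an admissible test function, turns the definition of the weak derivative into the
  fundamental theorem of calculus along lines.\<close>

lemma weak_deriv_line:
  fixes u v :: "real^'n::finite \<Rightarrow> real"
  assumes w: "weak_deriv (axis_index i) u v" and t: "t > 0"
  shows "AE x in lborel. u (x + t *\<^sub>R axis i 1) - u x =
    (LBINT s. indicator {0..t} s * v (x + s *\<^sub>R axis i 1))"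
proof -
  define e :: "real^'n" where "e = axis i 1"
  define W where "W x = (LBINT s. indicator {0..t} s * v (x + s *\<^sub>R e))" for x
  have u: "locint u" and v: "locint v" using w by (auto simp: weak_deriv_def)
  have W: "locint W" unfolding W_def e_def by (rule locint_line_integral[OF v])
  have [measurable]: "u \<in> borel_measurable borel" "v \<in> borel_measurable borel"
    using u v by (auto simp: locint_borel)
  have "AE x in lborel. u (x + t *\<^sub>R e) - u x - W x = 0"
  proof (rule fundamental_lemma)
    show "locint (\<lambda>x. u (x + t *\<^sub>R e) - u x - W x)"
      by (intro locint_diff locint_translate u W)
    fix g :: "'n \<Rightarrow> real \<Rightarrow> real" assume g: "ptest g"
    then have [measurable]: "prodf g \<in> borel_measurable borel" by (rule prodf_borel)
    have sg: "smooth1 (g j)" for j using g by (simp add: ptest_def)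
    obtain r where r: "\<And>j \<tau>. r < \<bar>\<tau>\<bar> \<Longrightarrow> g j \<tau> = 0" using g by (auto simp: ptest_def)
    obtain G where "\<And>\<tau>. (G has_vector_derivative g i \<tau>) (at \<tau>)"
      using einterval_antiderivative[of "-\<infinity>" \<infinity> "g i"] smooth1_continuous[OF sg[of i], of UNIV]
      by (auto simp: continuous_on_eq_continuous_at)
    then have G: "(G has_real_derivative g i \<tau>) (at \<tau>)" for \<tau>
      by (simp add: has_real_derivative_iff_has_vector_derivative)
    define H where "H \<tau> = G \<tau> - G (\<tau> - t)" for \<tau>
    have Gt: "((\<lambda>\<tau>. G (\<tau> - t)) has_real_derivative g i (\<tau> - t)) (at \<tau>)" for \<tau>
    proof -
      have "((\<lambda>\<tau>. \<tau> - t) has_real_derivative 1) (at \<tau>)" by (auto intro!: derivative_eq_intros)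
      from DERIV_chain2[where f=G, OF G this] show ?thesis by simp
    qed
    have H': "(H has_real_derivative g i \<tau> - g i (\<tau> - t)) (at \<tau>)" for \<tau>
      unfolding H_def by (intro DERIV_diff G Gt)
    have sH: "smooth1 H"
      by (rule smooth1_antiderivative[OF _ H']) (intro smooth1_diff smooth1_translate sg)
    have dH: "deriv H = (\<lambda>\<tau>. g i \<tau> - g i (\<tau> - t))" using H' by (auto intro: DERIV_imp_deriv)
    \<comment> \<open>\<open>G\<close> itself may be nonzero far out, but its increment over a
      length \<open>t\<close> is \<open>t\<close> times a value of \<open>g i\<close> at an
      intermediate point, which still lies outside the support.\<close>
    have H0: "H \<tau> = 0" if "r + t < \<bar>\<tau>\<bar>" for \<tau>
    proof -
      obtain \<xi> where "\<tau> - t < \<xi>" "\<xi> < \<tau>" "G \<tau> - G (\<tau> - t) = (\<tau> - (\<tau> - t)) * g i \<xi>"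
        using MVT2[of "\<tau> - t" \<tau> G "g i"] G t by auto
      moreover from this have "r < \<bar>\<xi>\<bar>" using that by linarith
      ultimately show ?thesis using r by (simp add: H_def)
    qed
    have pH: "ptest (g(i := H))"
      unfolding ptest_def
    proof (intro conjI allI exI impI)
      fix j \<tau> assume "r + t < \<bar>\<tau>\<bar>"
      then show "(g(i := H)) j \<tau> = 0" using H0 r[of \<tau> j] t by auto
    qed (use sH sg in auto)
    \<comment> \<open>As an integral of translates of \<open>g i\<close>, \<open>H\<close> turns its
      product into a superposition of translated test products; Fubini can then move the shift onto
      \<open>v\<close>.\<close>
    have H_int: "H \<tau> = (LBINT s. g i (\<tau> - s) * indicator {0..t} s)" for \<tau>
    proof -
      have "(LBINT s. g i (\<tau> - s) * indicator {0..t} s) = - G (\<tau> - t) - - G (\<tau> - 0)"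
      proof (rule integral_FTC_Icc_real)
        fix s
        show "((\<lambda>s. - G (\<tau> - s)) has_real_derivative g i (\<tau> - s)) (at s)"
        proof -
          have "((\<lambda>s. \<tau> - s) has_real_derivative -1) (at s)" by (auto intro!: derivative_eq_intros)
          from DERIV_minus[OF DERIV_chain2[where f=G, OF G this]] show ?thesis by simp
        qed
        show "isCont (\<lambda>s. g i (\<tau> - s)) s"
          using smooth1_continuous[OF smooth1_affine[OF sg[of i], of "-1" \<tau>], of UNIV]
          by (simp add: continuous_on_eq_continuous_at)
      qed (use t in simp)
      then show ?thesis by (simp add: H_def)
    qed
    have shift: "prodf g (x - s *\<^sub>R e) = g i (x $ i - s) * (\<Prod>j\<in>UNIV - {i}. g j (x $ j))" for x s
      by (auto simp: prodf_insert[of g _ i] e_def axis_def intro!: prod.cong)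
    have psi: "prodf (g(i := H)) x = (LBINT s. indicator {0..t} s * prodf g (x - s *\<^sub>R e))" for x
    proof -
      have "prodf (g(i := H)) x = H (x $ i) * (\<Prod>j\<in>UNIV - {i}. g j (x $ j))"
        by (simp add: prodf_insert[of _ x i])
      also have "\<dots> = (LBINT s. (g i (x $ i - s) * indicator {0..t} s) * (\<Prod>j\<in>UNIV - {i}. g j (x $ j)))"
        unfolding H_int by (rule integral_mult_left_zero[symmetric])
      finally show ?thesis unfolding shift by (simp add: mult_ac)
    qed
    have dpsi: "prodf ((g(i := H))(i := deriv H)) x = prodf g x - prodf g (x - t *\<^sub>R e)" for x
      unfolding shift by (simp add: prodf_insert[of _ x i] dH algebra_simps)
    have int_shift: "integrable lborel (\<lambda>x. u x * prodf g (x - t *\<^sub>R e))"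
      using locint_integrable_ptest[OF u ptest_translate[OF g, of "t *\<^sub>R e"]]
      unfolding prodf_translate .
    have "(LBINT x. u x * (prodf g x - prodf g (x - t *\<^sub>R e))) = - (LBINT x. v x * prodf (g(i := H)) x)"
    proof -
      have "(LBINT x. u x * prodf ((g(i := H))(i := deriv ((g(i := H)) i))) x) = - (LBINT x. v x * prodf (g(i := H)) x)"
        using w pH unfolding weak_deriv_axis_index by blast
      then show ?thesis unfolding fun_upd_same dpsi .
    qed
    then have 1: "(LBINT x. u x * prodf g (x - t *\<^sub>R e)) - (LBINT x. u x * prodf g x) = (LBINT x. v x * prodf (g(i := H)) x)"
      using int_shift locint_integrable_ptest[OF u g] by (simp add: right_diff_distrib)
    have 2: "(LBINT x. u x * prodf g (x - t *\<^sub>R e)) = (LBINT x. u (x + t *\<^sub>R e) * prodf g x)"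
      using integral_translate[of "\<lambda>x. u x * prodf g (x - t *\<^sub>R e)" "t *\<^sub>R e"] by simp
    have "(LBINT x. v x * prodf (g(i := H)) x) =
      (LBINT x. LBINT s. indicator {0..t} s * (v x * prodf g (x - s *\<^sub>R e)))"
    proof (rule Bochner_Integration.integral_cong[OF refl])
      fix x
      have "v x * prodf (g(i := H)) x = (LBINT s. v x * (indicator {0..t} s * prodf g (x - s *\<^sub>R e)))"
        unfolding psi by (rule integral_mult_right_zero[symmetric])
      then show "v x * prodf (g(i := H)) x = (LBINT s. indicator {0..t} s * (v x * prodf g (x - s *\<^sub>R e)))"
        by (simp only: mult.left_commute)
    qed
    also have "\<dots> = (LBINT s. LBINT x. indicator {0..t} s * (v x * prodf g (x - s *\<^sub>R e)))"
      by (rule lborel_pair.Fubini_integral) (use shear_integrable_ptest(2)[OF v g] in \<open>simp add: e_def\<close>)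
    also have "\<dots> = (LBINT s. LBINT x. indicator {0..t} s * (v (x + s *\<^sub>R e) * prodf g x))"
    proof (rule Bochner_Integration.integral_cong[OF refl])
      fix s :: real
      show "(LBINT x. indicator {0..t} s * (v x * prodf g (x - s *\<^sub>R e))) = (LBINT x. indicator {0..t} s * (v (x + s *\<^sub>R e) * prodf g x))"
        using integral_translate[of "\<lambda>x. indicator {0..t} s * (v x * prodf g (x - s *\<^sub>R e))" "s *\<^sub>R e"] by auto
    qed
    also have "\<dots> = (LBINT x. LBINT s. indicator {0..t} s * (v (x + s *\<^sub>R e) * prodf g x))"
      by (rule lborel_pair.Fubini_integral[symmetric]) (use shear_integrable_ptest(1)[OF v g] in \<open>simp add: e_def\<close>)
    also have "\<dots> = (LBINT x. W x * prodf g x)"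
    proof (rule Bochner_Integration.integral_cong[OF refl])
      fix x
      have "W x * prodf g x = (LBINT s. (indicator {0..t} s * v (x + s *\<^sub>R e)) * prodf g x)"
        unfolding W_def by (rule integral_mult_left_zero[symmetric])
      then show "(LBINT s. indicator {0..t} s * (v (x + s *\<^sub>R e) * prodf g x)) = W x * prodf g x"
        by (simp only: mult.assoc)
    qed
    finally have 3: "(LBINT x. v x * prodf (g(i := H)) x) = (LBINT x. W x * prodf g x)" .
    show "(LBINT x. (u (x + t *\<^sub>R e) - u x - W x) * prodf g x) = 0"
      using 1 2 3 locint_integrable_ptest[OF u g] locint_integrable_ptest[OF W g]
        locint_integrable_ptest[OF locint_translate[OF u, of "t *\<^sub>R e"] g]
      by (simp add: left_diff_distrib)
  qed
  then show ?thesis by (simp add: W_def e_def)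
qed

text \<open>Jensen along the segment costs t^(p-1). Integrating in \<open>x\<close> first makes each
  \<open>s\<close>-slice the full mass of \<open>v\<close> by translation invariance, and the length
  of the segment supplies the last factor \<open>t\<close>.\<close>

lemma nn_integral_translation_diff_axis:
  fixes u v :: "real^'n::finite \<Rightarrow> real"
  assumes w: "weak_deriv (axis_index i) u v" and t: "t \<ge> 0" and p: "1 < p"
  shows "(\<integral>\<^sup>+x. ennreal (\<bar>u (x + t *\<^sub>R axis i 1) - u x\<bar> powr p) \<partial>lborel) \<le>
    ennreal (t powr p) * nn_Lp_mass p v"
proof (cases "t = 0")
  case True
  then show ?thesis by simp
next
  case False
  then have t: "t > 0" using t by simp
  have v: "locint v" using w by (auto simp: weak_deriv_def)
  then have [measurable]: "v \<in> borel_measurable borel" by (rule locint_borel)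
  let ?e = "axis i 1 :: real^'n"
  have "(\<integral>\<^sup>+x. ennreal (\<bar>u (x + t *\<^sub>R ?e) - u x\<bar> powr p) \<partial>lborel) \<le>
    (\<integral>\<^sup>+x. ennreal (t powr (p - 1)) * (\<integral>\<^sup>+s. indicator {0..t} s * ennreal (\<bar>v (x + s *\<^sub>R ?e)\<bar> powr p) \<partial>lborel) \<partial>lborel)"
  proof (rule nn_integral_mono_AE)
    show "AE x in lborel. ennreal (\<bar>u (x + t *\<^sub>R ?e) - u x\<bar> powr p) \<le>
       ennreal (t powr (p - 1)) * (\<integral>\<^sup>+s. indicator {0..t} s * ennreal (\<bar>v (x + s *\<^sub>R ?e)\<bar> powr p) \<partial>lborel)"
      using weak_deriv_line[OF w t] AE_integrable_line[OF v, of t i]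
    proof eventually_elim
      case (elim x)
      have "integrable lborel (\<lambda>s. indicator {0..t} s * \<bar>v (x + s *\<^sub>R ?e)\<bar>)"
        using integrable_abs[OF elim(2)] by (simp add: abs_mult)
      from integral_powr_Icc_le[OF this _ _ t p]
      have *: "ennreal ((LBINT s. indicator {0..t} s * \<bar>v (x + s *\<^sub>R ?e)\<bar>) powr p) \<le>
        ennreal (t powr (p - 1)) * (\<integral>\<^sup>+s. indicator {0..t} s * ennreal (\<bar>v (x + s *\<^sub>R ?e)\<bar> powr p) \<partial>lborel)"
        by simp
      have "\<bar>u (x + t *\<^sub>R ?e) - u x\<bar> \<le> (LBINT s. indicator {0..t} s * \<bar>v (x + s *\<^sub>R ?e)\<bar>)"
        unfolding elim(1) using integral_abs_bound[of lborel "\<lambda>s. indicator {0..t} s * v (x + s *\<^sub>R ?e)"]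
        by (simp add: abs_mult)
      then have "\<bar>u (x + t *\<^sub>R ?e) - u x\<bar> powr p \<le> (LBINT s. indicator {0..t} s * \<bar>v (x + s *\<^sub>R ?e)\<bar>) powr p"
        using p by (intro powr_mono2) auto
      then show ?case using * by (meson ennreal_leI order_trans)
    qed
  qed
  also have "\<dots> = ennreal (t powr (p - 1)) * (\<integral>\<^sup>+x. \<integral>\<^sup>+s. indicator {0..t} s * ennreal (\<bar>v (x + s *\<^sub>R ?e)\<bar> powr p) \<partial>lborel \<partial>lborel)"
    by (rule nn_integral_cmult) measurable
  also have "(\<integral>\<^sup>+x. \<integral>\<^sup>+s. indicator {0..t} s * ennreal (\<bar>v (x + s *\<^sub>R ?e)\<bar> powr p) \<partial>lborel \<partial>lborel)
     = (\<integral>\<^sup>+s. \<integral>\<^sup>+x. indicator {0..t} s * ennreal (\<bar>v (x + s *\<^sub>R ?e)\<bar> powr p) \<partial>lborel \<partial>lborel)"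
    by (rule lborel_pair.Fubini') measurable
  also have "\<dots> = (\<integral>\<^sup>+s. indicator {0..t} s * nn_Lp_mass p v \<partial>lborel)"
  proof (rule nn_integral_cong)
    fix s :: real
    have "(\<integral>\<^sup>+x. indicator {0..t} s * ennreal (\<bar>v (x + s *\<^sub>R ?e)\<bar> powr p) \<partial>lborel) =
      indicator {0..t} s * (\<integral>\<^sup>+x. ennreal (\<bar>v (x + s *\<^sub>R ?e)\<bar> powr p) \<partial>lborel)"
      by (rule nn_integral_cmult) measurable
    also have "(\<integral>\<^sup>+x. ennreal (\<bar>v (x + s *\<^sub>R ?e)\<bar> powr p) \<partial>lborel) = nn_Lp_mass p v"
      by (rule nn_integral_translate) simp
    finally show "(\<integral>\<^sup>+x. indicator {0..t} s * ennreal (\<bar>v (x + s *\<^sub>R ?e)\<bar> powr p) \<partial>lborel) =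
      indicator {0..t} s * nn_Lp_mass p v" .
  qed
  also have "\<dots> = emeasure lborel {0..t} * nn_Lp_mass p v"
    by (subst nn_integral_multc) auto
  also have "emeasure lborel {0..t} = ennreal t" using t by (simp add: emeasure_lborel_Icc_eq)
  also have "ennreal (t powr (p - 1)) * (ennreal t * nn_Lp_mass p v) =
     ennreal (t powr p) * nn_Lp_mass p v"
    using powr_mult_base[of t "p - 1"] t by (simp add: mult.assoc[symmetric] mult.commute flip: ennreal_mult)
  finally show ?thesis .
qed

section \<open>The Sobolev embedding\<close>

text \<open>The tangent inequalities at the midpoint are added; their linear terms cancel.\<close>

lemma powr_add_le:
  fixes a b p :: real
  assumes "0 \<le> a" "0 \<le> b" "1 < p"
  shows "(a + b) powr p \<le> 2 powr (p - 1) * (a powr p + b powr p)"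
proof -
  let ?m = "(a + b) / 2"
  have "2 * ?m powr p \<le> a powr p + b powr p"
    using powr_tangent[of a ?m p] powr_tangent[of b ?m p] assms by (simp add: field_simps)
  moreover have "(a + b) powr p = 2 powr p * ?m powr p"
    using assms by (simp add: powr_divide)
  moreover have "2 powr p = 2 * 2 powr (p - 1)" using powr_mult_base[of 2 "p - 1"] by simp
  ultimately show ?thesis by (simp add: mult_left_mono)
qed

lemma powr_superadditive:
  fixes a b p :: real
  assumes "0 \<le> a" "0 \<le> b" "1 < p"
  shows "a powr p + b powr p \<le> (a + b) powr p"
proof -
  have *: "x powr p = x * x powr (p - 1)" if "x \<ge> 0" for x :: real
    using powr_mult_base[of x "p - 1"] that by simp
  have "a powr p + b powr p \<le> a * (a + b) powr (p - 1) + b * (a + b) powr (p - 1)"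
    unfolding *[OF assms(1)] *[OF assms(2)] using assms
    by (intro add_mono mult_left_mono powr_mono2) auto
  also have "\<dots> = (a + b) powr p" using *[of "a + b"] assms by (simp add: algebra_simps)
  finally show ?thesis .
qed

text \<open>Iterated superadditivity, that is, the inclusion of l^1 in l^p with constant 1. Because
  no constant enters, the energies of arbitrarily many slices can be added.\<close>

lemma sum_powr_le:
  fixes f :: "'i \<Rightarrow> real"
  assumes "\<And>i. i \<in> A \<Longrightarrow> 0 \<le> f i" "1 < p"
  shows "(\<Sum>i\<in>A. f i powr p) \<le> (\<Sum>i\<in>A. f i) powr p"
  using assms(1)
proof (induction A rule: infinite_finite_induct)
  case (insert x A)
  have "(\<Sum>i\<in>insert x A. f i powr p) \<le> f x powr p + (\<Sum>i\<in>A. f i) powr p"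
    using insert by simp
  also have "\<dots> \<le> (f x + (\<Sum>i\<in>A. f i)) powr p"
    using insert assms by (intro powr_superadditive sum_nonneg) auto
  finally show ?case using insert by simp
qed auto

section \<open>Translation energies and their scaling\<close>

definition transl_energy :: "real \<Rightarrow> (real^'n::finite \<Rightarrow> real) \<Rightarrow> real^'n \<Rightarrow> ennreal" where
  "transl_energy p g z = (\<integral>\<^sup>+x. ennreal (\<bar>g (x + z) - g x\<bar> powr p) \<partial>lborel)"

lemma transl_energy_add:
  fixes g :: "real^'n::finite \<Rightarrow> real"
  assumes [measurable]: "g \<in> borel_measurable borel" and p: "1 < p"
  shows "transl_energy p g (y + z) \<le> ennreal (2 powr (p - 1)) * (transl_energy p g y + transl_energy p g z)"
proof -
  have "transl_energy p g (y + z) \<le> (\<integral>\<^sup>+x. ennreal (2 powr (p - 1)) *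
     (ennreal (\<bar>g (x + z + y) - g (x + z)\<bar> powr p) + ennreal (\<bar>g (x + z) - g x\<bar> powr p)) \<partial>lborel)"
    unfolding transl_energy_def
  proof (rule nn_integral_mono)
    fix x
    have "\<bar>g (x + (y + z)) - g x\<bar> powr p \<le> (\<bar>g (x + z + y) - g (x + z)\<bar> + \<bar>g (x + z) - g x\<bar>) powr p"
      using p by (intro powr_mono2) (auto simp: algebra_simps)
    also have "\<dots> \<le> 2 powr (p - 1) * (\<bar>g (x + z + y) - g (x + z)\<bar> powr p + \<bar>g (x + z) - g x\<bar> powr p)"
      using p by (intro powr_add_le) auto
    finally show "ennreal (\<bar>g (x + (y + z)) - g x\<bar> powr p) \<le> ennreal (2 powr (p - 1)) *
     (ennreal (\<bar>g (x + z + y) - g (x + z)\<bar> powr p) + ennreal (\<bar>g (x + z) - g x\<bar> powr p))"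
      by (simp add: ennreal_leI flip: ennreal_plus ennreal_mult)
  qed
  also have "\<dots> = ennreal (2 powr (p - 1)) * ((\<integral>\<^sup>+x. ennreal (\<bar>g (x + z + y) - g (x + z)\<bar> powr p) \<partial>lborel) + transl_energy p g z)"
    unfolding transl_energy_def by (subst nn_integral_cmult, measurable, subst nn_integral_add) auto
  also have "(\<integral>\<^sup>+x. ennreal (\<bar>g (x + z + y) - g (x + z)\<bar> powr p) \<partial>lborel) = transl_energy p g y"
    unfolding transl_energy_def by (rule nn_integral_translate[of "\<lambda>x. ennreal (\<bar>g (x + y) - g x\<bar> powr p)"]) simp
  finally show ?thesis .
qed

text \<open>One doubling costs 2^(p-1) from convexity and 2 from the two equal terms, together
  exactly 2^p. This is the homogeneous scaling, so no constant accumulates over \<open>n\<close>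
  doublings.\<close>

lemma transl_energy_pow2:
  fixes g :: "real^'n::finite \<Rightarrow> real"
  assumes [measurable]: "g \<in> borel_measurable borel" and p: "1 < p"
  shows "transl_energy p g ((2 ^ n) *\<^sub>R z) \<le> ennreal ((2 ^ n) powr p) * transl_energy p g z"
proof (induction n)
  case (Suc n)
  have "transl_energy p g ((2 ^ Suc n) *\<^sub>R z) = transl_energy p g ((2 ^ n) *\<^sub>R z + (2 ^ n) *\<^sub>R z)"
    by (simp add: scaleR_2 flip: scaleR_add_left)
  also have "\<dots> \<le> ennreal (2 powr (p - 1)) * (transl_energy p g ((2 ^ n) *\<^sub>R z) + transl_energy p g ((2 ^ n) *\<^sub>R z))"
    by (intro transl_energy_add assms)
  also have "\<dots> = ennreal (2 powr p) * transl_energy p g ((2 ^ n) *\<^sub>R z)"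
  proof -
    have "2 powr p = 2 powr (p - 1) * 2" using powr_mult_base[of 2 "p - 1"] by simp
    then have "ennreal (2 powr p) = ennreal (2 powr (p - 1)) * 2" by (simp add: ennreal_mult)
    then show ?thesis by (simp only: mult_2[symmetric] mult.assoc)
  qed
  also have "\<dots> \<le> ennreal (2 powr p) * (ennreal ((2 ^ n) powr p) * transl_energy p g z)"
    by (intro mult_left_mono Suc) simp
  also have "\<dots> = ennreal ((2 ^ Suc n) powr p) * transl_energy p g z"
    by (simp add: powr_mult ennreal_mult mult.assoc)
  finally show ?case .
qed simp

text \<open>A displacement is composed of coordinate moves, each controlled by the corresponding
  derivative. The constant is quantified before \<open>u\<close>, \<open>v\<close>, \<open>M\<close>
  and \<open>t\<close> so that the embedding constants become uniform over bounded families.\<close>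

lemma transl_energy_axes:
  fixes p :: real and S :: "'n::finite set"
  assumes p: "1 < p" and "finite S"
  shows "\<exists>c\<ge>0. \<forall>(u::real^'n \<Rightarrow> real) v M t z. (\<forall>i. weak_deriv (axis_index i) u (v i)) \<longrightarrow>
    (\<forall>i. nn_Lp_mass p (v i) \<le> ennreal M) \<longrightarrow> 0 \<le> M \<longrightarrow> 0 \<le> t \<longrightarrow>
    (\<forall>i. 0 \<le> z i \<and> z i \<le> t) \<longrightarrow> transl_energy p u (\<Sum>i\<in>S. z i *\<^sub>R axis i 1) \<le> ennreal (c * M * t powr p)"
  using assms(2)
proof (induction S rule: finite_induct)
  case empty
  show ?case by (auto simp: transl_energy_def intro!: exI[of _ 0])
next
  case (insert j S)
  then obtain c where c: "c \<ge> 0" and IH: "\<And>(u::real^'n \<Rightarrow> real) v M t z. (\<forall>i. weak_deriv (axis_index i) u (v i)) \<Longrightarrow>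
    (\<forall>i. nn_Lp_mass p (v i) \<le> ennreal M) \<Longrightarrow> 0 \<le> M \<Longrightarrow> 0 \<le> t \<Longrightarrow>
    (\<forall>i. 0 \<le> z i \<and> z i \<le> t) \<Longrightarrow> transl_energy p u (\<Sum>i\<in>S. z i *\<^sub>R axis i 1) \<le> ennreal (c * M * t powr p)"
    by blast
  show ?case
  proof (intro exI[of _ "2 powr (p - 1) * (1 + c)"] conjI allI impI)
    fix u :: "real^'n \<Rightarrow> real" and v M t and z :: "'n \<Rightarrow> real"
    assume w: "\<forall>i. weak_deriv (axis_index i) u (v i)"
      and M: "\<forall>i. nn_Lp_mass p (v i) \<le> ennreal M" "0 \<le> M"
      and t: "0 \<le> t" and z: "\<forall>i. 0 \<le> z i \<and> z i \<le> t"
    have u: "u \<in> borel_measurable borel" using w by (auto simp: weak_deriv_def locint_borel)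
    have "transl_energy p u (z j *\<^sub>R axis j 1) \<le> ennreal (z j powr p) * nn_Lp_mass p (v j)"
      unfolding transl_energy_def using w z by (intro nn_integral_translation_diff_axis p) auto
    also have "\<dots> \<le> ennreal (t powr p) * ennreal M"
      using M z p by (intro mult_mono ennreal_leI powr_mono2) auto
    finally have 1: "transl_energy p u (z j *\<^sub>R axis j 1) \<le> ennreal (M * t powr p)"
      using M by (simp add: mult.commute flip: ennreal_mult)
    have "transl_energy p u (\<Sum>i\<in>insert j S. z i *\<^sub>R axis i 1) \<le>
      ennreal (2 powr (p - 1)) * (transl_energy p u (z j *\<^sub>R axis j 1) + transl_energy p u (\<Sum>i\<in>S. z i *\<^sub>R axis i 1))"
      using insert by (simp add: transl_energy_add[OF u p])
    also have "\<dots> \<le> ennreal (2 powr (p - 1)) * (ennreal (M * t powr p) + ennreal (c * M * t powr p))"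
      by (intro mult_left_mono add_mono 1 IH[OF w M t z]) auto
    also have "\<dots> = ennreal (2 powr (p - 1) * (1 + c) * M * t powr p)"
      using M c by (simp add: algebra_simps flip: ennreal_plus ennreal_mult)
    finally show "transl_energy p u (\<Sum>i\<in>insert j S. z i *\<^sub>R axis i 1) \<le> ennreal (2 powr (p - 1) * (1 + c) * M * t powr p)" .
  qed (use c in auto)
qed

section \<open>Dyadic truncations and the measure of level sets\<close>

definition slice :: "nat \<Rightarrow> real \<Rightarrow> real" where
  "slice j s = min (max (\<bar>s\<bar> - 2 ^ j) 0) (2 ^ j)"

text \<open>The layers from 2^j to 2^(j+1) with j < J tile the range from 1 to 2^J, which explains
  the two shifts by 1; values below 1 are left to the L^p mass.\<close>

lemma sum_slice: "(\<Sum>j<J. slice j s) = min (max (\<bar>s\<bar> - 1) 0) (2 ^ J - 1)"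
proof (induction J)
  case (Suc J)
  define a :: real where "a = 2 ^ J"
  have "a \<ge> 1" by (simp add: a_def)
  then show ?case using Suc by (auto simp: slice_def min_def max_def a_def[symmetric])
qed simp

lemma slice_mono: "\<bar>s\<bar> \<le> \<bar>s'\<bar> \<Longrightarrow> slice j s \<le> slice j s'"
  by (auto simp: slice_def)

text \<open>All slices are nondecreasing in |s|, so their increments share a sign, and the sum of
  the absolute values is the increment of a 1-Lipschitz clamp of |s|.\<close>

lemma sum_abs_slice_diff: "(\<Sum>j<J. \<bar>slice j s - slice j s'\<bar>) \<le> \<bar>s - s'\<bar>"
proof -
  have *: "(\<Sum>j<J. \<bar>slice j s - slice j s'\<bar>) \<le> \<bar>s - s'\<bar>" if "\<bar>s\<bar> \<le> \<bar>s'\<bar>" for s s'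
  proof -
    have "(\<Sum>j<J. \<bar>slice j s - slice j s'\<bar>) = (\<Sum>j<J. slice j s') - (\<Sum>j<J. slice j s)"
      unfolding sum_subtractf[symmetric] using slice_mono[OF that] by (intro sum.cong) auto
    also have "\<dots> \<le> \<bar>s'\<bar> - \<bar>s\<bar>" unfolding sum_slice using that by (auto simp: min_def max_def)
    finally show ?thesis by linarith
  qed
  show ?thesis
  proof (cases "\<bar>s\<bar> \<le> \<bar>s'\<bar>")
    case False
    then show ?thesis using *[of s' s] by (simp add: abs_minus_commute)
  qed (rule *)
qed

lemma borel_measurable_slice [measurable]: "slice j \<in> borel_measurable borel"
  unfolding slice_def by measurable

lemma sum_transl_energy_slice:
  fixes u :: "real^'n::finite \<Rightarrow> real"
  assumes [measurable]: "u \<in> borel_measurable borel" and p: "1 < p"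
  shows "(\<Sum>j<J. transl_energy p (\<lambda>x. slice j (u x)) z) \<le> transl_energy p u z"
proof -
  have "(\<Sum>j<J. transl_energy p (\<lambda>x. slice j (u x)) z) =
    (\<integral>\<^sup>+x. (\<Sum>j<J. ennreal (\<bar>slice j (u (x + z)) - slice j (u x)\<bar> powr p)) \<partial>lborel)"
    unfolding transl_energy_def by (rule nn_integral_sum[symmetric]) measurable
  also have "\<dots> \<le> transl_energy p u z"
    unfolding transl_energy_def
  proof (rule nn_integral_mono)
    fix x
    have "(\<Sum>j<J. \<bar>slice j (u (x + z)) - slice j (u x)\<bar> powr p) \<le> (\<Sum>j<J. \<bar>slice j (u (x + z)) - slice j (u x)\<bar>) powr p"
      using p by (intro sum_powr_le) auto
    also have "\<dots> \<le> \<bar>u (x + z) - u x\<bar> powr p"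
      using p by (intro powr_mono2 sum_abs_slice_diff sum_nonneg) auto
    finally show "(\<Sum>j<J. ennreal (\<bar>slice j (u (x + z)) - slice j (u x)\<bar> powr p)) \<le> ennreal (\<bar>u (x + z) - u x\<bar> powr p)"
      by (simp add: sum_ennreal ennreal_leI)
  qed
  finally show ?thesis .
qed

lemma emeasure_affine_vimage:
  fixes A :: "(real^'n::finite) set"
  assumes A: "A \<in> sets borel" and h: "h > 0"
  shows "emeasure lborel A = ennreal (h ^ CARD('n)) * emeasure lborel {z. x + h *\<^sub>R z \<in> A}"
proof -
  let ?B = "{z. x + h *\<^sub>R z \<in> A}"
  have "(\<lambda>z. x + h *\<^sub>R z) \<in> borel_measurable borel" by measurable
  from measurable_sets[OF this A] have B: "?B \<in> sets borel" by (simp add: vimage_def)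
  have "A = (\<lambda>z. h *\<^sub>R z + x) ` ?B"
  proof (intro set_eqI iffI)
    fix a assume "a \<in> A"
    then show "a \<in> (\<lambda>z. h *\<^sub>R z + x) ` ?B"
      using h by (intro image_eqI[of _ _ "(1 / h) *\<^sub>R (a - x)"]) auto
  qed (auto simp: add.commute)
  then have "emeasure lebesgue A = \<bar>h\<bar> ^ DIM(real^'n) * emeasure lebesgue ?B"
    using emeasure_lebesgue_affine[of h x ?B] by (simp add: add.commute)
  then show ?thesis using A B h by simp
qed


text \<open>Where |u| > 2^(j+1) the slice equals 2^j. The cube of side \<open>h\<close> attached to
  such a point has at least twice the volume of {|u| > 2^j}, so on at least half of it the slice
  vanishes. Averaging over the cube therefore leaves 2^(jp)/2 at each such point.\<close>

lemma level_step:
  fixes u :: "real^'n::finite \<Rightarrow> real"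
  assumes [measurable]: "u \<in> borel_measurable borel" and p: "1 < p" and h: "h > 0"
    and a: "2 * emeasure lborel {x. 2 ^ j < \<bar>u x\<bar>} \<le> ennreal (h ^ CARD('n))"
  shows "ennreal ((2 ^ j) powr p / 2) * emeasure lborel {x. 2 ^ Suc j < \<bar>u x\<bar>} \<le>
    (\<integral>\<^sup>+\<zeta>. indicator (cbox 0 (\<chi> i. 1)) \<zeta> * transl_energy p (\<lambda>x. slice j (u x)) (h *\<^sub>R \<zeta>) \<partial>lborel)"
proof -
  define Q :: "(real^'n) set" where "Q = cbox 0 (\<chi> i. 1)"
  define A where "A = {x. 2 ^ j < \<bar>u x\<bar>}"
  define A' where "A' = {x. 2 ^ Suc j < \<bar>u x\<bar>}"
  have Am [measurable]: "A \<in> sets borel" "A' \<in> sets borel" unfolding A_def A'_def by measurable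
  have Qm [measurable]: "Q \<in> sets borel" unfolding Q_def by simp
  have Q1: "emeasure lborel Q = 1"
    unfolding Q_def by (subst emeasure_lborel_cbox_eq) (auto simp: Basis_vec_def inner_axis prod.neutral)
  have half: "ennreal (1 / 2) \<le> emeasure lborel (Q - {\<zeta>. x + h *\<^sub>R \<zeta> \<in> A})" for x
  proof -
    let ?B = "{\<zeta>. x + h *\<^sub>R \<zeta> \<in> A}"
    have Bm [measurable]: "?B \<in> sets borel"
      using measurable_sets[of "\<lambda>\<zeta>. x + h *\<^sub>R \<zeta>" borel borel A] by (simp add: vimage_def)
    have "ennreal (h ^ CARD('n)) * (2 * emeasure lborel ?B) \<le> ennreal (h ^ CARD('n)) * 1"
      using a emeasure_affine_vimage[OF Am(1) h, of x] by (simp add: A_def mult.left_commute)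
    then have "2 * emeasure lborel ?B \<le> 1"
      using h by (subst (asm) ennreal_mult_le_mult_iff) auto
    then have "ennreal (1 / 2) * (2 * emeasure lborel ?B) \<le> ennreal (1 / 2) * 1"
      by (intro mult_left_mono) auto
    moreover have "ennreal (1 / 2) * 2 = 1"
    proof -
      have "ennreal (1 / 2) * 2 = ennreal (1 / 2) * ennreal 2" by simp
      also have "\<dots> = ennreal (1 / 2 * 2)" by (rule ennreal_mult[symmetric]) auto
      finally show ?thesis by simp
    qed
    ultimately have B: "emeasure lborel ?B \<le> ennreal (1 / 2)"
      by (simp only: mult.assoc[symmetric] mult_1_left mult_1_right)
    have "1 \<le> emeasure lborel ((Q - ?B) \<union> ?B)"
      unfolding Q1[symmetric] by (intro emeasure_mono) auto
    also have "\<dots> \<le> emeasure lborel (Q - ?B) + emeasure lborel ?B"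
      by (intro emeasure_subadditive) auto
    also have "\<dots> \<le> emeasure lborel (Q - ?B) + ennreal (1 / 2)" by (intro add_left_mono B)
    finally have le: "1 \<le> emeasure lborel (Q - ?B) + ennreal (1 / 2)" .
    show ?thesis
    proof (cases "emeasure lborel (Q - ?B)")
      case (real r)
      then have "ennreal 1 \<le> ennreal (r + 1 / 2)" using le by (subst ennreal_plus) auto
      then have "1 \<le> r + 1 / 2" using real by (subst (asm) ennreal_le_iff) auto
      then show ?thesis unfolding real(2) by (intro ennreal_leI) linarith
    qed simp
  qed
  have "ennreal ((2 ^ j) powr p / 2) * emeasure lborel A' = (\<integral>\<^sup>+x. ennreal ((2 ^ j) powr p / 2) * indicator A' x \<partial>lborel)"
    by (subst nn_integral_cmult_indicator) auto
  also have "\<dots> \<le> (\<integral>\<^sup>+x. \<integral>\<^sup>+\<zeta>. indicator Q \<zeta> * ennreal (\<bar>slice j (u (x + h *\<^sub>R \<zeta>)) - slice j (u x)\<bar> powr p) \<partial>lborel \<partial>lborel)"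
  proof (rule nn_integral_mono)
    fix x
    show "ennreal ((2 ^ j) powr p / 2) * indicator A' x \<le>
      (\<integral>\<^sup>+\<zeta>. indicator Q \<zeta> * ennreal (\<bar>slice j (u (x + h *\<^sub>R \<zeta>)) - slice j (u x)\<bar> powr p) \<partial>lborel)"
    proof (cases "x \<in> A'")
      case True
      then have sx: "slice j (u x) = 2 ^ j" by (auto simp: A'_def slice_def)
      let ?B = "{\<zeta>. x + h *\<^sub>R \<zeta> \<in> A}"
      have Bm [measurable]: "?B \<in> sets borel"
        using measurable_sets[of "\<lambda>\<zeta>. x + h *\<^sub>R \<zeta>" borel borel A] by (simp add: vimage_def)
      have "ennreal ((2 ^ j) powr p / 2) = ennreal ((2 ^ j) powr p) * ennreal (1 / 2)"
        by (subst ennreal_mult[symmetric]) auto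
      also have "\<dots> \<le> ennreal ((2 ^ j) powr p) * emeasure lborel (Q - ?B)"
        by (intro mult_left_mono half) simp
      also have "\<dots> = (\<integral>\<^sup>+\<zeta>. ennreal ((2 ^ j) powr p) * indicator (Q - ?B) \<zeta> \<partial>lborel)"
        by (subst nn_integral_cmult_indicator) auto
      also have "\<dots> \<le> (\<integral>\<^sup>+\<zeta>. indicator Q \<zeta> * ennreal (\<bar>slice j (u (x + h *\<^sub>R \<zeta>)) - slice j (u x)\<bar> powr p) \<partial>lborel)"
      proof -
        have "slice j s = 0" if "\<not> 2 ^ j < \<bar>s\<bar>" for s using that by (auto simp: slice_def)
        then show ?thesis by (intro nn_integral_mono) (auto simp: indicator_def sx A_def)
      qed
      finally show ?thesis using True by simp
    qed simp
  qed
  also have "\<dots> = (\<integral>\<^sup>+\<zeta>. \<integral>\<^sup>+x. indicator Q \<zeta> * ennreal (\<bar>slice j (u (x + h *\<^sub>R \<zeta>)) - slice j (u x)\<bar> powr p) \<partial>lborel \<partial>lborel)"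
    by (rule lborel_pair.Fubini') measurable
  also have "\<dots> = (\<integral>\<^sup>+\<zeta>. indicator Q \<zeta> * transl_energy p (\<lambda>x. slice j (u x)) (h *\<^sub>R \<zeta>) \<partial>lborel)"
    unfolding transl_energy_def by (intro nn_integral_cong nn_integral_cmult) measurable
  finally show ?thesis unfolding A'_def Q_def .
qed

lemma transl_energy_measurable [measurable]:
  fixes g :: "real^'n::finite \<Rightarrow> real"
  assumes [measurable]: "g \<in> borel_measurable borel"
  shows "transl_energy p g \<in> borel_measurable borel"
  unfolding transl_energy_def by measurable

text \<open>The difference quotients of dyadic truncations add up to that of \<open>u\<close> only at a common
  scale.  Since \<open>transl_energy p g (2 z) \<le> 2 powr p * transl_energy p g z\<close>, each scale \<open>h j\<close> can be
  reduced to the smallest one.\<close>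

lemma level_sum:
  fixes u :: "real^'n::finite \<Rightarrow> real"
  assumes [measurable]: "u \<in> borel_measurable borel" and p: "1 < p" and t: "t > 0"
    and h: "\<And>j. j \<in> J \<Longrightarrow> h j = 2 ^ n j * t"
    and a: "\<And>j. j \<in> J \<Longrightarrow> 2 * emeasure lborel {x. 2 ^ j < \<bar>u x\<bar>} \<le> ennreal (h j ^ CARD('n))"
    and J: "J \<subseteq> {..<K}"
    and D: "\<And>z. (\<And>i. 0 \<le> z $ i \<and> z $ i \<le> t) \<Longrightarrow> transl_energy p u z \<le> ennreal (D * t powr p)" "D \<ge> 0"
  shows "(\<Sum>j\<in>J. ennreal (h j powr (- p) * ((2 ^ j) powr p / 2)) * emeasure lborel {x. 2 ^ Suc j < \<bar>u x\<bar>}) \<le> ennreal D"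
proof -
  define Q :: "(real^'n) set" where "Q = cbox 0 (\<chi> i. 1)"
  have Qm [measurable]: "Q \<in> sets borel" unfolding Q_def by simp
  have Q1: "emeasure lborel Q = 1"
    unfolding Q_def by (subst emeasure_lborel_cbox_eq) (auto simp: Basis_vec_def inner_axis prod.neutral)
  let ?E = "\<lambda>j. transl_energy p (\<lambda>x. slice j (u x))"
  have fin: "finite J" using J finite_subset by blast
  have hpos: "h j > 0" if "j \<in> J" for j using h[OF that] t by simp
  have "(\<Sum>j\<in>J. ennreal (h j powr (- p) * ((2 ^ j) powr p / 2)) * emeasure lborel {x. 2 ^ Suc j < \<bar>u x\<bar>}) \<le>
    (\<Sum>j\<in>J. ennreal (h j powr (- p)) * (\<integral>\<^sup>+\<zeta>. indicator Q \<zeta> * ?E j (h j *\<^sub>R \<zeta>) \<partial>lborel))"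
  proof (rule sum_mono)
    fix j assume j: "j \<in> J"
    have "ennreal (h j powr (- p) * ((2 ^ j) powr p / 2)) * emeasure lborel {x. 2 ^ Suc j < \<bar>u x\<bar>} =
      ennreal (h j powr (- p)) * (ennreal ((2 ^ j) powr p / 2) * emeasure lborel {x. 2 ^ Suc j < \<bar>u x\<bar>})"
      by (subst ennreal_mult) (auto simp: mult.assoc)
    also have "\<dots> \<le> ennreal (h j powr (- p)) * (\<integral>\<^sup>+\<zeta>. indicator Q \<zeta> * ?E j (h j *\<^sub>R \<zeta>) \<partial>lborel)"
      unfolding Q_def by (intro mult_left_mono level_step p hpos j a) auto
    finally show "ennreal (h j powr (- p) * ((2 ^ j) powr p / 2)) * emeasure lborel {x. 2 ^ Suc j < \<bar>u x\<bar>} \<le>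
       ennreal (h j powr (- p)) * (\<integral>\<^sup>+\<zeta>. indicator Q \<zeta> * ?E j (h j *\<^sub>R \<zeta>) \<partial>lborel)" .
  qed
  also have "\<dots> = (\<integral>\<^sup>+\<zeta>. (\<Sum>j\<in>J. ennreal (h j powr (- p)) * (indicator Q \<zeta> * ?E j (h j *\<^sub>R \<zeta>))) \<partial>lborel)"
    by (subst nn_integral_sum) (auto intro!: sum.cong nn_integral_cmult[symmetric])
  also have "\<dots> \<le> (\<integral>\<^sup>+\<zeta>. ennreal D * indicator Q \<zeta> \<partial>lborel)"
  proof (rule nn_integral_mono)
    fix \<zeta>
    show "(\<Sum>j\<in>J. ennreal (h j powr (- p)) * (indicator Q \<zeta> * ?E j (h j *\<^sub>R \<zeta>))) \<le> ennreal D * indicator Q \<zeta>"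
    proof (cases "\<zeta> \<in> Q")
      case True
      have "(\<Sum>j\<in>J. ennreal (h j powr (- p)) * ?E j (h j *\<^sub>R \<zeta>)) \<le> (\<Sum>j\<in>J. ennreal (t powr (- p)) * ?E j (t *\<^sub>R \<zeta>))"
      proof (rule sum_mono)
        fix j assume j: "j \<in> J"
        have "?E j (h j *\<^sub>R \<zeta>) \<le> ennreal ((2 ^ n j) powr p) * ?E j (t *\<^sub>R \<zeta>)"
          using transl_energy_pow2[OF _ p, of "\<lambda>x. slice j (u x)" "n j" "t *\<^sub>R \<zeta>"] h[OF j] by simp
        then have "ennreal (h j powr (- p)) * ?E j (h j *\<^sub>R \<zeta>) \<le>
          ennreal (h j powr (- p)) * (ennreal ((2 ^ n j) powr p) * ?E j (t *\<^sub>R \<zeta>))"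
          by (intro mult_left_mono) auto
        also have "\<dots> = ennreal (h j powr (- p) * (2 ^ n j) powr p) * ?E j (t *\<^sub>R \<zeta>)"
          by (simp add: ennreal_mult mult.assoc)
        also have "h j powr (- p) * (2 ^ n j) powr p = t powr (- p)"
          using t by (simp add: h[OF j] powr_mult powr_minus field_simps)
        finally show "ennreal (h j powr (- p)) * ?E j (h j *\<^sub>R \<zeta>) \<le> ennreal (t powr (- p)) * ?E j (t *\<^sub>R \<zeta>)" .
      qed
      also have "\<dots> = ennreal (t powr (- p)) * (\<Sum>j\<in>J. ?E j (t *\<^sub>R \<zeta>))" by (simp add: sum_distrib_left)
      also have "(\<Sum>j\<in>J. ?E j (t *\<^sub>R \<zeta>)) \<le> (\<Sum>j<K. ?E j (t *\<^sub>R \<zeta>))"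
        using J by (intro sum_mono2) auto
      also have "\<dots> \<le> transl_energy p u (t *\<^sub>R \<zeta>)" by (intro sum_transl_energy_slice p) auto
      also have "\<dots> \<le> ennreal (D * t powr p)"
        using True t by (intro D) (auto simp: Q_def mem_box_cart mult_left_le)
      also have "ennreal (t powr (- p)) * ennreal (D * t powr p) = ennreal D"
        using t D(2) by (simp add: powr_minus field_simps flip: ennreal_mult)
      finally show ?thesis using True by (simp add: mult_left_mono)
    qed simp
  qed
  also have "\<dots> = ennreal D" by (subst nn_integral_cmult_indicator) (auto simp: Q1)
  finally show ?thesis .
qed


lemma ex_dyadic_between:
  fixes s t :: real
  assumes "0 < t" "t \<le> s"
  shows "\<exists>n. s \<le> 2 ^ n * t \<and> 2 ^ n * t \<le> 2 * s"
proof -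
  obtain k where "s / t < 2 ^ k" using real_arch_pow[of 2 "s / t"] by auto
  then have ex: "\<exists>n. s \<le> 2 ^ n * t" using assms by (intro exI[of _ k]) (simp add: field_simps)
  define n where "n = (LEAST n. s \<le> 2 ^ n * t)"
  have n: "s \<le> 2 ^ n * t" unfolding n_def by (rule LeastI_ex[OF ex])
  have "2 ^ n * t \<le> 2 * s"
  proof (cases n)
    case 0
    then show ?thesis using assms by simp
  next
    case (Suc k)
    then have "\<not> s \<le> 2 ^ k * t" unfolding n_def using not_less_Least by (metis lessI)
    then show ?thesis using Suc by simp
  qed
  then show ?thesis using n by blast
qed

text \<open>Beyond 1 the constant \<open>K\<close> is absorbed into
  \<open>K * X powr \<theta>\<close>, and division by \<open>X powr \<theta>\<close> leaves a power
  of \<open>X\<close> with positive exponent. \<open>X\<close> is a real number, so the absorption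
  is legitimate; in the application it is a finite partial sum and the bound does not depend on its
  length.\<close>

lemma sublinear_bound:
  fixes X R \<theta> :: real
  assumes "X \<le> K + L * X powr \<theta>" "0 \<le> \<theta>" "\<theta> < 1" "0 \<le> K" "0 \<le> L"
  shows "X \<le> max 1 ((K + L) powr (1 / (1 - \<theta>)))"
proof (cases "X \<le> 1")
  case False
  then have "1 \<le> X powr \<theta>" using assms by (simp add: ge_one_powr_ge_zero)
  then have "K + L * X powr \<theta> \<le> (K + L) * X powr \<theta>"
    using assms mult_left_mono[of 1 "X powr \<theta>" K] by (simp add: algebra_simps)
  then have "X \<le> (K + L) * X powr \<theta>" using assms by linarith
  then have "X / X powr \<theta> \<le> K + L" using False by (simp add: field_simps)
  moreover have "X / X powr \<theta> = X powr (1 - \<theta>)" using False by (simp add: powr_diff)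
  ultimately have "(X powr (1 - \<theta>)) powr (1 / (1 - \<theta>)) \<le> (K + L) powr (1 / (1 - \<theta>))"
    using assms by (intro powr_mono2) auto
  then have "X \<le> (K + L) powr (1 / (1 - \<theta>))" using False assms by (simp add: powr_powr)
  then show ?thesis by simp
qed simp

text \<open>Level \<open>j\<close> is examined at a scale h_j comparable to (2 a_j)^(1/N), where N
  is the dimension and a_j the measure of {|u| > 2^j}. With b_j = 2^(jq) a_j and \<theta> = 1 - p/q,
  the hypothesis on the exponents says \<theta> <= p/N and yields b_(j+1) <= L m_j b_j^\<theta>,
  where the m_j sum to at most \<open>D\<close> by \<open>level_sum\<close>. Bounding b_j by the
  whole sum X gives X <= K + L D X^\<theta>, which is sublinear even in the critical case \<theta> =
  p/N. In \<open>L\<close> the factors come from the index shift, the half in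
  \<open>level_step\<close>, the dyadic rounding, and the normalisation of a_j by
  \<open>K\<close>.\<close>

lemma level_measures_bound:
  fixes u :: "real^'n::finite \<Rightarrow> real" and p q K D :: real
  assumes [measurable]: "u \<in> borel_measurable borel" and p: "1 < p" and pq: "p < q" and N: "1 / p - 1 / q \<le> 1 / real CARD('n)"
    and K: "1 \<le> K" and D: "0 \<le> D"
    and uK: "nn_Lp_mass p u \<le> ennreal K"
    and uD: "\<And>t z. 0 < t \<Longrightarrow> (\<And>i. 0 \<le> z $ i \<and> z $ i \<le> t) \<Longrightarrow> transl_energy p u z \<le> ennreal (D * t powr p)"
  defines "L \<equiv> 2 powr q * 2 * 2 powr p * (2 * K) powr (p / real CARD('n))"
  shows "(\<Sum>j\<le>n. (2 ^ j) powr q * measure lborel {x. 2 ^ j < \<bar>u x\<bar>}) \<le> max 1 ((K + L * D) powr (q / p))"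
    and "emeasure lborel {x. 2 ^ j < \<bar>u x\<bar>} = ennreal (measure lborel {x. 2 ^ j < \<bar>u x\<bar>})"
proof -
  define A where "A j = {x. 2 ^ j < \<bar>u x\<bar>}" for j :: nat
  have Am [measurable]: "A j \<in> sets borel" for j unfolding A_def by measurable
  define a where "a j = measure lborel (A j)" for j
  have le: "emeasure lborel (A j) \<le> ennreal K" for j
  proof -
    have "emeasure lborel (A j) = (\<integral>\<^sup>+x. indicator (A j) x \<partial>lborel)" by simp
    also have "\<dots> \<le> nn_Lp_mass p u"
    proof (rule nn_integral_mono)
      fix x
      have "1 \<le> \<bar>u x\<bar> powr p" if "x \<in> A j"
      proof -
        have "(1::real) \<le> 2 ^ j" by simp
        moreover have "2 ^ j < \<bar>u x\<bar>" using that by (simp add: A_def)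
        ultimately have "1 \<le> \<bar>u x\<bar>" by linarith
        then show ?thesis using p by (simp add: ge_one_powr_ge_zero)
      qed
      then show "indicator (A j) x \<le> ennreal (\<bar>u x\<bar> powr p)" by (auto simp: indicator_def)
    qed
    finally show ?thesis using uK by simp
  qed
  then have fin: "emeasure lborel (A j) \<noteq> top" for j using le_less_trans[OF le[of j] ennreal_less_top] by simp
  have aA: "emeasure lborel (A j) = ennreal (a j)" for j
    unfolding a_def using fin by (intro emeasure_eq_ennreal_measure) auto
  then show "emeasure lborel {x. 2 ^ j < \<bar>u x\<bar>} = ennreal (measure lborel {x. 2 ^ j < \<bar>u x\<bar>})"
    by (simp add: A_def a_def)
  have a0: "0 \<le> a j" for j by (simp add: a_def)
  have aK: "a j \<le> K" for j using le[of j] K unfolding aA by (simp add: ennreal_le_iff)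
  have a_Suc: "a (Suc j) \<le> a j" for j
  proof -
    have "A (Suc j) \<subseteq> A j"
    proof
      fix x assume "x \<in> A (Suc j)"
      moreover have "(2::real) ^ j \<le> 2 ^ Suc j" by simp
      ultimately show "x \<in> A j" unfolding A_def mem_Collect_eq by linarith
    qed
    then have "emeasure lborel (A (Suc j)) \<le> emeasure lborel (A j)" by (intro emeasure_mono) auto
    then show ?thesis using a0 unfolding aA by (simp add: ennreal_le_iff)
  qed
  define \<theta> where "\<theta> = 1 - p / q"
  have \<theta>: "0 \<le> \<theta>" "\<theta> < 1" "q * \<theta> = q - p" "1 / (1 - \<theta>) = q / p"
    using p pq by (auto simp: \<theta>_def field_simps)
  have \<theta>N: "\<theta> \<le> p / real CARD('n)"
  proof -
    have "p * (1 / p - 1 / q) \<le> p * (1 / real CARD('n))" using p by (intro mult_left_mono N) auto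
    moreover have "p * (1 / p - 1 / q) = \<theta>" using p by (simp add: \<theta>_def right_diff_distrib)
    ultimately show ?thesis by simp
  qed
  define s where "s j = (2 * a j) powr (1 / real CARD('n))" for j
  \<comment> \<open>Levels of measure 0 offer no positive scale; they contribute nothing, since the
    next level is then null as well (\<open>b_notin\<close>).\<close>
  define J where "J = {j. j < n \<and> a j > 0}"
  have finJ: "finite J" by (simp add: J_def)
  have sJ: "0 < s j" if "j \<in> J" for j using that by (simp add: s_def J_def)
  \<comment> \<open>The common base scale of \<open>level_sum\<close>; the inserted 1 keeps the
    minimum meaningful when \<open>J\<close> is empty.\<close>
  define t where "t = Min (insert 1 (s ` J))"
  have t: "t > 0" unfolding t_def using finJ sJ by (subst Min_gr_iff) auto
  have ts: "t \<le> s j" if "j \<in> J" for j unfolding t_def using finJ that by (intro Min_le) auto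
  have "\<forall>j\<in>J. \<exists>n. s j \<le> 2 ^ n * t \<and> 2 ^ n * t \<le> 2 * s j"
    using ex_dyadic_between[OF t ts] by blast
  then obtain k where k: "\<And>j. j \<in> J \<Longrightarrow> s j \<le> 2 ^ k j * t \<and> 2 ^ k j * t \<le> 2 * s j"
    by metis
  define h where "h j = 2 ^ k j * t" for j
  have hs: "s j \<le> h j" "h j \<le> 2 * s j" if "j \<in> J" for j using k[OF that] by (auto simp: h_def)
  define m where "m j = h j powr (- p) * ((2 ^ j) powr p / 2) * a (Suc j)" for j
  have m0: "0 \<le> m j" for j unfolding m_def using a0 by simp
  have "(\<Sum>j\<in>J. ennreal (h j powr (- p) * ((2 ^ j) powr p / 2)) * emeasure lborel {x. 2 ^ Suc j < \<bar>u x\<bar>}) \<le> ennreal D"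
  proof (rule level_sum[where n = k and t = t and K = n])
    fix j assume j: "j \<in> J"
    have "2 * a j = s j ^ CARD('n)"
      using j by (simp add: s_def J_def powr_powr flip: powr_realpow)
    also have "\<dots> \<le> h j ^ CARD('n)" using hs(1)[OF j] sJ[OF j] by (intro power_mono) auto
    finally have "ennreal (2 * a j) \<le> ennreal (h j ^ CARD('n))" by (rule ennreal_leI)
    then show "2 * emeasure lborel {x. 2 ^ j < \<bar>u x\<bar>} \<le> ennreal (h j ^ CARD('n))"
      using aA[of j] a0[of j] by (simp add: A_def ennreal_mult)
  qed (use p t D uD in \<open>auto simp: h_def J_def\<close>)
  also have "(\<Sum>j\<in>J. ennreal (h j powr (- p) * ((2 ^ j) powr p / 2)) * emeasure lborel {x. 2 ^ Suc j < \<bar>u x\<bar>}) = ennreal (\<Sum>j\<in>J. m j)"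
  proof -
    have "ennreal (h j powr (- p) * ((2 ^ j) powr p / 2)) * emeasure lborel {x. 2 ^ Suc j < \<bar>u x\<bar>} = ennreal (m j)" for j
      unfolding m_def aA[of "Suc j", unfolded A_def] using a0[of "Suc j"] by (subst ennreal_mult[symmetric]) auto
    then show ?thesis using m0 by (simp add: sum_ennreal)
  qed
  finally have mD: "(\<Sum>j\<in>J. m j) \<le> D" using D by (simp add: ennreal_le_iff)
  define b where "b j = (2 ^ j) powr q * a j" for j
  have b0: "0 \<le> b j" for j unfolding b_def using a0 by simp
  define X where "X = (\<Sum>j\<le>n. b j)"
  have bX: "b j \<le> X" if "j \<le> n" for j
    unfolding X_def using that b0 by (intro member_le_sum) auto
  have step: "b (Suc j) \<le> L * m j * X powr \<theta>" if j: "j \<in> J" for j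
  proof -
    have aj: "a j > 0" using j by (simp add: J_def)
    have hj: "h j > 0" using hs(1)[OF j] sJ[OF j] by linarith
    have "h j powr p \<le> (2 * s j) powr p" using hs(2)[OF j] hj p by (intro powr_mono2) auto
    also have "\<dots> = 2 powr p * (2 * a j) powr (p / real CARD('n))"
      using aj by (simp add: s_def powr_mult powr_powr)
    also have "(2 * a j) powr (p / real CARD('n)) = (2 * K) powr (p / real CARD('n)) * (a j / K) powr (p / real CARD('n))"
      using K aj by (simp flip: powr_mult)
    \<comment> \<open>The base is at most 1, so lowering the exponent from p/N to
      \<open>\<theta>\<close> enlarges the power; this is the only place where the exponent
      condition enters. Dropping \<open>K\<close> afterwards uses \<open>K \<ge> 1\<close>.\<close>
    also have "(a j / K) powr (p / real CARD('n)) \<le> (a j / K) powr \<theta>"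
      using aj K aK[of j] \<theta>N by (intro powr_mono') auto
    also have "(a j / K) powr \<theta> \<le> a j powr \<theta>"
      using aj K \<theta> by (intro powr_mono2) (auto simp: field_simps)
    finally have h_le: "h j powr p \<le> 2 powr p * ((2 * K) powr (p / real CARD('n)) * a j powr \<theta>)"
      by (simp add: mult_left_mono)
    have "(2 ^ j) powr p * a (Suc j) = 2 * m j * h j powr p"
      using hj by (simp add: m_def powr_minus field_simps)
    also have "\<dots> \<le> 2 * m j * (2 powr p * ((2 * K) powr (p / real CARD('n)) * a j powr \<theta>))"
      using m0[of j] by (intro mult_left_mono h_le) auto
    finally have 1: "(2 ^ j) powr p * a (Suc j) \<le> 2 * m j * (2 powr p * ((2 * K) powr (p / real CARD('n)) * a j powr \<theta>))" .
    have "b (Suc j) = 2 powr q * (2 ^ j) powr (q - p) * ((2 ^ j) powr p * a (Suc j))"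
      by (simp add: b_def powr_mult flip: powr_add mult.assoc)
    also have "\<dots> \<le> 2 powr q * (2 ^ j) powr (q - p) * (2 * m j * (2 powr p * ((2 * K) powr (p / real CARD('n)) * a j powr \<theta>)))"
      by (intro mult_left_mono 1) auto
    \<comment> \<open>Since q - p = q \<theta>, the weight 2^(j(q-p)) and the power of
      \<open>a j\<close> combine into \<open>b j powr \<theta>\<close>.\<close>
    also have "\<dots> = L * m j * b j powr \<theta>"
      using aj \<theta> by (simp add: b_def L_def powr_mult powr_powr)
    also have "\<dots> \<le> L * m j * X powr \<theta>"
      using bX[of j] j b0[of j] m0[of j] \<theta> K
      by (intro mult_left_mono powr_mono2) (auto simp: J_def L_def)
    finally show ?thesis .
  qed
  have b_notin: "b (Suc j) = 0" if "j < n" "j \<notin> J" for j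
  proof -
    have "a j = 0" using that a0[of j] by (auto simp: J_def)
    then have "a (Suc j) = 0" using a_Suc[of j] a0[of "Suc j"] by simp
    then show ?thesis by (simp add: b_def)
  qed
  have "X = b 0 + (\<Sum>j<n. b (Suc j))"
    unfolding X_def by (simp add: sum.atMost_shift)
  also have "(\<Sum>j<n. b (Suc j)) = (\<Sum>j\<in>J. b (Suc j))"
    using b_notin by (intro sum.mono_neutral_right) (auto simp: J_def)
  also have "\<dots> \<le> (\<Sum>j\<in>J. L * m j * X powr \<theta>)" by (intro sum_mono step)
  also have "\<dots> = L * X powr \<theta> * (\<Sum>j\<in>J. m j)" by (simp add: sum_distrib_left sum_distrib_right mult_ac)
  also have "\<dots> \<le> L * X powr \<theta> * D" using K by (intro mult_left_mono mD) (auto simp: L_def)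
  finally have "X \<le> K + (L * D) * X powr \<theta>"
    using aK[of 0] by (simp add: b_def mult_ac)
  from sublinear_bound[OF this \<theta>(1,2)] K D have "X \<le> max 1 ((K + L * D) powr (q / p))"
    unfolding \<theta>(4) by (simp add: L_def)
  then show "(\<Sum>j\<le>n. (2 ^ j) powr q * measure lborel {x. 2 ^ j < \<bar>u x\<bar>}) \<le> max 1 ((K + L * D) powr (q / p))"
    by (simp add: X_def b_def a_def A_def)
qed


text \<open>For |s| <= 1 the smaller exponent dominates. Otherwise the last \<open>j\<close> with
  2^j < |s| satisfies |s| <= 2^(j+1), and its single term suffices; the rounding accounts for
  2^q.\<close>

lemma powr_le_dyadic_sum:
  fixes s p q :: real
  assumes "1 < p" "p < q"
  shows "ennreal (\<bar>s\<bar> powr q) \<le> ennreal (\<bar>s\<bar> powr p) +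
    (\<Sum>j. ennreal (2 powr q * (2 ^ j) powr q) * indicator {x. 2 ^ j < \<bar>x\<bar>} s)"
proof (cases "\<bar>s\<bar> \<le> 1")
  case True
  then have "\<bar>s\<bar> powr q \<le> \<bar>s\<bar> powr p" using assms by (intro powr_mono') auto
  then have "ennreal (\<bar>s\<bar> powr q) \<le> ennreal (\<bar>s\<bar> powr p)" by (rule ennreal_leI)
  then show ?thesis by (rule add_increasing2[rotated]) simp
next
  case False
  obtain n where n: "\<bar>s\<bar> \<le> 2 ^ n * 1 \<and> 2 ^ n * 1 \<le> 2 * \<bar>s\<bar>" using ex_dyadic_between[of 1 "\<bar>s\<bar>"] False by auto
  then obtain k where k: "\<bar>s\<bar> \<le> 2 ^ k" by auto
  define m where "m = (LEAST k. \<bar>s\<bar> \<le> 2 ^ k)"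
  have m: "\<bar>s\<bar> \<le> 2 ^ m" unfolding m_def by (rule LeastI[where P="\<lambda>k. \<bar>s\<bar> \<le> 2 ^ k", OF k])
  then have "m \<noteq> 0" using False by (cases m) auto
  then obtain j where j: "m = Suc j" by (cases m) auto
  then have js: "2 ^ j < \<bar>s\<bar>" unfolding m_def using not_less_Least[of j "\<lambda>k. \<bar>s\<bar> \<le> 2 ^ k"] by (auto simp: not_le)
  have "\<bar>s\<bar> powr q \<le> (2 ^ m) powr q" using m assms by (intro powr_mono2) auto
  then have "\<bar>s\<bar> powr q \<le> 2 powr q * (2 ^ j) powr q" by (simp add: j powr_mult)
  then have "ennreal (\<bar>s\<bar> powr q) \<le> ennreal (2 powr q * (2 ^ j) powr q) * indicator {x. 2 ^ j < \<bar>x\<bar>} s"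
    using js by (simp add: ennreal_leI)
  also have "\<dots> \<le> (\<Sum>j. ennreal (2 powr q * (2 ^ j) powr q) * indicator {x. 2 ^ j < \<bar>x\<bar>} s)"
    using sum_le_suminf[of "\<lambda>j. ennreal (2 powr q * (2 ^ j) powr q) * indicator {x. 2 ^ j < \<bar>x\<bar>} s" "{j}"]
    by (simp only: sum.insert sum.empty finite.intros empty_iff not_False_eq_True simp_thms add_0_right) auto
  finally show ?thesis by (rule add_increasing[rotated]) simp
qed

text \<open>The dyadic majorant of |u|^q is integrated against the level measures, whose weighted
  partial sums are bounded independently of their length. The dyadic argument covers
  \<open>p < q\<close>, and \<open>K' = max K 1\<close> meets its normalisation.\<close>

lemma truncation_sobolev:
  fixes p q K D :: real
  assumes p: "1 < p" and pq: "p \<le> q" and N: "1 / p - 1 / q \<le> 1 / real CARD('n::finite)" and D: "0 \<le> D"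
  shows "\<exists>C\<ge>0. \<forall>u :: real^'n \<Rightarrow> real. u \<in> borel_measurable borel \<longrightarrow>
    nn_Lp_mass p u \<le> ennreal K \<longrightarrow>
    (\<forall>t z. 0 < t \<longrightarrow> (\<forall>i. 0 \<le> z $ i \<and> z $ i \<le> t) \<longrightarrow> transl_energy p u z \<le> ennreal (D * t powr p)) \<longrightarrow>
    nn_Lp_mass q u \<le> ennreal C"
proof (cases "p = q")
  case True
  have "ennreal K = ennreal (max K 0)" by (simp add: max_def ennreal_neg)
  then show ?thesis using True by (intro exI[of _ "max K 0"]) simp
next
  case False
  then have pq: "p < q" using pq by simp
  define K' where "K' = max K 1"
  define L where "L = 2 powr q * 2 * 2 powr p * (2 * K') powr (p / real CARD('n))"
  define Y where "Y = max 1 ((K' + L * D) powr (q / p))"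
  have K': "1 \<le> K'" by (simp add: K'_def)
  have Y: "0 \<le> Y" by (simp add: Y_def)
  show ?thesis
  proof (intro exI[of _ "K' + 2 powr q * Y"] conjI allI impI)
    fix u :: "real^'n \<Rightarrow> real"
    assume u [measurable]: "u \<in> borel_measurable borel"
      and uK: "nn_Lp_mass p u \<le> ennreal K"
      and uD: "\<forall>t z. 0 < t \<longrightarrow> (\<forall>i. 0 \<le> z $ i \<and> z $ i \<le> t) \<longrightarrow> transl_energy p u z \<le> ennreal (D * t powr p)"
    have uK': "nn_Lp_mass p u \<le> ennreal K'"
      using uK by (rule order_trans) (auto simp: K'_def intro: ennreal_leI)
    let ?a = "\<lambda>j. measure lborel {x. 2 ^ j < \<bar>u x\<bar>}"
    have 1: "(\<Sum>j\<le>n. (2 ^ j) powr q * ?a j) \<le> Y" and 2: "emeasure lborel {x. 2 ^ j < \<bar>u x\<bar>} = ennreal (?a j)" for n j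
      using level_measures_bound[OF u p pq N K' D uK'] uD by (auto simp: Y_def L_def)
    have "nn_Lp_mass q u \<le>
      (\<integral>\<^sup>+x. ennreal (\<bar>u x\<bar> powr p) + (\<Sum>j. ennreal (2 powr q * (2 ^ j) powr q) * indicator {x. 2 ^ j < \<bar>u x\<bar>} x) \<partial>lborel)"
      using powr_le_dyadic_sum[OF p pq] by (intro nn_integral_mono) (simp add: indicator_def)
    also have "\<dots> = nn_Lp_mass p u +
      (\<Sum>j. \<integral>\<^sup>+x. ennreal (2 powr q * (2 ^ j) powr q) * indicator {x. 2 ^ j < \<bar>u x\<bar>} x \<partial>lborel)"
      by (subst nn_integral_add, measurable, subst nn_integral_suminf) auto
    also have "(\<lambda>j. \<integral>\<^sup>+x. ennreal (2 powr q * (2 ^ j) powr q) * indicator {x. 2 ^ j < \<bar>u x\<bar>} x \<partial>lborel) =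
      (\<lambda>j. ennreal (2 powr q * ((2 ^ j) powr q * ?a j)))"
      by (subst nn_integral_cmult_indicator) (auto simp: 2 ennreal_mult mult.assoc)
    also have "(\<Sum>j. ennreal (2 powr q * ((2 ^ j) powr q * ?a j))) \<le> ennreal (2 powr q * Y)"
    proof (rule suminf_le_const)
      fix n
      have "(\<Sum>j<n. (2 ^ j) powr q * ?a j) \<le> (\<Sum>j\<le>n. (2 ^ j) powr q * ?a j)" by (intro sum_mono2) auto
      also have "\<dots> \<le> Y" by (rule 1)
      finally have "2 powr q * (\<Sum>j<n. (2 ^ j) powr q * ?a j) \<le> 2 powr q * Y" by (intro mult_left_mono) auto
      then show "(\<Sum>j<n. ennreal (2 powr q * ((2 ^ j) powr q * ?a j))) \<le> ennreal (2 powr q * Y)"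
        by (simp add: sum_ennreal ennreal_leI sum_distrib_left)
    qed simp
    finally have "nn_Lp_mass q u \<le>
      (nn_Lp_mass p u) + ennreal (2 powr q * Y)"
      by (simp add: add_left_mono)
    also have "\<dots> \<le> ennreal K' + ennreal (2 powr q * Y)" by (intro add_right_mono uK')
    also have "\<dots> = ennreal (K' + 2 powr q * Y)" using K' Y by (subst ennreal_plus) auto
    finally show "nn_Lp_mass q u \<le> ennreal (K' + 2 powr q * Y)" .
  qed (use K' Y in auto)
qed

section \<open>The first-order embedding and its iteration\<close>

lemma sobolev_first_order:
  fixes p q M :: real
  assumes p: "1 < p" and pq: "p \<le> q" and N: "1 / p - 1 / q \<le> 1 / real CARD('n::finite)" and M: "0 \<le> M"
  shows "\<exists>C\<ge>0. \<forall>(u :: real^'n \<Rightarrow> real) v. (\<forall>i. weak_deriv (axis_index i) u (v i)) \<longrightarrow>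
    nn_Lp_mass p u \<le> ennreal M \<longrightarrow>
    (\<forall>i. nn_Lp_mass p (v i) \<le> ennreal M) \<longrightarrow>
    nn_Lp_mass q u \<le> ennreal C"
proof -
  obtain c where c: "c \<ge> 0" "\<And>(u::real^'n \<Rightarrow> real) v M t z. (\<forall>i. weak_deriv (axis_index i) u (v i)) \<Longrightarrow>
    (\<forall>i. nn_Lp_mass p (v i) \<le> ennreal M) \<Longrightarrow> 0 \<le> M \<Longrightarrow> 0 \<le> t \<Longrightarrow>
    (\<forall>i. 0 \<le> z i \<and> z i \<le> t) \<Longrightarrow> transl_energy p u (\<Sum>i\<in>UNIV. z i *\<^sub>R axis i 1) \<le> ennreal (c * M * t powr p)"
    using transl_energy_axes[OF p, of "UNIV :: 'n set"] by auto
  obtain C where C: "C \<ge> 0" "\<And>u :: real^'n \<Rightarrow> real. u \<in> borel_measurable borel \<Longrightarrow>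
    nn_Lp_mass p u \<le> ennreal M \<Longrightarrow>
    (\<forall>t z. 0 < t \<longrightarrow> (\<forall>i. 0 \<le> z $ i \<and> z $ i \<le> t) \<longrightarrow> transl_energy p u z \<le> ennreal (c * M * t powr p)) \<Longrightarrow>
    nn_Lp_mass q u \<le> ennreal C"
    using truncation_sobolev[OF p pq N, of "c * M" M] c M by auto
  have ax: "(\<Sum>i\<in>UNIV. z $ i *\<^sub>R axis i 1) = z" for z :: "real^'n"
    by (simp add: vec_eq_iff axis_def if_distrib cong: if_cong)
  show ?thesis
  proof (intro exI[of _ C] conjI allI impI C)
    fix u :: "real^'n \<Rightarrow> real" and v and t :: real and z :: "real^'n"
    assume w: "\<forall>i. weak_deriv (axis_index i) u (v i)"
      and v: "\<forall>i. nn_Lp_mass p (v i) \<le> ennreal M"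
    show "u \<in> borel_measurable borel" using w by (auto simp: weak_deriv_def locint_borel)
    assume "0 < t" "\<forall>i. 0 \<le> z $ i \<and> z $ i \<le> t"
    then show "transl_energy p u z \<le> ennreal (c * M * t powr p)"
      using c(2)[OF w v M, of t "\<lambda>i. z $ i"] by (simp add: ax)
  qed
qed

text \<open>Each of the \<open>k\<close> steps trades one derivative for a first-order embedding, so
  the available order falls from \<open>m\<close> to \<open>m - k\<close>. Stating it for a family
  \<open>G\<close> linked only by first-order weak derivatives lets the induction apply to all
  orders at once.\<close>

theorem sobolev_embedding:
  fixes p M :: real
  assumes p: "1 < p" and M: "0 \<le> M" and "k \<le> m" and "p \<le> r" and "1 / p - real k / real CARD('n::finite) \<le> 1 / r"
  shows "\<exists>C\<ge>0. \<forall>G :: 'n mindex \<Rightarrow> real^'n \<Rightarrow> real.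
    (\<forall>\<beta> i. mlen \<beta> < m \<longrightarrow> weak_deriv (axis_index i) (G \<beta>) (G (\<lambda>j. \<beta> j + axis_index i j))) \<longrightarrow>
    (\<forall>\<beta>. mlen \<beta> \<le> m \<longrightarrow> nn_Lp_mass p (G \<beta>) \<le> ennreal M) \<longrightarrow>
    (\<forall>\<beta>. mlen \<beta> \<le> m - k \<longrightarrow> nn_Lp_mass r (G \<beta>) \<le> ennreal C)"
  using assms(3-)
proof (induction k arbitrary: r)
  case 0
  then have "1 / p \<le> 1 / r" by simp
  then have "r = p" using 0 p by (simp add: frac_le_eq divide_le_eq field_simps)
  then show ?case using M by (intro exI[of _ M]) auto
next
  case (Suc k)
  define N where "N = real CARD('n)"
  have N: "N > 0" by (simp add: N_def)
  have r: "r > 0" using Suc.prems p by simp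
  \<comment> \<open>The intermediate exponent lies one first-order step of 1/N below
    \<open>r\<close>, but the minimum stops it from falling below \<open>p\<close>.\<close>
  define r0 where "r0 = 1 / min (1 / p) (1 / r + 1 / N)"
  have inv: "1 / r0 = min (1 / p) (1 / r + 1 / N)" by (simp add: r0_def)
  have pos: "0 < min (1 / p) (1 / r + 1 / N)" using p r N by (simp add: add_pos_pos)
  have r0: "r0 > 0" using pos by (simp add: r0_def)
  have "1 / r0 \<le> 1 / p" unfolding inv by simp
  then have pr0: "p \<le> r0" using p r0 by (simp add: field_simps)
  have "1 / r \<le> 1 / p" using Suc.prems p by (simp add: frac_le)
  then have "1 / r \<le> 1 / r0" unfolding inv using N by simp
  then have r0r: "r0 \<le> r" using r r0 by (simp add: field_simps)
  have "1 / p - real k / N \<le> 1 / r0"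
    unfolding inv using Suc.prems(3) N by (simp add: add_divide_distrib N_def[symmetric])
  then obtain C0 where C0: "C0 \<ge> 0" "\<And>G :: 'n mindex \<Rightarrow> real^'n \<Rightarrow> real.
    (\<forall>\<beta> i. mlen \<beta> < m \<longrightarrow> weak_deriv (axis_index i) (G \<beta>) (G (\<lambda>j. \<beta> j + axis_index i j))) \<Longrightarrow>
    (\<forall>\<beta>. mlen \<beta> \<le> m \<longrightarrow> nn_Lp_mass p (G \<beta>) \<le> ennreal M) \<Longrightarrow>
    (\<forall>\<beta>. mlen \<beta> \<le> m - k \<longrightarrow> nn_Lp_mass r0 (G \<beta>) \<le> ennreal C0)"
    using Suc.IH[OF _ pr0] Suc.prems by (auto simp: N_def)
  have "1 / r0 - 1 / r \<le> 1 / real CARD('n)" unfolding inv N_def by simp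
  from sobolev_first_order[OF _ r0r this C0(1)] p pr0
  obtain C where C: "C \<ge> 0" "\<And>(u :: real^'n \<Rightarrow> real) v. (\<forall>i. weak_deriv (axis_index i) u (v i)) \<Longrightarrow>
    nn_Lp_mass r0 u \<le> ennreal C0 \<Longrightarrow>
    (\<forall>i. nn_Lp_mass r0 (v i) \<le> ennreal C0) \<Longrightarrow>
    nn_Lp_mass r u \<le> ennreal C"
    by auto
  show ?case
  proof (intro exI[of _ C] conjI allI impI C(1))
    fix G :: "'n mindex \<Rightarrow> real^'n \<Rightarrow> real" and \<beta> :: "'n mindex"
    assume w: "\<forall>\<beta> i. mlen \<beta> < m \<longrightarrow> weak_deriv (axis_index i) (G \<beta>) (G (\<lambda>j. \<beta> j + axis_index i j))"
      and GM: "\<forall>\<beta>. mlen \<beta> \<le> m \<longrightarrow> nn_Lp_mass p (G \<beta>) \<le> ennreal M"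
      and \<beta>: "mlen \<beta> \<le> m - Suc k"
    have len: "mlen (\<lambda>j. \<beta> j + axis_index i j) = Suc (mlen \<beta>)" for i
      by (simp add: mlen_def axis_index_def sum.distrib)
    show "nn_Lp_mass r (G \<beta>) \<le> ennreal C"
      using w \<beta> Suc.prems C0(2)[OF w GM] len
      by (intro C(2)[of "G \<beta>" "\<lambda>i. G (\<lambda>j. \<beta> j + axis_index i j)"]) auto
  qed
qed

section \<open>The spaces of the profile decomposition\<close>

lemma finite_mindex: "finite {\<beta> :: 'n::finite mindex. mlen \<beta> \<le> m}"
proof (rule finite_subset)
  show "{\<beta> :: 'n mindex. mlen \<beta> \<le> m} \<subseteq> PiE UNIV (\<lambda>_. {..m})"
  proof
    fix \<beta> :: "'n mindex" assume "\<beta> \<in> {\<beta>. mlen \<beta> \<le> m}"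
    then have "\<beta> i \<le> m" for i
      using member_le_sum[of i UNIV \<beta>] by (auto simp: mlen_def)
    then show "\<beta> \<in> PiE UNIV (\<lambda>_. {..m})" by auto
  qed
qed (intro finite_PiE, auto)

lemma is_weak_deriv_wd: "is_weak_deriv \<beta> u v \<Longrightarrow> is_weak_deriv \<beta> u (wd \<beta> u)"
  unfolding wd_def by (rule someI[where P="is_weak_deriv \<beta> u"])

lemma sobolev_weak_deriv_wd:
  assumes "sobolev m p u" "mlen \<beta> \<le> m"
  shows "weak_deriv \<beta> u (wd \<beta> u)"
  using assms unfolding sobolev_def by (meson is_weak_deriv_wd is_weak_deriv_imp_weak_deriv)

text \<open>\<open>sobolev\<close> promises some derivative in L^p, while \<open>wd\<close> chooses
  a derivative without regard to integrability; almost everywhere uniqueness transfers it.\<close>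

lemma sobolev_Lp_wd:
  assumes "sobolev m p u" "mlen \<beta> \<le> m"
  shows "Lp p (wd \<beta> u)"
proof -
  obtain v where v: "is_weak_deriv \<beta> u v" "Lp p v" using assms unfolding sobolev_def by meson
  have "AE x in lborel. wd \<beta> u x = v x"
    using v(1) by (intro weak_deriv_unique[OF sobolev_weak_deriv_wd[OF assms]] is_weak_deriv_imp_weak_deriv)
  then have ae: "AE x in lborel. \<bar>v x\<bar> powr p = \<bar>wd \<beta> u x\<bar> powr p" by eventually_elim simp
  have m: "wd \<beta> u \<in> borel_measurable lborel"
    using sobolev_weak_deriv_wd[OF assms] by (simp add: weak_deriv_def locint_def)
  have "integrable lborel (\<lambda>x. \<bar>wd \<beta> u x\<bar> powr p)"
    using v(2) m by (subst integrable_cong_AE[OF _ _ AE_symmetric[OF ae]]) (auto simp: Lp_def)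
  then show ?thesis using m by (simp add: Lp_def)
qed

lemma Lp_nn_integral: "Lp r f \<Longrightarrow> nn_Lp_mass r f = ennreal (Lp_mass r f)"
  by (intro nn_integral_eq_integral) (auto simp: Lp_def)

lemma Lp_norm_powr: "0 < r \<Longrightarrow> Lp_norm r f powr r = Lp_mass r f"
  by (simp add: Lp_norm_def powr_powr integral_nonneg_AE)

lemma sob_norm_bound:
  assumes p: "1 < p" and "mlen \<beta> \<le> m" and B: "sob_norm m p u \<le> B"
  shows "Lp_mass p (wd \<beta> u) \<le> B powr p"
proof -
  let ?A = "{\<beta>. mlen \<beta> \<le> m}"
  have "Lp_norm p (wd \<beta> u) powr p \<le> (\<Sum>\<beta>\<in>?A. Lp_norm p (wd \<beta> u) powr p)"
    using assms by (intro member_le_sum finite_mindex) auto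
  also have "\<dots> = sob_norm m p u powr p"
    using p by (simp add: sob_norm_def powr_powr sum_nonneg)
  also have "\<dots> \<le> B powr p" using p B by (intro powr_mono2) (auto simp: sob_norm_def)
  finally show ?thesis using p by (simp add: Lp_norm_powr)
qed

text \<open>Both branches of \<open>pstar\<close> become one inequality between reciprocals:
  equality at the critical exponent in the finite branch, and a non-positive left-hand side in the
  infinite one.\<close>

lemma pstar_exponent:
  assumes p: "1 < p" and r: "p \<le> r" and le: "ereal r \<le> pstar n p k" and n: "0 < n"
  shows "1 / p - real k / real n \<le> 1 / r"
proof (cases "real n > real k * p")
  case True
  then have "r \<le> p * real n / (real n - real k * p)" using le by (simp add: pstar_def)
  then have "1 / (p * real n / (real n - real k * p)) \<le> 1 / r"
    using p r by (intro divide_left_mono) (use True n in auto)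
  moreover have "1 / (p * real n / (real n - real k * p)) = 1 / p - real k / real n"
    using p n by (simp add: field_simps)
  ultimately show ?thesis by simp
next
  case False
  then have "1 / p \<le> real k / real n" using p n by (simp add: field_simps)
  moreover have "0 \<le> 1 / r" using p r by simp
  ultimately show ?thesis by linarith
qed

text \<open>The embedding is applied to the family of derivatives of order \<alpha> + \<beta>, with
  \<open>m - mlen \<alpha>\<close> orders available and all of them spent; the claim is read off at
  \<beta> = 0.\<close>

lemma sobolev_bound:
  fixes \<alpha> :: "'n::finite mindex"
  assumes p: "1 < p" and r: "p \<le> r" "ereal r \<le> pstar CARD('n) p (m - mlen \<alpha>)" and \<alpha>: "mlen \<alpha> \<le> m"
  shows "\<exists>C\<ge>0. \<forall>u :: real^'n \<Rightarrow> real. sobolev m p u \<longrightarrow> sob_norm m p u \<le> B \<longrightarrow>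
    Lp r (wd \<alpha> u) \<and> Lp_mass r (wd \<alpha> u) \<le> C"
proof -
  let ?k = "m - mlen \<alpha>"
  have e: "1 / p - real ?k / real CARD('n) \<le> 1 / r" by (rule pstar_exponent[OF p r]) simp
  obtain C where C: "C \<ge> 0" "\<And>G :: 'n mindex \<Rightarrow> real^'n \<Rightarrow> real.
    (\<forall>\<beta> i. mlen \<beta> < ?k \<longrightarrow> weak_deriv (axis_index i) (G \<beta>) (G (\<lambda>j. \<beta> j + axis_index i j))) \<Longrightarrow>
    (\<forall>\<beta>. mlen \<beta> \<le> ?k \<longrightarrow> nn_Lp_mass p (G \<beta>) \<le> ennreal (B powr p)) \<Longrightarrow>
    (\<forall>\<beta>. mlen \<beta> \<le> ?k - ?k \<longrightarrow> nn_Lp_mass r (G \<beta>) \<le> ennreal C)"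
    using sobolev_embedding[OF p _ order_refl r(1) e, of "B powr p"] by auto
  show ?thesis
  proof (intro exI[of _ C] conjI[OF C(1)] allI impI)
    fix u :: "real^'n \<Rightarrow> real" assume u: "sobolev m p u" "sob_norm m p u \<le> B"
    define G :: "'n mindex \<Rightarrow> real^'n \<Rightarrow> real" where "G \<beta> = wd (\<lambda>j. \<alpha> j + \<beta> j) u" for \<beta>
    have len: "mlen (\<lambda>j. \<alpha> j + \<beta> j) = mlen \<alpha> + mlen \<beta>" for \<beta> :: "'n mindex" by (simp add: mlen_def sum.distrib)
    have len1: "mlen (axis_index i) = 1" for i :: 'n by (simp add: mlen_def axis_index_def)
    have 1: "weak_deriv (axis_index i) (G \<beta>) (G (\<lambda>j. \<beta> j + axis_index i j))" if b: "mlen \<beta> < ?k" for \<beta> i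
    proof -
      have "weak_deriv (\<lambda>j. \<alpha> j + \<beta> j) u (G \<beta>)"
        unfolding G_def using b \<alpha> by (intro sobolev_weak_deriv_wd[OF u(1)]) (simp add: len)
      moreover have "weak_deriv (\<lambda>j. (\<alpha> j + \<beta> j) + axis_index i j) u (G (\<lambda>j. \<beta> j + axis_index i j))"
        unfolding G_def add.assoc using b \<alpha> by (intro sobolev_weak_deriv_wd[OF u(1)]) (simp add: mlen_def sum.distrib axis_index_def)
      ultimately show ?thesis by (rule weak_deriv_step)
    qed
    have 2: "nn_Lp_mass p (G \<beta>) \<le> ennreal (B powr p)" if b: "mlen \<beta> \<le> ?k" for \<beta>
    proof -
      have l: "mlen (\<lambda>j. \<alpha> j + \<beta> j) \<le> m" using \<alpha> b by (simp add: len)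
      show ?thesis
        unfolding G_def Lp_nn_integral[OF sobolev_Lp_wd[OF u(1) l]]
        by (intro ennreal_leI sob_norm_bound[OF p l u(2)])
    qed
    have "\<forall>\<beta>. mlen \<beta> \<le> ?k - ?k \<longrightarrow> nn_Lp_mass r (G \<beta>) \<le> ennreal C"
      using 1 2 by (intro C(2)) blast+
    moreover have "mlen (\<lambda>_::'n. 0) = 0" by (simp add: mlen_def)
    ultimately have *: "nn_Lp_mass r (wd \<alpha> u) \<le> ennreal C"
      unfolding G_def by (auto dest: spec[of _ "\<lambda>_. 0"])
    have [measurable]: "wd \<alpha> u \<in> borel_measurable borel"
      using sobolev_Lp_wd[OF u(1) \<alpha>] by (simp add: Lp_def)
    have "integrable lborel (\<lambda>x. \<bar>wd \<alpha> u x\<bar> powr r)"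
      using le_less_trans[OF * ennreal_less_top] by (intro integrableI_nonneg) auto
    then have Lp: "Lp r (wd \<alpha> u)" by (simp add: Lp_def)
    show "Lp r (wd \<alpha> u) \<and> Lp_mass r (wd \<alpha> u) \<le> C"
      using Lp * C(1) unfolding Lp_nn_integral[OF Lp] by (simp add: ennreal_le_iff)
  qed
qed

section \<open>Lebesgue integrability and the interaction of translates\<close>

lemma Lp_borel: "Lp r f \<Longrightarrow> f \<in> borel_measurable borel" by (simp add: Lp_def)

lemma Lp_integrable: "Lp r f \<Longrightarrow> integrable lborel (\<lambda>x. \<bar>f x\<bar> powr r)" by (simp add: Lp_def)

lemma Lp_add:
  assumes f: "Lp r f" and g: "Lp r g" and r: "1 < r" shows "Lp r (\<lambda>x. f x + g x)"
proof -
  have [measurable]: "f \<in> borel_measurable borel" "g \<in> borel_measurable borel" using f g by (auto intro: Lp_borel)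
  have "integrable lborel (\<lambda>x. \<bar>f x + g x\<bar> powr r)"
  proof (rule Bochner_Integration.integrable_bound)
    show "integrable lborel (\<lambda>x. 2 powr (r - 1) * (\<bar>f x\<bar> powr r + \<bar>g x\<bar> powr r))"
      using f g by (intro integrable_mult_right Bochner_Integration.integrable_add) (auto simp: Lp_def)
    have "\<bar>f x + g x\<bar> powr r \<le> 2 powr (r - 1) * (\<bar>f x\<bar> powr r + \<bar>g x\<bar> powr r)" for x
    proof -
      have "\<bar>f x + g x\<bar> powr r \<le> (\<bar>f x\<bar> + \<bar>g x\<bar>) powr r" using r by (intro powr_mono2) auto
      also have "\<dots> \<le> 2 powr (r - 1) * (\<bar>f x\<bar> powr r + \<bar>g x\<bar> powr r)" using r by (intro powr_add_le) auto
      finally show ?thesis .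
    qed
    then show "AE x in lborel. norm (\<bar>f x + g x\<bar> powr r) \<le> norm (2 powr (r - 1) * (\<bar>f x\<bar> powr r + \<bar>g x\<bar> powr r))"
      by (auto simp: abs_mult)
  qed measurable
  then show ?thesis by (simp add: Lp_def)
qed

lemma Lp_zero: "Lp r (\<lambda>x. 0)" by (simp add: Lp_def)

lemma Lp_sum: "(\<And>l. l \<in> A \<Longrightarrow> Lp r (f l)) \<Longrightarrow> 1 < r \<Longrightarrow> Lp r (\<lambda>x. \<Sum>l\<in>A. f l x)"
  by (induction A rule: infinite_finite_induct) (auto intro: Lp_add Lp_zero)

lemma Lp_uminus: "Lp r f \<Longrightarrow> Lp r (\<lambda>x. - f x)" by (auto simp: Lp_def)

lemma Lp_diff: "Lp r f \<Longrightarrow> Lp r g \<Longrightarrow> 1 < r \<Longrightarrow> Lp r (\<lambda>x. f x - g x)"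
  using Lp_add[of r f "\<lambda>x. - g x"] Lp_uminus[of r g] by simp

lemma Lp_translate:
  assumes "Lp r f" shows "Lp r (\<lambda>x. f (x + z))"
  unfolding Lp_def
proof
  show "(\<lambda>x. f (x + z)) \<in> borel_measurable lborel"
    using assms by (intro borel_measurable_translate) (simp add: Lp_def)
  show "integrable lborel (\<lambda>x. \<bar>f (x + z)\<bar> powr r)"
    using integrable_translate[of "\<lambda>x. \<bar>f x\<bar> powr r" z] assms by (simp add: Lp_def)
qed

text \<open>A weighted Young inequality by a case split: if a <= \<eta> b the first term suffices,
  otherwise b < a / \<eta> and the second does.\<close>

lemma mult_powr_le:
  fixes a b r \<eta> :: real
  assumes "0 \<le> a" "0 \<le> b" "1 < r" "0 < \<eta>"
  shows "a * b powr (r - 1) \<le> \<eta> * b powr r + \<eta> powr (1 - r) * a powr r"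
proof -
  have *: "x powr r = x * x powr (r - 1)" if "x \<ge> 0" for x :: real
    using powr_mult_base[of x "r - 1"] that by simp
  show ?thesis
  proof (cases "a \<le> \<eta> * b")
    case True
    then have "a * b powr (r - 1) \<le> \<eta> * b * b powr (r - 1)" by (intro mult_right_mono) auto
    also have "\<dots> = \<eta> * b powr r" using * assms by simp
    finally show ?thesis by (simp add: add_increasing2)
  next
    case False
    then have "b powr (r - 1) \<le> (a / \<eta>) powr (r - 1)" using assms by (intro powr_mono2) (auto simp: field_simps)
    also have "\<dots> = \<eta> powr (1 - r) * a powr (r - 1)"
      using assms by (simp add: powr_divide powr_diff field_simps)
    finally have "a * b powr (r - 1) \<le> a * (\<eta> powr (1 - r) * a powr (r - 1))" using assms by (intro mult_left_mono) auto
    also have "\<dots> = \<eta> powr (1 - r) * a powr r" using * assms by simp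
    finally show ?thesis using assms by (simp add: add_increasing)
  qed
qed

lemma mult_powr_le':
  fixes a b r \<eta> :: real
  assumes "0 \<le> a" "0 \<le> b" "1 < r" "0 < \<eta>"
  shows "a * b powr (r - 1) \<le> \<eta> * a powr r + \<eta> powr (- 1 / (r - 1)) * b powr r"
proof -
  \<comment> \<open>Solving \<kappa>^(1-r) = \<eta> exchanges the roles of the small and the large
    weight.\<close>
  let ?\<kappa> = "\<eta> powr (1 / (1 - r))"
  have "?\<kappa> powr (1 - r) = \<eta>" using assms by (simp add: powr_powr)
  moreover have "1 / (1 - r) = - 1 / (r - 1)" using assms by (simp add: field_simps)
  ultimately show ?thesis using mult_powr_le[of a b r ?\<kappa>] assms by (simp add: add.commute)
qed


lemma Lp_tail_tendsto_0:
  fixes f :: "real^'n::finite \<Rightarrow> real" and \<rho> :: "nat \<Rightarrow> real"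
  assumes f: "Lp r f" and \<rho>: "filterlim \<rho> at_top sequentially"
  shows "(\<lambda>n. LBINT x. indicator {x. \<rho> n < norm x} x * \<bar>f x\<bar> powr r) \<longlonglongrightarrow> 0"
proof -
  have [measurable]: "f \<in> borel_measurable borel" using f by (rule Lp_borel)
  have "(\<lambda>n. LBINT x. indicator {x. \<rho> n < norm x} x * \<bar>f x\<bar> powr r) \<longlonglongrightarrow> (\<integral>x. 0 \<partial>(lborel :: (real^'n) measure))"
  proof (rule integral_dominated_convergence)
    show "integrable lborel (\<lambda>x. \<bar>f x\<bar> powr r)" by (rule Lp_integrable[OF f])
    show "AE x in lborel. (\<lambda>n. indicator {x. \<rho> n < norm x} x * \<bar>f x\<bar> powr r) \<longlonglongrightarrow> 0"
    proof (rule AE_I2)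
      fix x :: "real^'n"
      have "\<forall>\<^sub>F n in sequentially. norm x \<le> \<rho> n" using \<rho> by (simp add: filterlim_at_top)
      then have "\<forall>\<^sub>F n in sequentially. indicator {x. \<rho> n < norm x} x * \<bar>f x\<bar> powr r = 0"
        by eventually_elim (auto simp: indicator_def)
      then show "(\<lambda>n. indicator {x. \<rho> n < norm x} x * \<bar>f x\<bar> powr r) \<longlonglongrightarrow> 0" by (rule tendsto_eventually)
    qed
  qed (auto simp: indicator_def)
  then show ?thesis by simp
qed

lemma integrable_cross:
  fixes g h :: "real^'n::finite \<Rightarrow> real"
  assumes g: "Lp r g" and h: "Lp r h" and r: "1 < r"
  shows "integrable lborel (\<lambda>x. \<bar>g x\<bar> * \<bar>h x\<bar> powr (r - 1))"
proof -
  have [measurable]: "g \<in> borel_measurable borel" "h \<in> borel_measurable borel" using g h by (auto intro: Lp_borel)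
  have "integrable lborel (\<lambda>x. 1 * \<bar>h x\<bar> powr r + 1 powr (1 - r) * \<bar>g x\<bar> powr r)"
    using g h by (intro Bochner_Integration.integrable_add integrable_mult_right Lp_integrable)
  then show ?thesis
  proof (rule Bochner_Integration.integrable_bound)
    have "\<bar>g x\<bar> * \<bar>h x\<bar> powr (r - 1) \<le> 1 * \<bar>h x\<bar> powr r + 1 powr (1 - r) * \<bar>g x\<bar> powr r" for x
      by (rule mult_powr_le) (use r in auto)
    then show "AE x in lborel. norm (\<bar>g x\<bar> * \<bar>h x\<bar> powr (r - 1)) \<le> norm (1 * \<bar>h x\<bar> powr r + 1 powr (1 - r) * \<bar>g x\<bar> powr r)"
      by (auto simp: abs_mult)
  qed measurable
qed

text \<open>Each \<open>x\<close> is at distance at least |z_n|/2 from 0 or from z_n. Where it is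
  far from z_n, Young's inequality puts the small weight on \<open>h\<close> and the large one on a
  tail of \<open>g\<close>; otherwise the roles are reversed. The tails vanish for fixed
  \<open>\<eta>\<close>, which is then made small.\<close>

lemma cross_term_tendsto_0:
  fixes g h :: "real^'n::finite \<Rightarrow> real" and z :: "nat \<Rightarrow> real^'n"
  assumes g: "Lp r g" and h: "Lp r h" and r: "1 < r" and z: "filterlim (\<lambda>n. norm (z n)) at_top sequentially"
  shows "(\<lambda>n. LBINT x. \<bar>g (x - z n)\<bar> * \<bar>h x\<bar> powr (r - 1)) \<longlonglongrightarrow> 0"
proof -
  have [measurable]: "g \<in> borel_measurable borel" "h \<in> borel_measurable borel" using g h by (auto intro: Lp_borel)
  have gz: "Lp r (\<lambda>x. g (x - z n))" for n using Lp_translate[OF g, of "- z n"] by simp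
  define G where "G = Lp_mass r g"
  define H where "H = Lp_mass r h"
  have G0: "0 \<le> G" "0 \<le> H" by (auto simp: G_def H_def integral_nonneg_AE)
  have tr: "(LBINT x. \<bar>g (x - z n)\<bar> powr r) = G" for n
    unfolding G_def using integral_translate[of "\<lambda>x. \<bar>g x\<bar> powr r" "- z n"] by simp
  define Tg where "Tg n = (LBINT x. indicator {x. norm (z n) / 2 < norm x} x * \<bar>g x\<bar> powr r)" for n
  \<comment> \<open>The triangle inequality gives only a non-strict bound in the second case;
    subtracting 1 makes it fit the strict tail set.\<close>
  define Th where "Th n = (LBINT x. indicator {x. norm (z n) / 2 - 1 < norm x} x * \<bar>h x\<bar> powr r)" for n
  have "filterlim (\<lambda>n. (1 / 2) * norm (z n)) at_top sequentially"
    by (rule filterlim_tendsto_pos_mult_at_top[OF tendsto_const _ z]) simp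
  then have half: "filterlim (\<lambda>n. norm (z n) / 2) at_top sequentially" by simp
  have half': "filterlim (\<lambda>n. norm (z n) / 2 - 1) at_top sequentially"
    using filterlim_tendsto_add_at_top[OF tendsto_const[of "-1"] half] by simp
  have T0: "Tg \<longlonglongrightarrow> 0" "Th \<longlonglongrightarrow> 0"
    unfolding Tg_def Th_def by (rule Lp_tail_tendsto_0[OF g half], rule Lp_tail_tendsto_0[OF h half'])
  have bound: "(LBINT x. \<bar>g (x - z n)\<bar> * \<bar>h x\<bar> powr (r - 1)) \<le>
     \<eta> * (G + H) + \<eta> powr (1 - r) * Tg n + \<eta> powr (- 1 / (r - 1)) * Th n" if \<eta>: "\<eta> > 0" for \<eta> n
  proof -
    let ?A = "{x. norm (z n) / 2 < norm (x - z n)}" and ?B = "{x. norm (z n) / 2 - 1 < norm x}"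
    let ?f = "\<lambda>x. \<eta> * (\<bar>g (x - z n)\<bar> powr r + \<bar>h x\<bar> powr r) + \<eta> powr (1 - r) * (indicator ?A x * \<bar>g (x - z n)\<bar> powr r)
         + \<eta> powr (- 1 / (r - 1)) * (indicator ?B x * \<bar>h x\<bar> powr r)"
    have iA: "integrable lborel (\<lambda>x. indicator ?A x * \<bar>g (x - z n)\<bar> powr r)"
      and iB: "integrable lborel (\<lambda>x. indicator ?B x * \<bar>h x\<bar> powr r)"
      using integrable_mult_indicator[OF _ Lp_integrable[OF gz[of n]], of ?A] integrable_mult_indicator[OF _ Lp_integrable[OF h], of ?B]
      by auto
    have "(LBINT x. \<bar>g (x - z n)\<bar> * \<bar>h x\<bar> powr (r - 1)) \<le> (LBINT x. ?f x)"
    proof (rule integral_mono)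
      show "integrable lborel (\<lambda>x. \<bar>g (x - z n)\<bar> * \<bar>h x\<bar> powr (r - 1))" by (rule integrable_cross[OF gz h r])
      show "integrable lborel ?f"
        by (intro Bochner_Integration.integrable_add integrable_mult_right iA iB Lp_integrable gz h)
      fix x
      show "\<bar>g (x - z n)\<bar> * \<bar>h x\<bar> powr (r - 1) \<le> ?f x"
      proof (cases "x \<in> ?A")
        case True
        have "0 \<le> \<eta> * \<bar>g (x - z n)\<bar> powr r" "0 \<le> \<eta> powr (- 1 / (r - 1)) * (indicator ?B x * \<bar>h x\<bar> powr r)" using \<eta> by auto
        moreover have "\<bar>g (x - z n)\<bar> * \<bar>h x\<bar> powr (r - 1) \<le> \<eta> * \<bar>h x\<bar> powr r + \<eta> powr (1 - r) * (indicator ?A x * \<bar>g (x - z n)\<bar> powr r)"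
          using True mult_powr_le[of "\<bar>g (x - z n)\<bar>" "\<bar>h x\<bar>" r \<eta>] r \<eta> by simp
        ultimately show ?thesis unfolding distrib_left by linarith
      next
        case False
        have "z n = x - (x - z n)" by simp
        then have "norm (z n) \<le> norm x + norm (x - z n)" by (metis norm_triangle_ineq4)
        then have zx: "norm (z n) / 2 \<le> norm x" using False by (simp add: not_less)
        have "0 \<le> \<eta> * \<bar>h x\<bar> powr r" "0 \<le> \<eta> powr (1 - r) * (indicator ?A x * \<bar>g (x - z n)\<bar> powr r)" using \<eta> by auto
        moreover have "\<bar>g (x - z n)\<bar> * \<bar>h x\<bar> powr (r - 1) \<le> \<eta> * \<bar>g (x - z n)\<bar> powr r + \<eta> powr (- 1 / (r - 1)) * (indicator ?B x * \<bar>h x\<bar> powr r)"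
        proof (cases "x \<in> ?B")
          case True
          then show ?thesis using mult_powr_le'[of "\<bar>g (x - z n)\<bar>" "\<bar>h x\<bar>" r \<eta>] r \<eta> by simp
        next
          case False
          then show ?thesis using zx by simp
        qed
        ultimately show ?thesis unfolding distrib_left by linarith
      qed
    qed
    also have "\<dots> = \<eta> * (G + H) + \<eta> powr (1 - r) * Tg n + \<eta> powr (- 1 / (r - 1)) * Th n"
    proof -
      have "(LBINT x. indicator ?A x * \<bar>g (x - z n)\<bar> powr r) = Tg n"
        unfolding Tg_def
        using integral_translate[of "\<lambda>x. indicator {x. norm (z n) / 2 < norm x} x * \<bar>g x\<bar> powr r" "- z n"]
        by (simp add: indicator_def)
      then show ?thesis
        using iA iB Lp_integrable[OF gz[of n]] Lp_integrable[OF h] tr[of n]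
        by (simp add: Th_def H_def)
    qed
    finally show ?thesis .
  qed
  show ?thesis
  proof (rule LIMSEQ_I)
    fix e :: real assume e: "e > 0"
    define \<eta> where "\<eta> = e / (2 * (G + H + 1))"
    have \<eta>: "\<eta> > 0" using e G0 by (simp add: \<eta>_def)
    have small: "\<eta> * (G + H) < e / 2 + e / 4"
    proof -
      have "\<eta> * (G + H) \<le> \<eta> * (G + H + 1)" using \<eta> by simp
      also have "\<dots> = e / 2" using G0 by (simp add: \<eta>_def field_simps)
      finally show ?thesis using e by simp
    qed
    have "(\<lambda>n. \<eta> powr (1 - r) * Tg n + \<eta> powr (- 1 / (r - 1)) * Th n) \<longlonglongrightarrow> \<eta> powr (1 - r) * 0 + \<eta> powr (- 1 / (r - 1)) * 0"
      by (intro tendsto_intros T0)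
    then have "\<forall>\<^sub>F n in sequentially. \<eta> powr (1 - r) * Tg n + \<eta> powr (- 1 / (r - 1)) * Th n < e / 4"
      using e by (intro order_tendstoD(2)) auto
    then have "\<forall>\<^sub>F n in sequentially. (LBINT x. \<bar>g (x - z n)\<bar> * \<bar>h x\<bar> powr (r - 1)) < e"
    proof eventually_elim
      case (elim n)
      then show ?case using bound[OF \<eta>, of n] small by linarith
    qed
    then show "\<exists>no. \<forall>n\<ge>no. norm ((LBINT x. \<bar>g (x - z n)\<bar> * \<bar>h x\<bar> powr (r - 1)) - 0) < e"
      by (auto simp: eventually_sequentially abs_of_nonneg integral_nonneg_AE)
  qed
qed

section \<open>Decoupling of diverging profiles\<close>

text \<open>The growth condition shared by \<open>F\<close> and the powers \<open>\<bar>s\<bar> powr r\<close>.\<close>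

definition power_lipschitz :: "real set \<Rightarrow> real \<Rightarrow> (real \<Rightarrow> real) \<Rightarrow> bool" where
  "power_lipschitz E c \<Phi> \<longleftrightarrow> \<Phi> 0 = 0 \<and>
     (\<forall>a b. \<bar>\<Phi> (a + b) - \<Phi> a\<bar> \<le> c * (\<Sum>r\<in>E. \<bar>b\<bar> * (\<bar>a\<bar> + \<bar>b\<bar>) powr (r - 1)))"

lemma power_lipschitz_growth:
  assumes "power_lipschitz E c \<Phi>"
  shows "\<bar>\<Phi> s\<bar> \<le> c * (\<Sum>r\<in>E. \<bar>s\<bar> powr r)"
proof -
  have "\<bar>\<Phi> (0 + s) - \<Phi> 0\<bar> \<le> c * (\<Sum>r\<in>E. \<bar>s\<bar> * (\<bar>0\<bar> + \<bar>s\<bar>) powr (r - 1))"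
    using assms unfolding power_lipschitz_def by blast
  moreover have "\<bar>s\<bar> * \<bar>s\<bar> powr (r - 1) = \<bar>s\<bar> powr r" for r
    using powr_mult_base[of "\<bar>s\<bar>" "r - 1"] by simp
  ultimately show ?thesis using assms by (simp add: power_lipschitz_def)
qed

text \<open>The argument of larger modulus serves as base point: if |b| <= |a|, then |a| + |b| <=
  2|a| and |b|^r <= |b| |a|^(r-1). Both mixed products are kept so that the bound is symmetric and
  the other case follows by exchange.\<close>

lemma power_lipschitz_split:
  assumes \<Phi>: "power_lipschitz E c \<Phi>" and c: "0 \<le> c" and E: "\<And>r. r \<in> E \<Longrightarrow> 1 < r"
  shows "\<bar>\<Phi> (a + b) - \<Phi> a - \<Phi> b\<bar> \<le>
    c * (\<Sum>r\<in>E. (2 powr (r - 1) + 1) * (\<bar>a\<bar> * \<bar>b\<bar> powr (r - 1) + \<bar>b\<bar> * \<bar>a\<bar> powr (r - 1)))"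
proof -
  have sq: "\<bar>s\<bar> * \<bar>s\<bar> powr (r - 1) = \<bar>s\<bar> powr r" for s r :: real
    using powr_mult_base[of "\<bar>s\<bar>" "r - 1"] by simp
  have *: "\<bar>\<Phi> (a + b) - \<Phi> a - \<Phi> b\<bar> \<le>
    c * (\<Sum>r\<in>E. (2 powr (r - 1) + 1) * (\<bar>a\<bar> * \<bar>b\<bar> powr (r - 1) + \<bar>b\<bar> * \<bar>a\<bar> powr (r - 1)))"
    if ab: "\<bar>b\<bar> \<le> \<bar>a\<bar>" for a b
  proof -
    have "\<bar>\<Phi> (a + b) - \<Phi> a - \<Phi> b\<bar> \<le> c * (\<Sum>r\<in>E. \<bar>b\<bar> * (\<bar>a\<bar> + \<bar>b\<bar>) powr (r - 1)) + c * (\<Sum>r\<in>E. \<bar>b\<bar> powr r)"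
    proof -
      have "\<bar>\<Phi> (a + b) - \<Phi> a\<bar> \<le> c * (\<Sum>r\<in>E. \<bar>b\<bar> * (\<bar>a\<bar> + \<bar>b\<bar>) powr (r - 1))"
        using \<Phi> unfolding power_lipschitz_def by blast
      then show ?thesis
        using power_lipschitz_growth[OF \<Phi>, of b] abs_triangle_ineq4[of "\<Phi> (a + b) - \<Phi> a" "\<Phi> b"] by linarith
    qed
    also have "\<dots> = c * (\<Sum>r\<in>E. \<bar>b\<bar> * (\<bar>a\<bar> + \<bar>b\<bar>) powr (r - 1) + \<bar>b\<bar> powr r)"
      by (simp add: sum.distrib distrib_left)
    also have "\<dots> \<le> c * (\<Sum>r\<in>E. (2 powr (r - 1) + 1) * (\<bar>a\<bar> * \<bar>b\<bar> powr (r - 1) + \<bar>b\<bar> * \<bar>a\<bar> powr (r - 1)))"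
    proof (intro mult_left_mono c sum_mono)
      fix r assume r: "r \<in> E"
      have "(\<bar>a\<bar> + \<bar>b\<bar>) powr (r - 1) \<le> (2 * \<bar>a\<bar>) powr (r - 1)" using E[OF r] ab by (intro powr_mono2) auto
      then have 1: "\<bar>b\<bar> * (\<bar>a\<bar> + \<bar>b\<bar>) powr (r - 1) \<le> \<bar>b\<bar> * (2 powr (r - 1) * \<bar>a\<bar> powr (r - 1))"
        by (intro mult_left_mono) (auto simp: powr_mult)
      have "\<bar>b\<bar> powr (r - 1) \<le> \<bar>a\<bar> powr (r - 1)" using E[OF r] ab by (intro powr_mono2) auto
      then have 2: "\<bar>b\<bar> powr r \<le> \<bar>b\<bar> * \<bar>a\<bar> powr (r - 1)"
        using mult_left_mono[of "\<bar>b\<bar> powr (r - 1)" "\<bar>a\<bar> powr (r - 1)" "\<bar>b\<bar>"] sq[of b r] by simp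
      have "\<bar>b\<bar> * (\<bar>a\<bar> + \<bar>b\<bar>) powr (r - 1) + \<bar>b\<bar> powr r \<le> (2 powr (r - 1) + 1) * (\<bar>b\<bar> * \<bar>a\<bar> powr (r - 1))"
        using 1 2 by (simp add: algebra_simps)
      also have "\<dots> \<le> (2 powr (r - 1) + 1) * (\<bar>a\<bar> * \<bar>b\<bar> powr (r - 1) + \<bar>b\<bar> * \<bar>a\<bar> powr (r - 1))"
        by (intro mult_left_mono) auto
      finally show "\<bar>b\<bar> * (\<bar>a\<bar> + \<bar>b\<bar>) powr (r - 1) + \<bar>b\<bar> powr r \<le>
        (2 powr (r - 1) + 1) * (\<bar>a\<bar> * \<bar>b\<bar> powr (r - 1) + \<bar>b\<bar> * \<bar>a\<bar> powr (r - 1))" .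
    qed
    finally show ?thesis .
  qed
  show ?thesis
  proof (cases "\<bar>b\<bar> \<le> \<bar>a\<bar>")
    case False
    then have "\<bar>\<Phi> (b + a) - \<Phi> b - \<Phi> a\<bar> \<le>
      c * (\<Sum>r\<in>E. (2 powr (r - 1) + 1) * (\<bar>b\<bar> * \<bar>a\<bar> powr (r - 1) + \<bar>a\<bar> * \<bar>b\<bar> powr (r - 1)))"
      by (intro *) simp
    moreover have eq: "\<Phi> (b + a) - \<Phi> b - \<Phi> a = \<Phi> (a + b) - \<Phi> a - \<Phi> b" by (simp add: add.commute)
    moreover have "\<bar>b\<bar> * \<bar>a\<bar> powr (r - 1) + \<bar>a\<bar> * \<bar>b\<bar> powr (r - 1) = \<bar>a\<bar> * \<bar>b\<bar> powr (r - 1) + \<bar>b\<bar> * \<bar>a\<bar> powr (r - 1)" for r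
      by (rule add.commute)
    ultimately show ?thesis by (simp only:)
  qed (rule *)
qed

text \<open>The increment is estimated by the tangent at the larger modulus. It lets the decoupling
  result for \<open>F\<close> also compute the limiting L^r masses of sums of translates.\<close>

lemma power_lipschitz_powr:
  assumes r: "1 < r"
  shows "power_lipschitz {r} r (\<lambda>s. \<bar>s\<bar> powr r)"
proof -
  have *: "\<bar>\<bar>x\<bar> powr r - \<bar>y\<bar> powr r\<bar> \<le> r * (d * t powr (r - 1))" if "\<bar>x\<bar> \<le> t" "\<bar>y\<bar> \<le> t" "\<bar>\<bar>x\<bar> - \<bar>y\<bar>\<bar> \<le> d" for x y t d :: real
  proof -
    have **: "x powr r - y powr r \<le> r * (d * t powr (r - 1))" if "0 \<le> y" "y \<le> x" "x \<le> t" "x - y \<le> d" for x y :: real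
    proof -
      have "x powr r - y powr r \<le> r * x powr (r - 1) * (x - y)"
        using powr_tangent[of y x r] that r by (simp add: algebra_simps)
      also have "\<dots> \<le> r * t powr (r - 1) * d"
        using that r by (intro mult_mono powr_mono2) auto
      finally show ?thesis by (simp add: mult_ac)
    qed
    have "\<bar>x\<bar> powr r \<le> \<bar>y\<bar> powr r" if "\<bar>x\<bar> \<le> \<bar>y\<bar>" using r that by (intro powr_mono2) auto
    moreover have "\<bar>y\<bar> powr r \<le> \<bar>x\<bar> powr r" if "\<bar>y\<bar> \<le> \<bar>x\<bar>" using r that by (intro powr_mono2) auto
    ultimately show ?thesis using **[of "\<bar>x\<bar>" "\<bar>y\<bar>"] **[of "\<bar>y\<bar>" "\<bar>x\<bar>"] that by (cases "\<bar>x\<bar> \<le> \<bar>y\<bar>") auto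
  qed
  show ?thesis unfolding power_lipschitz_def
  proof (intro conjI allI)
    fix a b :: real
    show "\<bar>\<bar>a + b\<bar> powr r - \<bar>a\<bar> powr r\<bar> \<le> r * (\<Sum>r\<in>{r}. \<bar>b\<bar> * (\<bar>a\<bar> + \<bar>b\<bar>) powr (r - 1))"
      using *[of "a + b" "\<bar>a\<bar> + \<bar>b\<bar>" a "\<bar>b\<bar>"] by simp
  qed (use r in simp)
qed

text \<open>The sum is at most its cardinality times the largest term. Unlike a convexity argument
  this covers exponents below 1, which occur as r - 1.\<close>

lemma sum_powr_le_card:
  fixes f :: "'i \<Rightarrow> real"
  assumes "finite A" "\<And>i. i \<in> A \<Longrightarrow> 0 \<le> f i" "0 \<le> s"
  shows "(\<Sum>i\<in>A. f i) powr s \<le> real (card A) powr s * (\<Sum>i\<in>A. f i powr s)"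
proof (cases "A = {}")
  case False
  define M where "M = Max (f ` A)"
  have "M \<in> f ` A" unfolding M_def using assms False by (intro Max_in) auto
  then obtain j where j: "j \<in> A" "f j = M" by auto
  have le: "f i \<le> M" if "i \<in> A" for i unfolding M_def using assms that by (intro Max_ge) auto
  have "(\<Sum>i\<in>A. f i) \<le> real (card A) * M" using sum_bounded_above[of A f M] le by simp
  then have "(\<Sum>i\<in>A. f i) powr s \<le> (real (card A) * M) powr s"
    using assms by (intro powr_mono2 sum_nonneg) auto
  also have "\<dots> = real (card A) powr s * f j powr s" using assms j by (simp add: powr_mult)
  also have "\<dots> \<le> real (card A) powr s * (\<Sum>i\<in>A. f i powr s)"
    using assms j by (intro mult_left_mono member_le_sum) auto
  finally show ?thesis .
qed simp

lemma power_lipschitz_integrable: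
  fixes f :: "real^'n::finite \<Rightarrow> real"
  assumes \<Phi>: "power_lipschitz E c \<Phi>" and m: "\<Phi> \<in> borel_measurable borel" and c: "0 \<le> c" and E: "finite E"
    and f: "\<And>r. r \<in> E \<Longrightarrow> Lp r f" "f \<in> borel_measurable borel"
  shows "integrable lborel (\<lambda>x. \<Phi> (f x))"
proof (rule Bochner_Integration.integrable_bound)
  show "integrable lborel (\<lambda>x. c * (\<Sum>r\<in>E. \<bar>f x\<bar> powr r))"
    using f by (intro integrable_mult_right Bochner_Integration.integrable_sum Lp_integrable)
  show "(\<lambda>x. \<Phi> (f x)) \<in> borel_measurable lborel" using measurable_compose[OF f(2) m] by simp
  show "AE x in lborel. norm (\<Phi> (f x)) \<le> norm (c * (\<Sum>r\<in>E. \<bar>f x\<bar> powr r))"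
    by (intro AE_I2) (simp add: order_trans[OF power_lipschitz_growth[OF \<Phi>] abs_ge_self])
qed

lemma cross_term_translates_tendsto_0:
  fixes g h :: "real^'n::finite \<Rightarrow> real" and y z :: "nat \<Rightarrow> real^'n"
  assumes g: "Lp r g" and h: "Lp r h" and r: "1 < r" and z: "filterlim (\<lambda>n. norm (y n - z n)) at_top sequentially"
  shows "(\<lambda>n. LBINT x. \<bar>g (x - y n)\<bar> * \<bar>h (x - z n)\<bar> powr (r - 1)) \<longlonglongrightarrow> 0"
proof -
  have [measurable]: "g \<in> borel_measurable borel" "h \<in> borel_measurable borel" using g h by (auto intro: Lp_borel)
  have "(LBINT x. \<bar>g (x - y n)\<bar> * \<bar>h (x - z n)\<bar> powr (r - 1)) = (LBINT x. \<bar>g (x - (y n - z n))\<bar> * \<bar>h x\<bar> powr (r - 1))" for n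
    using integral_translate[of "\<lambda>x. \<bar>g (x - y n)\<bar> * \<bar>h (x - z n)\<bar> powr (r - 1)" "z n"]
    by (simp add: algebra_simps)
  then show ?thesis using cross_term_tendsto_0[OF g h r z] by simp
qed

text \<open>Induction on \<open>L\<close>: splitting off the last translate costs only cross terms
  with the sum of the earlier ones, and these reduce to finitely many pairs with diverging
  centres.\<close>

lemma integral_sum_translates:
  fixes W :: "nat \<Rightarrow> real^'n::finite \<Rightarrow> real" and y :: "nat \<Rightarrow> nat \<Rightarrow> real^'n"
  assumes \<Phi>: "power_lipschitz E c \<Phi>" and m: "\<Phi> \<in> borel_measurable borel" and c: "0 \<le> c"
    and E: "finite E" "\<And>r. r \<in> E \<Longrightarrow> 1 < r"
    and W: "\<And>l r. l \<le> L \<Longrightarrow> r \<in> E \<Longrightarrow> Lp r (W l)" "\<And>l. l \<le> L \<Longrightarrow> W l \<in> borel_measurable borel"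
    and y: "\<And>l k. l \<le> L \<Longrightarrow> k \<le> L \<Longrightarrow> l \<noteq> k \<Longrightarrow> filterlim (\<lambda>n. norm (y l n - y k n)) at_top sequentially"
  shows "(\<lambda>n. LBINT x. \<Phi> (\<Sum>l\<le>L. W l (x - y l n))) \<longlonglongrightarrow> (\<Sum>l\<le>L. LBINT x. \<Phi> (W l x))"
  using W y
proof (induction L)
  case 0
  have "(LBINT x. \<Phi> (W 0 (x - y 0 n))) = (LBINT x. \<Phi> (W 0 x))" for n
    using integral_translate[of "\<lambda>x. \<Phi> (W 0 x)" "- y 0 n"] measurable_compose[OF 0(2) m] by simp
  then show ?case by simp
next
  case (Suc L)
  define S where "S n x = (\<Sum>l\<le>L. W l (x - y l n))" for n x
  define b where "b n x = W (Suc L) (x - y (Suc L) n)" for n x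
  have Wt: "Lp r (\<lambda>x. W l (x - y l n))" if "l \<le> Suc L" "r \<in> E" for l r n
    using Lp_translate[OF Suc.prems(1)[OF that], of "- y l n"] by simp
  have Wm [measurable]: "(\<lambda>x. W l (x - y l n)) \<in> borel_measurable borel" if "l \<le> Suc L" for l n
    using Suc.prems(2)[OF that] by measurable
  have S: "Lp r (S n)" if "r \<in> E" for r n unfolding S_def using that E by (intro Lp_sum Wt) auto
  have Sm [measurable]: "S n \<in> borel_measurable borel" for n unfolding S_def by (intro borel_measurable_sum Wm) auto
  have b: "Lp r (b n)" if "r \<in> E" for r n unfolding b_def using that by (intro Wt) auto
  have bm [measurable]: "b n \<in> borel_measurable borel" for n unfolding b_def by (intro Wm) auto
  have IH: "(\<lambda>n. LBINT x. \<Phi> (S n x)) \<longlonglongrightarrow> (\<Sum>l\<le>L. LBINT x. \<Phi> (W l x))"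
    unfolding S_def by (intro Suc.IH Suc.prems) auto
  have bi: "(LBINT x. \<Phi> (b n x)) = (LBINT x. \<Phi> (W (Suc L) x))" for n
    unfolding b_def using integral_translate[of "\<lambda>x. \<Phi> (W (Suc L) x)" "- y (Suc L) n"] measurable_compose[OF Suc.prems(2) m] by simp
  have i1: "integrable lborel (\<lambda>x. \<Phi> (S n x))" "integrable lborel (\<lambda>x. \<Phi> (b n x))" "integrable lborel (\<lambda>x. \<Phi> (S n x + b n x))" for n
    by (rule power_lipschitz_integrable[OF \<Phi> m c E(1)]; use S b E in \<open>auto intro: Lp_add\<close>)+
  define K where "K r n = (LBINT x. \<bar>S n x\<bar> * \<bar>b n x\<bar> powr (r - 1)) + (LBINT x. \<bar>b n x\<bar> * \<bar>S n x\<bar> powr (r - 1))" for r n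
  have cross: "(\<lambda>n. K r n) \<longlonglongrightarrow> 0 + 0" if r: "r \<in> E" for r
    unfolding K_def
  proof (rule tendsto_add)
    have r1: "1 < r" by (rule E(2)[OF r])
    show "(\<lambda>n. LBINT x. \<bar>S n x\<bar> * \<bar>b n x\<bar> powr (r - 1)) \<longlonglongrightarrow> 0"
    proof (rule tendsto_sandwich[OF _ _ tendsto_const])
      show "\<forall>\<^sub>F n in sequentially. 0 \<le> (LBINT x. \<bar>S n x\<bar> * \<bar>b n x\<bar> powr (r - 1))" by (simp add: integral_nonneg_AE)
      have int: "integrable lborel (\<lambda>x. \<bar>W l (x - y l n)\<bar> * \<bar>b n x\<bar> powr (r - 1))" if "l \<le> L" for l n
        using that by (intro integrable_cross Wt b r r1) auto
      have "(LBINT x. \<bar>S n x\<bar> * \<bar>b n x\<bar> powr (r - 1)) \<le> (\<Sum>l\<le>L. LBINT x. \<bar>W l (x - y l n)\<bar> * \<bar>b n x\<bar> powr (r - 1))" for n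
      proof -
        have "(LBINT x. \<bar>S n x\<bar> * \<bar>b n x\<bar> powr (r - 1)) \<le> (LBINT x. (\<Sum>l\<le>L. \<bar>W l (x - y l n)\<bar> * \<bar>b n x\<bar> powr (r - 1)))"
        proof (rule integral_mono)
          fix x show "\<bar>S n x\<bar> * \<bar>b n x\<bar> powr (r - 1) \<le> (\<Sum>l\<le>L. \<bar>W l (x - y l n)\<bar> * \<bar>b n x\<bar> powr (r - 1))"
            unfolding S_def sum_distrib_right[symmetric] by (intro mult_right_mono sum_abs) auto
        qed (use int S b r r1 in \<open>auto intro: integrable_cross\<close>)
        also have "\<dots> = (\<Sum>l\<le>L. LBINT x. \<bar>W l (x - y l n)\<bar> * \<bar>b n x\<bar> powr (r - 1))"
          by (rule Bochner_Integration.integral_sum) (use int in auto)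
        finally show ?thesis .
      qed
      then show "\<forall>\<^sub>F n in sequentially. (LBINT x. \<bar>S n x\<bar> * \<bar>b n x\<bar> powr (r - 1)) \<le>
         (\<Sum>l\<le>L. LBINT x. \<bar>W l (x - y l n)\<bar> * \<bar>b n x\<bar> powr (r - 1))" by simp
      show "(\<lambda>n. \<Sum>l\<le>L. LBINT x. \<bar>W l (x - y l n)\<bar> * \<bar>b n x\<bar> powr (r - 1)) \<longlonglongrightarrow> 0"
        unfolding b_def
        by (intro tendsto_null_sum cross_term_translates_tendsto_0 Suc.prems r r1) auto
    qed
    show "(\<lambda>n. LBINT x. \<bar>b n x\<bar> * \<bar>S n x\<bar> powr (r - 1)) \<longlonglongrightarrow> 0"
    proof (rule tendsto_sandwich[OF _ _ tendsto_const])
      show "\<forall>\<^sub>F n in sequentially. 0 \<le> (LBINT x. \<bar>b n x\<bar> * \<bar>S n x\<bar> powr (r - 1))" by (simp add: integral_nonneg_AE)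
      let ?c = "real (Suc L) powr (r - 1)"
      have int: "integrable lborel (\<lambda>x. \<bar>b n x\<bar> * \<bar>W l (x - y l n)\<bar> powr (r - 1))" if "l \<le> L" for l n
        using that by (intro integrable_cross Wt b r r1) auto
      have "(LBINT x. \<bar>b n x\<bar> * \<bar>S n x\<bar> powr (r - 1)) \<le> ?c * (\<Sum>l\<le>L. LBINT x. \<bar>b n x\<bar> * \<bar>W l (x - y l n)\<bar> powr (r - 1))" for n
      proof -
        have "(LBINT x. \<bar>b n x\<bar> * \<bar>S n x\<bar> powr (r - 1)) \<le> (LBINT x. ?c * (\<Sum>l\<le>L. \<bar>b n x\<bar> * \<bar>W l (x - y l n)\<bar> powr (r - 1)))"
        proof (rule integral_mono)
          fix x
          have "\<bar>S n x\<bar> powr (r - 1) \<le> (\<Sum>l\<le>L. \<bar>W l (x - y l n)\<bar>) powr (r - 1)"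
            unfolding S_def using r1 by (intro powr_mono2 sum_abs) auto
          also have "\<dots> \<le> ?c * (\<Sum>l\<le>L. \<bar>W l (x - y l n)\<bar> powr (r - 1))"
            using sum_powr_le_card[of "{..L}" "\<lambda>l. \<bar>W l (x - y l n)\<bar>" "r - 1"] r1 by simp
          finally have "\<bar>b n x\<bar> * \<bar>S n x\<bar> powr (r - 1) \<le> \<bar>b n x\<bar> * (?c * (\<Sum>l\<le>L. \<bar>W l (x - y l n)\<bar> powr (r - 1)))"
            by (intro mult_left_mono) auto
          then show "\<bar>b n x\<bar> * \<bar>S n x\<bar> powr (r - 1) \<le> ?c * (\<Sum>l\<le>L. \<bar>b n x\<bar> * \<bar>W l (x - y l n)\<bar> powr (r - 1))"
            unfolding sum_distrib_left[symmetric] by (simp only: mult.left_commute)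
        next
          show "integrable lborel (\<lambda>x. ?c * (\<Sum>l\<le>L. \<bar>b n x\<bar> * \<bar>W l (x - y l n)\<bar> powr (r - 1)))"
            using int by (intro integrable_mult_right Bochner_Integration.integrable_sum) auto
          show "integrable lborel (\<lambda>x. \<bar>b n x\<bar> * \<bar>S n x\<bar> powr (r - 1))" by (intro integrable_cross S b r r1)
        qed
        also have "\<dots> = ?c * (\<Sum>l\<le>L. LBINT x. \<bar>b n x\<bar> * \<bar>W l (x - y l n)\<bar> powr (r - 1))"
          by (subst integral_mult_right_zero, subst Bochner_Integration.integral_sum) (use int in auto)
        finally show ?thesis .
      qed
      then show "\<forall>\<^sub>F n in sequentially. (LBINT x. \<bar>b n x\<bar> * \<bar>S n x\<bar> powr (r - 1)) \<le>
        ?c * (\<Sum>l\<le>L. LBINT x. \<bar>b n x\<bar> * \<bar>W l (x - y l n)\<bar> powr (r - 1))" by simp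
      show "(\<lambda>n. ?c * (\<Sum>l\<le>L. LBINT x. \<bar>b n x\<bar> * \<bar>W l (x - y l n)\<bar> powr (r - 1))) \<longlonglongrightarrow> 0"
        unfolding b_def
        by (intro tendsto_mult_right_zero tendsto_null_sum cross_term_translates_tendsto_0 Suc.prems r r1) auto
    qed
  qed
  have bound: "\<bar>(LBINT x. \<Phi> (S n x + b n x)) - (LBINT x. \<Phi> (S n x)) - (LBINT x. \<Phi> (b n x))\<bar> \<le>
    c * (\<Sum>r\<in>E. (2 powr (r - 1) + 1) * K r n)" for n
  proof -
    have ic: "integrable lborel (\<lambda>x. \<bar>S n x\<bar> * \<bar>b n x\<bar> powr (r - 1))" "integrable lborel (\<lambda>x. \<bar>b n x\<bar> * \<bar>S n x\<bar> powr (r - 1))" if "r \<in> E" for r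
      using that S b E by (auto intro: integrable_cross)
    have "\<bar>(LBINT x. \<Phi> (S n x + b n x)) - (LBINT x. \<Phi> (S n x)) - (LBINT x. \<Phi> (b n x))\<bar> =
      \<bar>LBINT x. \<Phi> (S n x + b n x) - \<Phi> (S n x) - \<Phi> (b n x)\<bar>"
      using i1 by simp
    also have "\<dots> \<le> (LBINT x. \<bar>\<Phi> (S n x + b n x) - \<Phi> (S n x) - \<Phi> (b n x)\<bar>)" by (rule integral_abs_bound)
    also have "\<dots> \<le> (LBINT x. c * (\<Sum>r\<in>E. (2 powr (r - 1) + 1) * (\<bar>S n x\<bar> * \<bar>b n x\<bar> powr (r - 1) + \<bar>b n x\<bar> * \<bar>S n x\<bar> powr (r - 1))))"
    proof (rule integral_mono)
      show "integrable lborel (\<lambda>x. \<bar>\<Phi> (S n x + b n x) - \<Phi> (S n x) - \<Phi> (b n x)\<bar>)"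
        using i1 by (intro integrable_abs Bochner_Integration.integrable_diff)
      show "integrable lborel (\<lambda>x. c * (\<Sum>r\<in>E. (2 powr (r - 1) + 1) * (\<bar>S n x\<bar> * \<bar>b n x\<bar> powr (r - 1) + \<bar>b n x\<bar> * \<bar>S n x\<bar> powr (r - 1))))"
        using ic by (intro integrable_mult_right Bochner_Integration.integrable_sum Bochner_Integration.integrable_add)
    qed (rule power_lipschitz_split[OF \<Phi> c E(2)])
    also have "\<dots> = c * (\<Sum>r\<in>E. (2 powr (r - 1) + 1) * K r n)"
      unfolding K_def
      by (subst integral_mult_right_zero, subst Bochner_Integration.integral_sum)
        (use ic in \<open>auto intro!: sum.cong\<close>)
    finally show ?thesis .
  qed
  have "(\<lambda>n. c * (\<Sum>r\<in>E. (2 powr (r - 1) + 1) * K r n)) \<longlonglongrightarrow> 0"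
    using cross by (intro tendsto_mult_right_zero tendsto_null_sum) auto
  then have "(\<lambda>n. (LBINT x. \<Phi> (S n x + b n x)) - (LBINT x. \<Phi> (S n x)) - (LBINT x. \<Phi> (b n x))) \<longlonglongrightarrow> 0"
    by (rule Lim_null_comparison[rotated]) (simp add: bound)
  from tendsto_add[OF this tendsto_add[OF IH tendsto_const[of "LBINT x. \<Phi> (W (Suc L) x)"]]]
  show ?case unfolding bi by (simp add: S_def b_def)
qed

section \<open>Lower semicontinuity and growth bounds\<close>

text \<open>Weak lower semicontinuity, applied on disjoint translates of bounded sets: linearise
  \<open>\<bar>b\<bar> powr r\<close> at \<open>W l\<close>, cut off where \<open>W l\<close> or \<open>x\<close> is large so that the linear part is an
  admissible test function for weak convergence in \<open>L\<^sup>p\<close>, whatever \<open>r\<close> is.\<close>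

lemma profile_powr_sum_le:
  fixes v W :: "nat \<Rightarrow> real^'n::finite \<Rightarrow> real" and y :: "nat \<Rightarrow> nat \<Rightarrow> real^'n"
  assumes p: "1 < p" and r: "1 < r"
    and v: "\<And>n. Lp r (v n)" "\<And>n. Lp_mass r (v n) \<le> B"
    and W: "\<And>l. l \<le> L \<Longrightarrow> Lp r (W l)"
    and weak: "\<And>l g. l \<le> L \<Longrightarrow> Lp (p / (p - 1)) g \<Longrightarrow>
      (\<lambda>n. LBINT x. v n (x + y l n) * g x) \<longlonglongrightarrow> (LBINT x. W l x * g x)"
    and y: "\<And>l k. l \<le> L \<Longrightarrow> k \<le> L \<Longrightarrow> l \<noteq> k \<Longrightarrow> filterlim (\<lambda>n. norm (y l n - y k n)) at_top sequentially"
  shows "(\<Sum>l\<le>L. LBINT x. \<bar>W l x\<bar> powr r) \<le> B"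
proof -
  define S where "S k l = {x. norm x \<le> real k \<and> \<bar>W l x\<bar> \<le> real k}" for k l :: nat
  have Wm [measurable]: "W l \<in> borel_measurable borel" if "l \<le> L" for l using W[OF that] by (rule Lp_borel)
  have vm [measurable]: "v n \<in> borel_measurable borel" for n using v(1) by (rule Lp_borel)
  have Sm [measurable]: "S k l \<in> sets borel" if "l \<le> L" for k l
    unfolding S_def using Wm[OF that] by measurable
  have cut: "(\<Sum>l\<le>L. LBINT x. indicator (S k l) x * \<bar>W l x\<bar> powr r) \<le> B" for k
  proof -
    define h where "h l x = indicator (S k l) x * W l x" for l x
    \<comment> \<open>The derivative of |s|^r at the cut-off profile. It is bounded by r k^(r-1) and
      lives in the ball of radius \<open>k\<close>.\<close>
    define g where "g l x = r * \<bar>h l x\<bar> powr (r - 1) * sgn (W l x)" for l x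
    have hm [measurable]: "h l \<in> borel_measurable borel" if "l \<le> L" for l
      unfolding h_def using Wm[OF that] Sm[OF that] by measurable
    have gm [measurable]: "g l \<in> borel_measurable borel" if "l \<le> L" for l
      unfolding g_def using Wm[OF that] hm[OF that] by measurable
    have h: "Lp r (h l)" if "l \<le> L" for l
    proof -
      have "integrable lborel (\<lambda>x. indicator (S k l) x *\<^sub>R \<bar>W l x\<bar> powr r)"
        using Sm[OF that] by (intro integrable_mult_indicator Lp_integrable W that) auto
      moreover have "indicator (S k l) x *\<^sub>R \<bar>W l x\<bar> powr r = \<bar>h l x\<bar> powr r" for x
        by (auto simp: h_def indicator_def)
      ultimately show ?thesis using hm[OF that] by (simp add: Lp_def)
    qed
    have g_Lp: "Lp (p / (p - 1)) (g l)" if "l \<le> L" for l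
      unfolding Lp_def
    proof
      show "g l \<in> borel_measurable lborel" using gm[OF that] by simp
      have pp: "0 < p / (p - 1)" using p by simp
      show "integrable lborel (\<lambda>x. \<bar>g l x\<bar> powr (p / (p - 1)))"
      proof (rule Bochner_Integration.integrable_bound)
        show "integrable lborel (\<lambda>x::real^'n. (r * real k powr (r - 1)) powr (p / (p - 1)) * indicator (cball 0 (real k)) x)"
          by (intro integrable_mult_right integrable_real_indicator) (use emeasure_bounded_finite[OF bounded_cball] in auto)
        show "(\<lambda>x. \<bar>g l x\<bar> powr (p / (p - 1))) \<in> borel_measurable lborel" using gm[OF that] by measurable
        show "AE x in lborel. norm (\<bar>g l x\<bar> powr (p / (p - 1))) \<le>
           norm ((r * real k powr (r - 1)) powr (p / (p - 1)) * indicator (cball 0 (real k)) x)"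
        proof (rule AE_I2)
          fix x
          show "norm (\<bar>g l x\<bar> powr (p / (p - 1))) \<le> norm ((r * real k powr (r - 1)) powr (p / (p - 1)) * indicator (cball 0 (real k)) x)"
          proof (cases "x \<in> S k l")
            case True
            then have "\<bar>g l x\<bar> \<le> r * real k powr (r - 1)"
              using r by (auto simp: g_def h_def S_def abs_mult sgn_if intro!: powr_mono2)
            then have "\<bar>g l x\<bar> powr (p / (p - 1)) \<le> (r * real k powr (r - 1)) powr (p / (p - 1))"
              using pp by (intro powr_mono2) auto
            then show ?thesis using True by (auto simp: S_def)
          qed (simp add: g_def h_def)
        qed
      qed
    qed
    \<comment> \<open>The tangent to |s|^r at \<open>W l\<close>, evaluated at the translated
      \<open>v n\<close> and integrated over the cut-off set. It stays below the mass of
      \<open>v n\<close> on the translated set, and its limit requires nothing but weak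
      convergence.\<close>
    define T where "T l n = (LBINT x. indicator (S k l) x * \<bar>W l x\<bar> powr r) +
      (LBINT x. v n (x + y l n) * g l x) - (LBINT x. W l x * g l x)" for l n
    have T_lim: "(\<lambda>n. T l n) \<longlonglongrightarrow> (LBINT x. indicator (S k l) x * \<bar>W l x\<bar> powr r)" if "l \<le> L" for l
    proof -
      have "(\<lambda>n. T l n) \<longlonglongrightarrow> (LBINT x. indicator (S k l) x * \<bar>W l x\<bar> powr r) + (LBINT x. W l x * g l x) - (LBINT x. W l x * g l x)"
        unfolding T_def by (intro tendsto_intros weak that g_Lp)
      then show ?thesis by simp
    qed
    have int_g: "integrable lborel (\<lambda>x. f x * g l x)" if l: "l \<le> L" and f: "Lp r f" for l f
    proof -
      have [measurable]: "f \<in> borel_measurable borel" using f by (rule Lp_borel)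
      have "integrable lborel (\<lambda>x. r * (\<bar>f x\<bar> * \<bar>h l x\<bar> powr (r - 1)))"
        by (intro integrable_mult_right integrable_cross f h l r)
      then show ?thesis
      proof (rule Bochner_Integration.integrable_bound)
        show "(\<lambda>x. f x * g l x) \<in> borel_measurable lborel" using gm[OF l] by measurable
        show "AE x in lborel. norm (f x * g l x) \<le> norm (r * (\<bar>f x\<bar> * \<bar>h l x\<bar> powr (r - 1)))"
          using r by (intro AE_I2) (auto simp: g_def abs_mult sgn_if)
      qed
    qed
    have int_S: "integrable lborel (\<lambda>x. indicator (S k l) x * \<bar>f x\<bar> powr r)" if l: "l \<le> L" and f: "Lp r f" for l f
      using integrable_mult_indicator[OF _ Lp_integrable[OF f], of "S k l"] Sm[OF l] by simp
    have T_le: "T l n \<le> (LBINT x. indicator (S k l) (x - y l n) * \<bar>v n x\<bar> powr r)" if l: "l \<le> L" for l n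
    proof -
      have vt: "Lp r (\<lambda>x. v n (x + y l n))" by (intro Lp_translate v)
      have "T l n = (LBINT x. indicator (S k l) x * \<bar>W l x\<bar> powr r + v n (x + y l n) * g l x - W l x * g l x)"
        unfolding T_def using int_S[OF l W[OF l]] int_g[OF l vt] int_g[OF l W[OF l]] by simp
      also have "\<dots> \<le> (LBINT x. indicator (S k l) x * \<bar>v n (x + y l n)\<bar> powr r)"
      proof (rule integral_mono)
        fix x
        define a where "a = W l x"
        define b where "b = v n (x + y l n)"
        show "indicator (S k l) x * \<bar>W l x\<bar> powr r + v n (x + y l n) * g l x - W l x * g l x \<le> indicator (S k l) x * \<bar>v n (x + y l n)\<bar> powr r"
        proof (cases "x \<in> S k l")
          case True
          have "sgn a * (b - a) \<le> \<bar>b\<bar> - \<bar>a\<bar>" by (auto simp: sgn_if)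
          then have "r * \<bar>a\<bar> powr (r - 1) * (sgn a * (b - a)) \<le> r * \<bar>a\<bar> powr (r - 1) * (\<bar>b\<bar> - \<bar>a\<bar>)"
            using r by (intro mult_left_mono) auto
          then have "\<bar>a\<bar> powr r + r * \<bar>a\<bar> powr (r - 1) * (sgn a * (b - a)) \<le> \<bar>b\<bar> powr r"
            using powr_tangent[OF abs_ge_zero abs_ge_zero r, of a b] by linarith
          then show ?thesis using True unfolding g_def h_def a_def[symmetric] b_def[symmetric] by (simp add: algebra_simps)
        qed (simp add: g_def h_def)
      qed (use int_S[OF l W[OF l]] int_g[OF l vt] int_g[OF l W[OF l]] int_S[OF l vt] in auto)
      also have "\<dots> = (LBINT x. indicator (S k l) (x - y l n) * \<bar>v n x\<bar> powr r)"
      proof -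
        have "(\<lambda>x. indicator (S k l) (x - y l n) * \<bar>v n x\<bar> powr r) \<in> borel_measurable lborel"
          using Sm[OF l] by measurable
        from integral_translate[OF this, of "y l n"] show ?thesis by simp
      qed
      finally show ?thesis .
    qed
    \<comment> \<open>The cut-off sets lie in the ball of radius \<open>k\<close>, so centres more
      than 2k apart make their translates disjoint; the masses of \<open>v n\<close> on them then
      add up to at most the total.\<close>
    have "\<forall>l\<in>{..L}. \<forall>j\<in>{..L}. l \<noteq> j \<longrightarrow> (\<forall>\<^sub>F n in sequentially. 2 * real k < norm (y l n - y j n))"
      using y by (simp add: filterlim_at_top_dense)
    then have "\<forall>\<^sub>F n in sequentially. \<forall>l\<in>{..L}. \<forall>j\<in>{..L}. l \<noteq> j \<longrightarrow> 2 * real k < norm (y l n - y j n)"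
      by (intro eventually_ball_finite ballI) (auto simp: eventually_conj_iff)
    then have ev: "\<forall>\<^sub>F n in sequentially. (\<Sum>l\<le>L. T l n) \<le> B"
    proof eventually_elim
      case (elim n)
      have int: "integrable lborel (\<lambda>x. indicator (S k l) (x - y l n) * \<bar>v n x\<bar> powr r)" if l: "l \<le> L" for l
      proof -
        have "(\<lambda>x. x - y l n) \<in> borel_measurable borel" by measurable
        from measurable_sets[OF this Sm[OF l]] have "{x. x - y l n \<in> S k l} \<in> sets lborel" by (simp add: vimage_def)
        from integrable_mult_indicator[OF this Lp_integrable[OF v(1)[of n]]] show ?thesis
          by (simp add: indicator_def)
      qed
      have "(\<Sum>l\<le>L. T l n) \<le> (\<Sum>l\<le>L. LBINT x. indicator (S k l) (x - y l n) * \<bar>v n x\<bar> powr r)"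
        by (intro sum_mono T_le) auto
      also have "\<dots> = (LBINT x. (\<Sum>l\<le>L. indicator (S k l) (x - y l n) * \<bar>v n x\<bar> powr r))"
        by (rule Bochner_Integration.integral_sum[symmetric]) (use int in auto)
      also have "\<dots> \<le> Lp_mass r (v n)"
      proof (rule integral_mono)
        fix x
        have "(\<Sum>l\<le>L. indicator (S k l) (x - y l n)) \<le> (1::real)"
        proof -
          let ?A = "{l\<in>{..L}. x - y l n \<in> S k l}"
          have "l = j" if "l \<in> ?A" "j \<in> ?A" for l j
          proof (rule ccontr)
            assume "l \<noteq> j"
            then have "2 * real k < norm (y l n - y j n)" using elim that by auto
            also have "y l n - y j n = (x - y j n) - (x - y l n)" by simp
            also have "norm \<dots> \<le> norm (x - y j n) + norm (x - y l n)" by (rule norm_triangle_ineq4)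
            also have "\<dots> \<le> real k + real k" using that by (intro add_mono) (auto simp: S_def)
            finally show False by simp
          qed
          then have "card ?A \<le> 1" by (subst One_nat_def, subst card_le_Suc0_iff_eq) auto
          moreover have "(\<Sum>l\<le>L. indicator (S k l) (x - y l n)) = real (card ?A)"
            by (simp add: indicator_def sum.If_cases Int_def)
          ultimately show ?thesis by simp
        qed
        then show "(\<Sum>l\<le>L. indicator (S k l) (x - y l n) * \<bar>v n x\<bar> powr r) \<le> \<bar>v n x\<bar> powr r"
          unfolding sum_distrib_right[symmetric] by (intro mult_left_le_one_le) (auto intro: sum_nonneg)
      next
        show "integrable lborel (\<lambda>x. \<Sum>l\<le>L. indicator (S k l) (x - y l n) * \<bar>v n x\<bar> powr r)"
          by (rule Bochner_Integration.integrable_sum) (use int in auto)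
      qed (rule Lp_integrable[OF v(1)])
      finally show ?case using v(2)[of n] by linarith
    qed
    have "(\<lambda>n. \<Sum>l\<le>L. T l n) \<longlonglongrightarrow> (\<Sum>l\<le>L. LBINT x. indicator (S k l) x * \<bar>W l x\<bar> powr r)"
      by (intro tendsto_sum T_lim) auto
    from tendsto_upperbound[OF this ev] show ?thesis by simp
  qed
  have "(\<lambda>k. LBINT x. indicator (S k l) x * \<bar>W l x\<bar> powr r) \<longlonglongrightarrow> (Lp_mass r (W l))" if l: "l \<le> L" for l
  proof (rule integral_dominated_convergence)
    show "integrable lborel (\<lambda>x. \<bar>W l x\<bar> powr r)" by (intro Lp_integrable W l)
    show "AE x in lborel. (\<lambda>k. indicator (S k l) x * \<bar>W l x\<bar> powr r) \<longlonglongrightarrow> \<bar>W l x\<bar> powr r"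
    proof (rule AE_I2)
      fix x
      obtain k0 :: nat where "max (norm x) \<bar>W l x\<bar> \<le> real k0" using real_arch_simple by blast
      then have "x \<in> S k l" if "k \<ge> k0" for k using that by (auto simp: S_def)
      then have "\<forall>\<^sub>F k in sequentially. indicator (S k l) x * \<bar>W l x\<bar> powr r = \<bar>W l x\<bar> powr r"
        unfolding eventually_sequentially by (intro exI[of _ k0]) simp
      then show "(\<lambda>k. indicator (S k l) x * \<bar>W l x\<bar> powr r) \<longlonglongrightarrow> \<bar>W l x\<bar> powr r" by (rule tendsto_eventually)
    qed
    show "(\<lambda>x. indicator (S k l) x * \<bar>W l x\<bar> powr r) \<in> borel_measurable lborel" for k
      using Sm[OF l] Wm[OF l] by measurable
    show "(\<lambda>x. \<bar>W l x\<bar> powr r) \<in> borel_measurable lborel" using Wm[OF l] by measurable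
  qed (auto simp: indicator_def)
  then have "(\<lambda>k. \<Sum>l\<le>L. LBINT x. indicator (S k l) x * \<bar>W l x\<bar> powr r) \<longlonglongrightarrow> (\<Sum>l\<le>L. LBINT x. \<bar>W l x\<bar> powr r)"
    by (intro tendsto_sum) auto
  then show ?thesis by (rule LIMSEQ_le_const2) (use cut in auto)
qed

section \<open>Growth estimates for the primitive\<close>

lemma primitive_MVT:
  fixes F f :: "real \<Rightarrow> real"
  assumes F: "\<And>s. (F has_real_derivative f s) (at s)"
  shows "\<exists>\<xi>. \<bar>\<xi>\<bar> \<le> max \<bar>a\<bar> \<bar>b\<bar> \<and> \<bar>F b - F a\<bar> = \<bar>b - a\<bar> * \<bar>f \<xi>\<bar>"
proof -
  consider "a < b" | "b < a" | "a = b" by linarith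
  then show ?thesis
  proof cases
    case 1
    then obtain \<xi> where "a < \<xi>" "\<xi> < b" "F b - F a = (b - a) * f \<xi>" using MVT2[of a b F f] F by auto
    then show ?thesis by (intro exI[of _ \<xi>]) (auto simp: abs_mult)
  next
    case 2
    then obtain \<xi> where "b < \<xi>" "\<xi> < a" "F a - F b = (a - b) * f \<xi>" using MVT2[of b a F f] F by auto
    then show ?thesis by (intro exI[of _ \<xi>]) (auto simp: abs_mult abs_minus_commute)
  qed auto
qed

lemma power_growth_mono:
  fixes \<xi> t :: real
  assumes "\<bar>\<xi>\<bar> \<le> t" "0 \<le> \<epsilon>" "0 \<le> C" "\<And>r. r \<in> E \<Longrightarrow> 1 < r" "1 < q"
  shows "\<epsilon> * (\<Sum>r\<in>E. \<bar>\<xi>\<bar> powr (r - 1)) + C * \<bar>\<xi>\<bar> powr (q - 1) \<le> \<epsilon> * (\<Sum>r\<in>E. t powr (r - 1)) + C * t powr (q - 1)"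
  using assms by (intro add_mono mult_left_mono sum_mono powr_mono2) (auto simp: less_imp_le dest: less_imp_le)

text \<open>The growth condition with \<epsilon> = 1 already yields an admissible set of exponents
  once \<open>q\<close> is added; \<open>q \<notin> E\<close> lets the sum over the enlarged set
  split.\<close>

lemma power_lipschitz_primitive:
  assumes F: "\<And>s. (F has_real_derivative f s) (at s)" and F0: "F 0 = 0"
    and f: "\<And>s. \<bar>f s\<bar> \<le> 1 * (\<Sum>r\<in>E. \<bar>s\<bar> powr (r - 1)) + C * \<bar>s\<bar> powr (q - 1)"
    and E: "finite E" "\<And>r. r \<in> E \<Longrightarrow> 1 < r" and q: "1 < q" "q \<notin> E" and C: "0 \<le> C"
  shows "power_lipschitz (insert q E) (max 1 C) F"
  unfolding power_lipschitz_def
proof (intro conjI allI F0)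
  fix a b :: real
  obtain \<xi> where \<xi>: "\<bar>\<xi>\<bar> \<le> max \<bar>a\<bar> \<bar>a + b\<bar>" "\<bar>F (a + b) - F a\<bar> = \<bar>a + b - a\<bar> * \<bar>f \<xi>\<bar>"
    using primitive_MVT[OF F, of a "a + b"] by blast
  define t where "t = \<bar>a\<bar> + \<bar>b\<bar>"
  have \<xi>t: "\<bar>\<xi>\<bar> \<le> t" using \<xi>(1) by (auto simp: t_def)
  have S0: "0 \<le> (\<Sum>r\<in>E. t powr (r - 1))" by (intro sum_nonneg) auto
  have "\<bar>f \<xi>\<bar> \<le> 1 * (\<Sum>r\<in>E. t powr (r - 1)) + C * t powr (q - 1)"
    by (rule order_trans[OF f power_growth_mono[OF \<xi>t _ C E(2) q(1)]]) auto
  also have "\<dots> \<le> max 1 C * (\<Sum>r\<in>E. t powr (r - 1)) + max 1 C * t powr (q - 1)"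
    using S0 by (intro add_mono mult_right_mono) auto
  finally have "\<bar>b\<bar> * \<bar>f \<xi>\<bar> \<le> \<bar>b\<bar> * (max 1 C * (\<Sum>r\<in>E. t powr (r - 1)) + max 1 C * t powr (q - 1))"
    by (intro mult_left_mono) auto
  also have "\<dots> = max 1 C * (\<Sum>r\<in>insert q E. \<bar>b\<bar> * t powr (r - 1))"
    using E(1) q(2) by (simp add: sum_distrib_left[symmetric] algebra_simps)
  finally show "\<bar>F (a + b) - F a\<bar> \<le> max 1 C * (\<Sum>r\<in>insert q E. \<bar>b\<bar> * (\<bar>a\<bar> + \<bar>b\<bar>) powr (r - 1))"
    using \<xi>(2) by (simp add: t_def)
qed

text \<open>After the mean value theorem the two kinds of exponents are treated differently. For
  those in \<open>E\<close> the increment is bounded crudely by the sizes of \<open>a\<close> and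
  \<open>b\<close>, the smallness coming from \<open>\<epsilon>\<close>; for \<open>q\<close>,
  Young's inequality isolates |b - a|^q, which will be the remainder.\<close>

lemma primitive_diff_bound:
  assumes F: "\<And>s. (F has_real_derivative f s) (at s)"
    and f: "\<And>s. \<bar>f s\<bar> \<le> \<epsilon> * (\<Sum>r\<in>E. \<bar>s\<bar> powr (r - 1)) + C * \<bar>s\<bar> powr (q - 1)"
    and E: "\<And>r. r \<in> E \<Longrightarrow> 1 < r" and q: "1 < q" and C: "0 \<le> C" and \<epsilon>: "0 \<le> \<epsilon>" and \<eta>: "0 < \<eta>"
  shows "\<bar>F b - F a\<bar> \<le> 2 * \<epsilon> * (\<Sum>r\<in>E. \<bar>b\<bar> powr r + \<bar>a\<bar> powr r) +
    C * (\<eta> * (\<bar>b\<bar> powr q + \<bar>a\<bar> powr q) + \<eta> powr (1 - q) * \<bar>b - a\<bar> powr q)"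
proof -
  obtain \<xi> where \<xi>: "\<bar>\<xi>\<bar> \<le> max \<bar>a\<bar> \<bar>b\<bar>" "\<bar>F b - F a\<bar> = \<bar>b - a\<bar> * \<bar>f \<xi>\<bar>"
    using primitive_MVT[OF F, of a b] by blast
  define t where "t = max \<bar>a\<bar> \<bar>b\<bar>"
  have t0: "0 \<le> t" by (auto simp: t_def)
  have tr: "t powr r \<le> \<bar>b\<bar> powr r + \<bar>a\<bar> powr r" for r by (auto simp: t_def max_def)
  have tt: "t * t powr (r - 1) = t powr r" for r using powr_mult_base[of t "r - 1"] t0 by simp
  have "\<bar>f \<xi>\<bar> \<le> \<epsilon> * (\<Sum>r\<in>E. t powr (r - 1)) + C * t powr (q - 1)"
    by (rule order_trans[OF f power_growth_mono[OF \<xi>(1)[folded t_def] \<epsilon> C E q]])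
  then have "\<bar>b - a\<bar> * \<bar>f \<xi>\<bar> \<le> \<bar>b - a\<bar> * (\<epsilon> * (\<Sum>r\<in>E. t powr (r - 1)) + C * t powr (q - 1))"
    by (intro mult_left_mono) auto
  also have "\<dots> = \<epsilon> * (\<Sum>r\<in>E. \<bar>b - a\<bar> * t powr (r - 1)) + C * (\<bar>b - a\<bar> * t powr (q - 1))"
    by (simp add: sum_distrib_left[symmetric] algebra_simps)
  also have "\<dots> \<le> \<epsilon> * (\<Sum>r\<in>E. 2 * (\<bar>b\<bar> powr r + \<bar>a\<bar> powr r)) + C * (\<eta> * (\<bar>b\<bar> powr q + \<bar>a\<bar> powr q) + \<eta> powr (1 - q) * \<bar>b - a\<bar> powr q)"
  proof (intro add_mono mult_left_mono sum_mono \<epsilon> C)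
    fix r
    have "\<bar>b - a\<bar> * t powr (r - 1) \<le> (2 * t) * t powr (r - 1)" by (intro mult_right_mono) (auto simp: t_def)
    also have "\<dots> = 2 * t powr r" using tt[of r] by simp
    also have "\<dots> \<le> 2 * (\<bar>b\<bar> powr r + \<bar>a\<bar> powr r)" using tr[of r] by simp
    finally show "\<bar>b - a\<bar> * t powr (r - 1) \<le> 2 * (\<bar>b\<bar> powr r + \<bar>a\<bar> powr r)" .
  next
    have "\<bar>b - a\<bar> * t powr (q - 1) \<le> \<eta> * t powr q + \<eta> powr (1 - q) * \<bar>b - a\<bar> powr q"
      using t0 q \<eta> by (intro mult_powr_le) auto
    also have "\<dots> \<le> \<eta> * (\<bar>b\<bar> powr q + \<bar>a\<bar> powr q) + \<eta> powr (1 - q) * \<bar>b - a\<bar> powr q"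
      using tr[of q] \<eta> by (intro add_right_mono mult_left_mono) auto
    finally show "\<bar>b - a\<bar> * t powr (q - 1) \<le> \<eta> * (\<bar>b\<bar> powr q + \<bar>a\<bar> powr q) + \<eta> powr (1 - q) * \<bar>b - a\<bar> powr q" .
  qed
  also have "\<epsilon> * (\<Sum>r\<in>E. 2 * (\<bar>b\<bar> powr r + \<bar>a\<bar> powr r)) = 2 * \<epsilon> * (\<Sum>r\<in>E. \<bar>b\<bar> powr r + \<bar>a\<bar> powr r)"
    by (subst sum_distrib_left[symmetric]) simp
  finally show ?thesis unfolding \<xi>(2) .
qed

section \<open>Convergence of the integrals\<close>

text \<open>The error is split into four quarters of \<open>\<delta>\<close>: the endpoint terms,
  the Young term, the remainder in L^q, and the decoupling of finitely many profiles. The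
  down-closed index set \<open>A\<close> treats finite and infinite \<open>\<Lambda>\<close>
  together, and \<open>P\<close> may be infinite.\<close>

lemma profile_integral_limit:
  fixes v W :: "nat \<Rightarrow> real^'n::finite \<Rightarrow> real" and y :: "nat \<Rightarrow> nat \<Rightarrow> real^'n" and A :: "nat set" and P :: ereal
  assumes p: "1 < p"
    and E: "finite E" "\<And>r. r \<in> E \<Longrightarrow> p \<le> r \<and> ereal r \<le> P" "\<And>r. r \<in> E \<Longrightarrow> r = p \<or> ereal r = P"
    and F: "\<And>s. (F has_real_derivative f s) (at s)" and F0: "F 0 = 0"
    and f: "\<And>\<epsilon>. 0 < \<epsilon> \<Longrightarrow> \<exists>q C. p < q \<and> ereal q < P \<and> 0 < C \<and>
      (\<forall>s. \<bar>f s\<bar> \<le> \<epsilon> * (\<Sum>r\<in>E. \<bar>s\<bar> powr (r - 1)) + C * \<bar>s\<bar> powr (q - 1))"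
    and v: "\<And>r. p \<le> r \<Longrightarrow> ereal r \<le> P \<Longrightarrow> \<exists>B. \<forall>n. Lp r (v n) \<and> Lp_mass r (v n) \<le> B"
    and W: "\<And>l r. l \<in> A \<Longrightarrow> p \<le> r \<Longrightarrow> ereal r \<le> P \<Longrightarrow> Lp r (W l)"
    and weak: "\<And>l g. l \<in> A \<Longrightarrow> Lp (p / (p - 1)) g \<Longrightarrow>
      (\<lambda>n. LBINT x. v n (x + y l n) * g x) \<longlonglongrightarrow> (LBINT x. W l x * g x)"
    and y: "\<And>l k. l \<in> A \<Longrightarrow> k \<in> A \<Longrightarrow> l \<noteq> k \<Longrightarrow> filterlim (\<lambda>n. norm (y l n - y k n)) at_top sequentially"
    and A: "\<And>L l. L \<in> A \<Longrightarrow> l \<le> L \<Longrightarrow> l \<in> A"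
    and R: "\<And>q \<kappa>. p < q \<Longrightarrow> ereal q < P \<Longrightarrow> 0 < \<kappa> \<Longrightarrow> \<exists>L0\<in>A. \<forall>L\<in>A. L0 \<le> L \<longrightarrow>
      (\<forall>\<^sub>F n in sequentially. (LBINT x. \<bar>v n x - (\<Sum>l\<le>L. W l (x - y l n))\<bar> powr q) < \<kappa>)"
    and \<delta>: "0 < \<delta>"
  shows "\<exists>L0\<in>A. \<forall>L\<in>A. L0 \<le> L \<longrightarrow>
    (\<forall>\<^sub>F n in sequentially. \<bar>(LBINT x. F (v n x)) - (\<Sum>l\<le>L. LBINT x. F (W l x))\<bar> < \<delta>)"
proof -
  have "\<exists>B. \<forall>r. p \<le> r \<and> ereal r \<le> P \<longrightarrow> (\<forall>n. Lp r (v n) \<and> Lp_mass r (v n) \<le> B r)"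
    using v by (intro choice) metis
  then obtain B where B: "\<And>r n. p \<le> r \<Longrightarrow> ereal r \<le> P \<Longrightarrow> Lp r (v n)"
    "\<And>r n. p \<le> r \<Longrightarrow> ereal r \<le> P \<Longrightarrow> Lp_mass r (v n) \<le> B r"
    by blast
  have B0: "0 \<le> B r" if "p \<le> r" "ereal r \<le> P" for r
    by (rule order_trans[OF _ B(2)[OF that, of 0]]) (simp add: integral_nonneg_AE)
  have Fm: "F \<in> borel_measurable borel"
    using F by (intro borel_measurable_continuous_onI) (auto intro: DERIV_isCont simp: continuous_on_eq_continuous_at)
  have notE: "q \<notin> E" if "p < q" "ereal q < P" for q using E(3)[of q] that by auto
  have E1: "1 < r" if "r \<in> E" for r using E(2)[OF that] p by auto
  obtain q1 C1 where q1: "p < q1" "ereal q1 < P" and C1: "0 < C1"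
    and f1: "\<And>s. \<bar>f s\<bar> \<le> 1 * (\<Sum>r\<in>E. \<bar>s\<bar> powr (r - 1)) + C1 * \<bar>s\<bar> powr (q1 - 1)"
    using f[of 1] by auto
  let ?E1 = "insert q1 E"
  have PL: "power_lipschitz ?E1 (max 1 C1) F"
    using q1 C1 p E1 by (intro power_lipschitz_primitive[OF F F0 f1 E(1)] notE) auto
  have E1': "p \<le> r" "ereal r \<le> P" if "r \<in> ?E1" for r using that q1 E(2) by auto
  have E1'_gt: "1 < r" if "r \<in> ?E1" for r using E1'(1)[OF that] p by simp
  have F_int: "integrable lborel (\<lambda>x. F (g x))" if "\<And>r. p \<le> r \<Longrightarrow> ereal r \<le> P \<Longrightarrow> Lp r g" for g :: "real^'n \<Rightarrow> real"
    by (rule power_lipschitz_integrable[OF PL Fm]) (use E(1) E1' that q1 in \<open>auto intro: Lp_borel[of q1]\<close>)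
  \<comment> \<open>For each endpoint exponent \<open>v n\<close> contributes at most
    \<open>B r\<close> and the sum of profiles eventually less than \<open>B r + 1\<close>; neither
    depends on \<open>L\<close>.\<close>
  define M where "M = (\<Sum>r\<in>E. 2 * B r + 1)"
  have M0: "0 \<le> M" unfolding M_def using B0 E(2) by (intro sum_nonneg) (simp add: add_nonneg_nonneg)
  define \<epsilon> where "\<epsilon> = \<delta> / (8 * (M + 1))"
  have \<epsilon>: "0 < \<epsilon>" using \<delta> M0 by (simp add: \<epsilon>_def)
  have \<epsilon>M: "2 * \<epsilon> * M \<le> \<delta> / 4"
  proof -
    have "2 * \<epsilon> * M \<le> 2 * \<epsilon> * (M + 1)" using \<epsilon> by simp
    also have "\<dots> = \<delta> / 4" using M0 by (simp add: \<epsilon>_def field_simps)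
    finally show ?thesis .
  qed
  obtain q C where q: "p < q" "ereal q < P" and C: "0 < C"
    and fq: "\<And>s. \<bar>f s\<bar> \<le> \<epsilon> * (\<Sum>r\<in>E. \<bar>s\<bar> powr (r - 1)) + C * \<bar>s\<bar> powr (q - 1)"
    using f[OF \<epsilon>] by blast
  have qV: "p \<le> q" "ereal q \<le> P" using q by auto
  have q_1: "1 < q" using q p by simp
  \<comment> \<open>\<open>q\<close> and \<open>C\<close> are fixed by now, so the Young parameter
    may depend on them; it makes its term a quarter of \<open>\<delta>\<close>.\<close>
  define \<eta> where "\<eta> = \<delta> / (4 * C * (2 * B q + 1))"
  have Bq: "0 < 2 * B q + 1" using B0[OF qV] by simp
  have \<eta>: "0 < \<eta>" using \<delta> C Bq by (simp add: \<eta>_def)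
  have C\<eta>: "C * \<eta> * (2 * B q + 1) = \<delta> / 4"
  proof -
    have "C * (\<delta> / (4 * C * b)) * b = \<delta> / 4" if "0 < b" for b using C that by (simp add: field_simps)
    from this[OF Bq] show ?thesis by (simp only: \<eta>_def)
  qed
  \<comment> \<open>The smallness demanded of the remainder compensates the factor
    \<open>\<eta> powr (1 - q)\<close> and determines \<open>L0\<close>.\<close>
  define \<kappa> where "\<kappa> = \<delta> / (4 * C * \<eta> powr (1 - q))"
  have \<kappa>: "0 < \<kappa>" using \<delta> C \<eta> by (simp add: \<kappa>_def)
  have C\<kappa>: "C * \<eta> powr (1 - q) * \<kappa> = \<delta> / 4" using C \<eta> by (simp add: \<kappa>_def field_simps)
  obtain L0 where L0: "L0 \<in> A" "\<And>L. L \<in> A \<Longrightarrow> L0 \<le> L \<Longrightarrow>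
      \<forall>\<^sub>F n in sequentially. (LBINT x. \<bar>v n x - (\<Sum>l\<le>L. W l (x - y l n))\<bar> powr q) < \<kappa>"
    using R[OF q \<kappa>] by blast
  show ?thesis
  proof (intro bexI[of _ L0] ballI impI L0(1))
    fix L assume L: "L \<in> A" "L0 \<le> L"
    define S where "S n x = (\<Sum>l\<le>L. W l (x - y l n))" for n x
    have lA: "l \<in> A" if "l \<le> L" for l using A[OF L(1) that] .
    have WL: "Lp r (W l)" if "l \<le> L" "p \<le> r" "ereal r \<le> P" for l r using W lA that by blast
    have Wm: "W l \<in> borel_measurable borel" if "l \<le> L" for l using WL[OF that qV] by (rule Lp_borel)
    have SL: "Lp r (S n)" if "p \<le> r" "ereal r \<le> P" for r n
      unfolding S_def using Lp_translate[OF WL[OF _ that], of _ "- y _ n"] p that by (intro Lp_sum) auto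
    have S_powr: "\<forall>\<^sub>F n in sequentially. Lp_mass r (S n) < B r + 1" if r: "p \<le> r" "ereal r \<le> P" for r
    proof -
      have r1: "1 < r" using r p by simp
      have "(\<lambda>n. LBINT x. \<bar>S n x\<bar> powr r) \<longlonglongrightarrow> (\<Sum>l\<le>L. LBINT x. \<bar>W l x\<bar> powr r)"
        unfolding S_def
        by (rule integral_sum_translates[OF power_lipschitz_powr[OF r1]]) (use r r1 WL Wm y lA in auto)
      \<comment> \<open>The limiting mass of the sum is bounded by that of \<open>v\<close>, however
        many profiles are included; this keeps \<open>M\<close> and \<open>B q\<close> independent
        of \<open>L\<close>.\<close>
      moreover have "(\<Sum>l\<le>L. LBINT x. \<bar>W l x\<bar> powr r) \<le> B r"
        by (rule profile_powr_sum_le[OF p r1, of v _ _ _ y]) (use B r WL weak y lA in auto)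
      ultimately show ?thesis by (intro order_tendstoD(2)) auto
    qed
    have S_all: "\<forall>\<^sub>F n in sequentially. \<forall>r\<in>E. Lp_mass r (S n) < B r + 1"
      using E S_powr by (intro eventually_ball_finite ballI) auto
    have "(\<lambda>n. LBINT x. F (S n x)) \<longlonglongrightarrow> (\<Sum>l\<le>L. LBINT x. F (W l x))"
      unfolding S_def
      by (rule integral_sum_translates[OF PL Fm]) (use E(1) E1' E1'_gt WL Wm y lA in auto)
    then have S_F: "\<forall>\<^sub>F n in sequentially. \<bar>(LBINT x. F (S n x)) - (\<Sum>l\<le>L. LBINT x. F (W l x))\<bar> < \<delta> / 4"
      using tendstoD[of _ _ _ "\<delta> / 4"] \<delta> by (fastforce simp: dist_real_def simp del: less_divide_eq_numeral1)
    show "\<forall>\<^sub>F n in sequentially. \<bar>(LBINT x. F (v n x)) - (\<Sum>l\<le>L. LBINT x. F (W l x))\<bar> < \<delta>"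
      using L0(2)[OF L] S_F S_all S_powr[OF qV]
    proof eventually_elim
      case (elim n)
      let ?v = "\<lambda>r. LBINT x. \<bar>v n x\<bar> powr r" and ?S = "\<lambda>r. LBINT x. \<bar>S n x\<bar> powr r"
      let ?R = "LBINT x. \<bar>v n x - S n x\<bar> powr q"
      have iv: "integrable lborel (\<lambda>x. \<bar>v n x\<bar> powr r)" "integrable lborel (\<lambda>x. \<bar>S n x\<bar> powr r)" if "p \<le> r" "ereal r \<le> P" for r
        using B(1) SL that by (auto simp: Lp_def)
      have iR: "integrable lborel (\<lambda>x. \<bar>v n x - S n x\<bar> powr q)"
        by (intro Lp_integrable Lp_diff B(1) SL qV q_1)
      have iF: "integrable lborel (\<lambda>x. F (v n x))" "integrable lborel (\<lambda>x. F (S n x))"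
        by (intro F_int B(1) SL; assumption)+
      have "\<bar>(LBINT x. F (v n x)) - (LBINT x. F (S n x))\<bar> = \<bar>LBINT x. F (v n x) - F (S n x)\<bar>"
        using iF by simp
      also have "\<dots> \<le> (LBINT x. \<bar>F (v n x) - F (S n x)\<bar>)" by (rule integral_abs_bound)
      also have "\<dots> \<le> (LBINT x. 2 * \<epsilon> * (\<Sum>r\<in>E. \<bar>v n x\<bar> powr r + \<bar>S n x\<bar> powr r) +
         C * (\<eta> * (\<bar>v n x\<bar> powr q + \<bar>S n x\<bar> powr q) + \<eta> powr (1 - q) * \<bar>v n x - S n x\<bar> powr q))"
      proof (rule integral_mono)
        show "integrable lborel (\<lambda>x. \<bar>F (v n x) - F (S n x)\<bar>)"
          using iF by (intro integrable_abs Bochner_Integration.integrable_diff)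
        show "integrable lborel (\<lambda>x. 2 * \<epsilon> * (\<Sum>r\<in>E. \<bar>v n x\<bar> powr r + \<bar>S n x\<bar> powr r) +
         C * (\<eta> * (\<bar>v n x\<bar> powr q + \<bar>S n x\<bar> powr q) + \<eta> powr (1 - q) * \<bar>v n x - S n x\<bar> powr q))"
          using E(2) by (intro Bochner_Integration.integrable_add integrable_mult_right Bochner_Integration.integrable_sum iv iR qV) auto
      qed (intro primitive_diff_bound[OF F fq] E1 q_1 \<eta>; use C \<epsilon> in simp)
      also have "\<dots> = 2 * \<epsilon> * (\<Sum>r\<in>E. ?v r + ?S r) + C * (\<eta> * (?v q + ?S q) + \<eta> powr (1 - q) * ?R)"
      proof -
        have iE: "integrable lborel (\<lambda>x. \<bar>v n x\<bar> powr r + \<bar>S n x\<bar> powr r)" if "r \<in> E" for r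
          using E(2)[OF that] by (intro Bochner_Integration.integrable_add iv) auto
        have sE: "(LBINT x. (\<Sum>r\<in>E. \<bar>v n x\<bar> powr r + \<bar>S n x\<bar> powr r)) = (\<Sum>r\<in>E. ?v r + ?S r)"
          using E(2) iv by (subst Bochner_Integration.integral_sum[OF iE]) (auto intro!: sum.cong)
        have isE: "integrable lborel (\<lambda>x. \<Sum>r\<in>E. \<bar>v n x\<bar> powr r + \<bar>S n x\<bar> powr r)"
          by (intro Bochner_Integration.integrable_sum iE)
        show ?thesis
          using isE iR iv[OF qV] by (simp add: sE)
      qed
      also have "\<dots> \<le> 2 * \<epsilon> * M + (C * \<eta> * (2 * B q + 1) + C * \<eta> powr (1 - q) * ?R)"
      proof -
        have "(\<Sum>r\<in>E. ?v r + ?S r) \<le> M"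
          unfolding M_def
        proof (rule sum_mono)
          fix r assume "r \<in> E"
          then show "?v r + ?S r \<le> 2 * B r + 1" using B(2)[of r n] E(2)[of r] elim(3) by force
        qed
        then have 1: "2 * \<epsilon> * (\<Sum>r\<in>E. ?v r + ?S r) \<le> 2 * \<epsilon> * M" using \<epsilon> by (intro mult_left_mono) auto
        have "?v q + ?S q \<le> 2 * B q + 1" using B(2)[OF qV, of n] elim(4) by linarith
        then have "C * \<eta> * (?v q + ?S q) \<le> C * \<eta> * (2 * B q + 1)" using C \<eta> by (intro mult_left_mono) auto
        then show ?thesis using 1 by (simp add: algebra_simps)
      qed
      also have "\<dots> < \<delta> / 4 + (\<delta> / 4 + \<delta> / 4)"
      proof -
        have "?R < \<kappa>" using elim(1) by (simp add: S_def)
        then have "C * \<eta> powr (1 - q) * ?R < C * \<eta> powr (1 - q) * \<kappa>" using C \<eta> by (intro mult_strict_left_mono) auto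
        then show ?thesis using \<epsilon>M C\<eta> C\<kappa> by linarith
      qed
      finally show ?case using elim(2) by linarith
    qed
  qed
qed


lemma pstar_ge:
  assumes p: "1 < p" shows "ereal p \<le> pstar n p k"
proof (cases "real n > real k * p")
  case True
  have "p * (real n - real k * p) \<le> p * real n" using p by (intro mult_left_mono) auto
  then have "p \<le> p * real n / (real n - real k * p)" using True by (simp add: pos_le_divide_eq)
  then show ?thesis using True by (simp add: pstar_def)
qed (simp add: pstar_def)

theorem mainTheorem17:
  fixes p :: real and m :: nat
    and u :: "nat \<Rightarrow> real^'n::finite \<Rightarrow> real"
    and \<Lambda> :: enat and \<nu> :: "nat \<Rightarrow> nat"
    and w :: "nat \<Rightarrow> real^'n \<Rightarrow> real" and y :: "nat \<Rightarrow> nat \<Rightarrow> real^'n"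
    and \<alpha> :: "'n mindex" and f :: "real \<Rightarrow> real" and F :: "real \<Rightarrow> real"
  assumes p: "1 < p" and m: "m \<ge> 1"
    and u_sob: "\<forall>n. sobolev m p (u n)"
    and u_bdd: "\<exists>B. \<forall>n. sob_norm m p (u n) \<le> B"
    and pd: "profile_decomp m p u \<Lambda> \<nu> w y"
    and \<alpha>: "mlen \<alpha> < m"
    and f_cont: "continuous_on UNIV f"
    and f_growth: "\<forall>\<epsilon>>0. \<exists>q C. p < q \<and> ereal q < pstar CARD('n) p (m - mlen \<alpha>) \<and> C > 0 \<and>
        (\<forall>s. \<bar>f s\<bar> \<le>
          (if pstar CARD('n) p (m - mlen \<alpha>) < \<infinity>
           then \<epsilon> * (\<bar>s\<bar> powr (p - 1) + \<bar>s\<bar> powr (real_of_ereal (pstar CARD('n) p (m - mlen \<alpha>)) - 1))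
                + C * \<bar>s\<bar> powr (q - 1)
           else \<epsilon> * \<bar>s\<bar> powr (p - 1) + C * \<bar>s\<bar> powr (q - 1)))"
    and F_def: "\<forall>s. F s = (LBINT t=0..s. f t)"
  shows "if \<Lambda> = \<infinity> then
           summable (\<lambda>l. \<integral>x. F (wd \<alpha> (w l) x) \<partial>lborel) \<and>
           (\<lambda>n. \<integral>x. F (wd \<alpha> (u (\<nu> n)) x) \<partial>lborel)
              \<longlonglongrightarrow> (\<Sum>l. \<integral>x. F (wd \<alpha> (w l) x) \<partial>lborel)
         else
           (\<lambda>n. \<integral>x. F (wd \<alpha> (u (\<nu> n)) x) \<partial>lborel)
              \<longlonglongrightarrow> (\<Sum>l\<le>the_enat \<Lambda>. \<integral>x. F (wd \<alpha> (w l) x) \<partial>lborel)"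
proof -
  let ?P = "pstar CARD('n) p (m - mlen \<alpha>)"
  define E where "E = (if ?P < \<infinity> then {p, real_of_ereal ?P} else {p})"
  define A where "A = {l. enat l \<le> \<Lambda>}"
  define v where "v n = wd \<alpha> (u (\<nu> n))" for n
  define W where "W l = wd \<alpha> (w l)" for l
  have \<alpha>m: "mlen \<alpha> \<le> m" using \<alpha> by simp
  have Pp: "ereal p \<le> ?P" by (rule pstar_ge[OF p])
  have P_real: "ereal (real_of_ereal ?P) = ?P" if "?P < \<infinity>"
    using that Pp by (cases ?P) auto
  have y0: "y 0 n = 0" for n using pd by (simp add: profile_decomp_def)
  have w_sob: "sobolev m p (w l)" if "l \<in> A" for l using pd that by (simp add: profile_decomp_def A_def)
  have shift_conv: "sob_weak_conv m p (\<lambda>n x. u (\<nu> n) (x + y l n)) (w l)" if "l \<in> A" for l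
    using pd that unfolding profile_decomp_def A_def by blast
  have rem_conv: "sob_weak_conv m p (\<lambda>n x. remainder u \<nu> w y L n (x + y 0 n)) (\<lambda>x. 0)" if "L \<in> A" for L
    using pd that unfolding profile_decomp_def A_def by blast
  \<comment> \<open>At l = 0 the centre is 0, so the clause about translated remainders speaks of
    the remainder itself.\<close>
  have rem_sob: "sobolev m p (remainder u \<nu> w y L n)" if "L \<in> A" for L n
    using rem_conv[OF that] unfolding sob_weak_conv_def by (simp add: y0)
  have yA: "filterlim (\<lambda>n. norm (y l n - y k n)) at_top sequentially" if "l \<in> A" "k \<in> A" "l \<noteq> k" for l k
    using pd that unfolding profile_decomp_def A_def by blast
  have A_down: "l \<in> A" if "L \<in> A" "l \<le> L" for L l
    using that order_trans[of "enat l" "enat L" \<Lambda>] by (simp add: A_def)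
  have E: "finite E" by (simp add: E_def)
  have E_le: "p \<le> r \<and> ereal r \<le> ?P" if "r \<in> E" for r
    using that Pp P_real by (auto simp: E_def split: if_splits) (metis ereal_less_eq(3))
  have E_eq: "r = p \<or> ereal r = ?P" if "r \<in> E" for r
    using that P_real by (auto simp: E_def split: if_splits)
  have growth: "\<exists>q C. p < q \<and> ereal q < ?P \<and> 0 < C \<and>
      (\<forall>s. \<bar>f s\<bar> \<le> \<epsilon> * (\<Sum>r\<in>E. \<bar>s\<bar> powr (r - 1)) + C * \<bar>s\<bar> powr (q - 1))" if \<epsilon>: "0 < \<epsilon>" for \<epsilon>
  proof -
    obtain q C where q: "p < q" "ereal q < ?P" "0 < C" and le: "\<And>s. \<bar>f s\<bar> \<le>
          (if ?P < \<infinity> then \<epsilon> * (\<bar>s\<bar> powr (p - 1) + \<bar>s\<bar> powr (real_of_ereal ?P - 1)) + C * \<bar>s\<bar> powr (q - 1)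
           else \<epsilon> * \<bar>s\<bar> powr (p - 1) + C * \<bar>s\<bar> powr (q - 1))"
      using f_growth \<epsilon> by blast
    \<comment> \<open>\<open>q\<close> lies strictly between the two exponents, so the sum over
      \<open>E\<close> really has both terms and matches the growth condition.\<close>
    have "p \<noteq> real_of_ereal ?P" if "?P < \<infinity>"
    proof -
      have "ereal p < ereal (real_of_ereal ?P)"
        unfolding P_real[OF that] using q less_trans[of "ereal p" "ereal q" ?P] by simp
      then show ?thesis by simp
    qed
    then have "\<bar>f s\<bar> \<le> \<epsilon> * (\<Sum>r\<in>E. \<bar>s\<bar> powr (r - 1)) + C * \<bar>s\<bar> powr (q - 1)" for s
      using le[of s] by (auto simp: E_def split: if_splits)
    then show ?thesis using q by blast
  qed
  have F_eq: "F = (\<lambda>s. LBINT t=ereal 0..ereal s. f t)" using F_def by (auto simp: zero_ereal_def)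
  have F_deriv: "(F has_real_derivative f s) (at s)" for s
  proof -
    \<comment> \<open>The fundamental theorem is applied on a compact interval around the base point
      0 that contains \<open>s\<close> in its interior.\<close>
    define R where "R = \<bar>s\<bar> + 1"
    have "((\<lambda>u. LBINT t=ereal 0..ereal u. f t) has_vector_derivative f s) (at s within {- R..R})"
      by (rule interval_integral_FTC2) (auto simp: R_def intro: continuous_on_subset[OF f_cont])
    then have "(F has_vector_derivative f s) (at s within {- R<..<R})"
      unfolding F_eq by (rule has_vector_derivative_within_subset) auto
    then have "(F has_vector_derivative f s) (at s)"
      by (subst (asm) at_within_open) (auto simp: R_def)
    then show ?thesis by (simp add: has_real_derivative_iff_has_vector_derivative)
  qed
  have F0: "F 0 = 0" unfolding F_eq by (simp add: interval_lebesgue_integral_def set_lebesgue_integral_def)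
  have v_bound: "\<exists>B. \<forall>n. Lp r (v n) \<and> Lp_mass r (v n) \<le> B" if r: "p \<le> r" "ereal r \<le> ?P" for r
  proof -
    obtain B where B: "\<And>n. sob_norm m p (u n) \<le> B" using u_bdd by blast
    show ?thesis using sobolev_bound[OF p r \<alpha>m, of B] u_sob B unfolding v_def by blast
  qed
  have W_Lp: "Lp r (W l)" if "l \<in> A" "p \<le> r" "ereal r \<le> ?P" for l r
    using sobolev_bound[OF p that(2,3) \<alpha>m, of "sob_norm m p (w l)"] w_sob[OF that(1)] unfolding W_def by blast
  have wv: "weak_deriv \<alpha> (u (\<nu> n)) (v n)" for n
    unfolding v_def using u_sob by (intro sobolev_weak_deriv_wd[OF _ \<alpha>m]) blast
  have wW: "weak_deriv \<alpha> (w l) (W l)" if "l \<in> A" for l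
    unfolding W_def by (rule sobolev_weak_deriv_wd[OF w_sob[OF that] \<alpha>m])
  have vm [measurable]: "v n \<in> borel_measurable borel" for n
    using wv by (auto simp: weak_deriv_def locint_borel)
  \<comment> \<open>The hypothesis concerns the chosen derivative of a translate, the claim the
    translate of a chosen derivative; both are weak derivatives of one function and agree almost
    everywhere.\<close>
  have weak: "(\<lambda>n. LBINT x. v n (x + y l n) * g x) \<longlonglongrightarrow> (LBINT x. W l x * g x)"
    if l: "l \<in> A" and g: "Lp (p / (p - 1)) g" for l g
  proof -
    have [measurable]: "g \<in> borel_measurable borel" using g by (rule Lp_borel)
    have "(LBINT x. wd \<alpha> (\<lambda>x. u (\<nu> n) (x + y l n)) x * g x) = (LBINT x. v n (x + y l n) * g x)" for n
    proof -
      have "sobolev m p (\<lambda>x. u (\<nu> n) (x + y l n))" using shift_conv[OF l] by (simp add: sob_weak_conv_def)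
      then have w1: "weak_deriv \<alpha> (\<lambda>x. u (\<nu> n) (x + y l n)) (wd \<alpha> (\<lambda>x. u (\<nu> n) (x + y l n)))"
        by (rule sobolev_weak_deriv_wd[OF _ \<alpha>m])
      then have [measurable]: "wd \<alpha> (\<lambda>x. u (\<nu> n) (x + y l n)) \<in> borel_measurable borel"
        by (auto simp: weak_deriv_def locint_borel)
      have "AE x in lborel. wd \<alpha> (\<lambda>x. u (\<nu> n) (x + y l n)) x = v n (x + y l n)"
        by (rule weak_deriv_unique[OF w1 weak_deriv_translate[OF wv]])
      then show ?thesis by (intro integral_cong_AE) (measurable, auto)
    qed
    moreover have "(\<lambda>n. LBINT x. wd \<alpha> (\<lambda>x. u (\<nu> n) (x + y l n)) x * g x) \<longlonglongrightarrow> (LBINT x. W l x * g x)"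
      using shift_conv[OF l] \<alpha>m g unfolding sob_weak_conv_def W_def by blast
    ultimately show ?thesis by simp
  qed
  \<comment> \<open>Linearity and translation give a second weak derivative of the remainder, which
    agrees with \<open>wd\<close> of it almost everywhere.\<close>
  have rem_powr: "(LBINT x. \<bar>v n x - (\<Sum>l\<le>L. W l (x - y l n))\<bar> powr q) = Lp_norm q (wd \<alpha> (remainder u \<nu> w y L n)) powr q"
    if L: "L \<in> A" and q: "0 < q" for L n q
  proof -
    have w1: "weak_deriv \<alpha> (remainder u \<nu> w y L n) (wd \<alpha> (remainder u \<nu> w y L n))"
      by (rule sobolev_weak_deriv_wd[OF rem_sob[OF L] \<alpha>m])
    have "weak_deriv \<alpha> (\<lambda>x. w l (x - y l n)) (\<lambda>x. W l (x - y l n))" if "l \<in> {..L}" for l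
      using weak_deriv_translate[OF wW, of l "- y l n"] A_down[OF L] that by simp
    then have w2: "weak_deriv \<alpha> (remainder u \<nu> w y L n) (\<lambda>x. v n x - (\<Sum>l\<le>L. W l (x - y l n)))"
      unfolding remainder_def by (intro weak_deriv_diff wv weak_deriv_sum)
    have [measurable]: "wd \<alpha> (remainder u \<nu> w y L n) \<in> borel_measurable borel"
      "(\<lambda>x. v n x - (\<Sum>l\<le>L. W l (x - y l n))) \<in> borel_measurable borel"
      using w1 w2 by (auto simp: weak_deriv_def locint_borel)
    have "(LBINT x. \<bar>v n x - (\<Sum>l\<le>L. W l (x - y l n))\<bar> powr q) = (LBINT x. \<bar>wd \<alpha> (remainder u \<nu> w y L n) x\<bar> powr q)"
    proof (rule integral_cong_AE)
      show "AE x in lborel. \<bar>v n x - (\<Sum>l\<le>L. W l (x - y l n))\<bar> powr q = \<bar>wd \<alpha> (remainder u \<nu> w y L n) x\<bar> powr q"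
        using weak_deriv_unique[OF w1 w2] by eventually_elim simp
    qed measurable
    then show ?thesis using q by (simp add: Lp_norm_powr)
  qed
  have rem_small: "\<exists>L0\<in>A. \<forall>L\<in>A. L0 \<le> L \<longrightarrow>
      (\<forall>\<^sub>F n in sequentially. (LBINT x. \<bar>v n x - (\<Sum>l\<le>L. W l (x - y l n))\<bar> powr q) < \<kappa>)"
    if q: "p < q" "ereal q < ?P" and \<kappa>: "0 < \<kappa>" for q \<kappa>
  proof -
    define a where "a L = limsup (\<lambda>n. ereal (Lp_norm q (wd \<alpha> (remainder u \<nu> w y L n))))" for L
    have lim: "if \<Lambda> = \<infinity> then a \<longlonglongrightarrow> 0 else a (the_enat \<Lambda>) = 0"
      using pd \<alpha> q unfolding profile_decomp_def a_def Let_def by blast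
    have q0: "0 < q" using p q by simp
    have pos: "(0::ereal) < ereal (\<kappa> powr (1 / q))" using \<kappa> by simp
    have small: "\<forall>\<^sub>F n in sequentially. (LBINT x. \<bar>v n x - (\<Sum>l\<le>L. W l (x - y l n))\<bar> powr q) < \<kappa>"
      if L: "L \<in> A" and aL: "a L < ereal (\<kappa> powr (1 / q))" for L
      using Limsup_lessD[OF aL[unfolded a_def]]
    proof eventually_elim
      case (elim n)
      then have "Lp_norm q (wd \<alpha> (remainder u \<nu> w y L n)) powr q < (\<kappa> powr (1 / q)) powr q"
        using q0 by (intro powr_less_mono2) (auto simp: Lp_norm_def)
      also have "\<dots> = \<kappa>" using q0 \<kappa> by (simp add: powr_powr)
      finally show ?case by (simp add: rem_powr[OF L q0])
    qed
    show ?thesis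
    proof (cases "\<Lambda> = \<infinity>")
      case True
      then have "\<forall>\<^sub>F L in sequentially. a L < ereal (\<kappa> powr (1 / q))" using lim pos by (auto intro: order_tendstoD(2))
      then obtain L0 where "\<And>L. L0 \<le> L \<Longrightarrow> a L < ereal (\<kappa> powr (1 / q))" by (auto simp: eventually_sequentially)
      then show ?thesis using small True by (intro bexI[of _ L0]) (auto simp: A_def)
    next
      case False
      then obtain k where k: "\<Lambda> = enat k" by (cases \<Lambda>) auto
      have "a k < ereal (\<kappa> powr (1 / q))" using lim False k pos by simp
      \<comment> \<open>\<open>k\<close> is the largest index in \<open>A\<close>, so
        \<open>L = k\<close> is the only one to consider.\<close>
      then show ?thesis using small k by (intro bexI[of _ k]) (auto simp: A_def dest: antisym)
    qed
  qed
  have core: "\<exists>L0\<in>A. \<forall>L\<in>A. L0 \<le> L \<longrightarrow>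
      (\<forall>\<^sub>F n in sequentially. \<bar>(LBINT x. F (v n x)) - (\<Sum>l\<le>L. LBINT x. F (W l x))\<bar> < \<delta>)" if "0 < \<delta>" for \<delta>
    by (rule profile_integral_limit[OF p E E_le E_eq F_deriv F0 growth v_bound W_Lp weak yA A_down rem_small that])
  define I where "I n = (LBINT x. F (v n x))" for n
  define s where "s L = (\<Sum>l\<le>L. LBINT x. F (W l x))" for L
  show ?thesis
  proof (cases "\<Lambda> = \<infinity>")
    case True
    then have A_UNIV: "A = UNIV" by (auto simp: A_def)
    have s_near: "\<exists>L0. \<forall>L\<ge>L0. \<forall>\<^sub>F n in sequentially. \<bar>I n - s L\<bar> < \<delta>" if "0 < \<delta>" for \<delta>
      using core[OF that] by (auto simp: A_UNIV I_def s_def)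
    \<comment> \<open>Two partial sums are compared through one \<open>n\<close> that is large
      enough for both, without presupposing a limit of \<open>I\<close>.\<close>
    have "Cauchy s"
    proof (rule metric_CauchyI)
      fix e :: real assume "0 < e"
      then obtain L0 where L0: "\<And>L. L0 \<le> L \<Longrightarrow> \<forall>\<^sub>F n in sequentially. \<bar>I n - s L\<bar> < e / 2"
        using s_near[of "e / 2"] by auto
      show "\<exists>M. \<forall>j\<ge>M. \<forall>k\<ge>M. dist (s j) (s k) < e"
      proof (intro exI[of _ L0] allI impI)
        fix j k assume "L0 \<le> j" "L0 \<le> k"
        from eventually_conj[OF L0[OF this(1)] L0[OF this(2)]]
        obtain n where "\<bar>I n - s j\<bar> < e / 2" "\<bar>I n - s k\<bar> < e / 2"
          using eventually_happens trivial_limit_sequentially by blast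
        then show "dist (s j) (s k) < e" unfolding dist_real_def by linarith
      qed
    qed
    then obtain \<sigma> where \<sigma>: "s \<longlonglongrightarrow> \<sigma>" by (auto simp: Cauchy_convergent_iff convergent_def)
    then have sums: "(\<lambda>l. LBINT x. F (W l x)) sums \<sigma>"
      unfolding sums_def_le s_def .
    have "I \<longlonglongrightarrow> \<sigma>"
      unfolding tendsto_iff
    proof (intro allI impI)
      fix e :: real assume e: "0 < e"
      obtain L0 where L0: "\<And>L. L0 \<le> L \<Longrightarrow> \<forall>\<^sub>F n in sequentially. \<bar>I n - s L\<bar> < e / 2"
        using s_near[of "e / 2"] e by auto
      have "\<forall>\<^sub>F L in sequentially. \<bar>s L - \<sigma>\<bar> < e / 2"
        using tendstoD[OF \<sigma>, of "e / 2"] e by (simp add: dist_real_def del: less_divide_eq_numeral1)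
      then have "\<forall>\<^sub>F L in sequentially. L0 \<le> L \<and> \<bar>s L - \<sigma>\<bar> < e / 2"
        by (intro eventually_conj eventually_ge_at_top)
      then obtain L where L: "L0 \<le> L" "\<bar>s L - \<sigma>\<bar> < e / 2"
        using eventually_happens trivial_limit_sequentially by blast
      show "\<forall>\<^sub>F n in sequentially. dist (I n) \<sigma> < e"
        using L0[OF L(1)]
      proof eventually_elim
        case (elim n)
        then show ?case using L(2) unfolding dist_real_def by linarith
      qed
    qed
    then show ?thesis using True sums by (auto simp: I_def[abs_def] v_def W_def sums_iff)
  next
    case False
    then obtain k where k: "\<Lambda> = enat k" by (cases \<Lambda>) auto
    have "I \<longlonglongrightarrow> s k"
      unfolding tendsto_iff
    proof (intro allI impI)
      fix e :: real assume "0 < e"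
      then obtain L0 where L0: "L0 \<in> A" "\<And>L. L \<in> A \<Longrightarrow> L0 \<le> L \<Longrightarrow> \<forall>\<^sub>F n in sequentially. \<bar>I n - s L\<bar> < e"
        using core[of e] unfolding I_def s_def by blast
      then have "\<forall>\<^sub>F n in sequentially. \<bar>I n - s k\<bar> < e" using k by (intro L0(2)) (auto simp: A_def)
      then show "\<forall>\<^sub>F n in sequentially. dist (I n) (s k) < e" by (simp add: dist_real_def)
    qed
    then show ?thesis using False k by (simp add: I_def[abs_def] s_def v_def W_def)
  qed
qed

end
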